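(* We have that $$\inf_{\hat\theta_n}\ \sup_{\theta\in\mathcal T}\ \mathbb E\big[\rho(\hat\theta_n,\theta)\big]\ \asymp\ \frac{\sigma^2}{\sqrt n},$$ where the infimum is taken over all estimators $\hat\theta_n$ based on $n$ samples $X_1,\dots,X_n$.
   Context: Fix a dimension $L$ and identify $\mathbb R^L$ with the space of functions $\mathbb Z/L\mathbb Z\to\mathbb R$. Let $\mathcal R=\{R^{(\ell)}:1\le \ell\le L\}$ be the group of cyclic coordinate shifts, $(R^{(\ell)}\theta)(i)=\theta(i+\ell)$. For $\theta,\phi\in\mathbb R^L$ let $\rho(\theta,\phi)=\min_{G\in\mathcal R}\|\theta-G\phi\|$, where $\|\cdot\|$ is the Euclidean norm. Given an unknown signal $\theta\in\mathbb R^L$ and a noise level $\sigma>0$ (both $L$ and $\sigma$ are assumed known), the samples are $X_i=G_i\theta+\sigma\xi_i$, $i=1,\dots,n$, where the $G_i$ are drawn independently and uniformly at random from $\mathcal R$ and the $\xi_i\sim\mathcal N(0,I_L)$ are i.i.d. and independent of the $G_i$. The expectation $\mathbb E$ is over these samples. A vector $\theta\in\mathbb R^L$ is collision-free if each element of the multiset $\mathcal D(\theta)=\{i-j\ (\mathrm{mod}\ L): i,j\in\mathrm{supp}(\theta),\ i\ne j\}$ appears with multiplicity exactly $1$. $\mathcal T$ denotes the set of signals $\theta\in\mathbb R^L$ such that (i) $\theta$ is collision-free; (ii) $\sigma\ge\|\theta\|$; (iii) for given positive constants $m,M,\epsilon$, $m\le|\theta(i)|\le M$ for all $i\in\mathrm{supp}(\theta)$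 and $s:=|\mathrm{supp}(\theta)|\ge\max\{7,(2+\epsilon)M^2/m^2\}$. The quantities $L,m,M,\epsilon$ are fixed throughout; only the dependence on $\sigma$ and $s$ is tracked. The symbol $\asymp$ means equality of order, i.e. each side is bounded by a positive constant multiple of the other.
   Formalization: The equality of order is proved, with constants independent of σ and s, for all n beyond a threshold depending on σ (it fails for n much smaller than σ⁴); the lower bound is claimed only when the class T is infinite, since it fails when T is empty or finite (for example m = M). *)

theory Defs
  imports "HOL-Probability.Probability" "Berlekamp_Zassenhaus.Finite_Field"
begin

text \<open>
  The type \<open>'l mod_ring\<close> is the ring of integers modulo \<open>L = CARD('l)\<close>, so a signal
  \<open>\<theta> :: real ^ 'l mod_ring\<close> is a function from Z/L to the reals, with the Euclidean norm.
  As \<open>'l\<close> ranges over the finite types, \<open>L\<close> ranges over all positive integers.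
\<close>

definition shift :: "'l::finite mod_ring \<Rightarrow> real ^ 'l mod_ring \<Rightarrow> real ^ 'l mod_ring" where
  "shift l \<theta> = (\<chi> i. \<theta> $ (i + l))"

definition rho :: "real ^ 'l::finite mod_ring \<Rightarrow> real ^ 'l mod_ring \<Rightarrow> real" where
  "rho \<theta> \<phi> = Min (range (\<lambda>l. norm (\<theta> - shift l \<phi>)))"

definition supp :: "real ^ 'l::finite mod_ring \<Rightarrow> 'l mod_ring set" where
  "supp \<theta> = {i. \<theta> $ i \<noteq> 0}"

definition diffs :: "real ^ 'l::finite mod_ring \<Rightarrow> 'l mod_ring multiset" where
  "diffs \<theta> = image_mset (\<lambda>(i, j). i - j) (mset_set {(i, j). i \<in> supp \<theta> \<and> j \<in> supp \<theta> \<and> i \<noteq> j})"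

definition collision_free :: "real ^ 'l::finite mod_ring \<Rightarrow> bool" where
  "collision_free \<theta> \<longleftrightarrow> (\<forall>d \<in># diffs \<theta>. count (diffs \<theta>) d = 1)"

definition signals :: "real \<Rightarrow> real \<Rightarrow> real \<Rightarrow> real \<Rightarrow> (real ^ 'l::finite mod_ring) set" where
  "signals m M \<epsilon> \<sigma> = {\<theta>. collision_free \<theta> \<and> norm \<theta> \<le> \<sigma> \<and>
     (\<forall>i \<in> supp \<theta>. m \<le> \<bar>\<theta> $ i\<bar> \<and> \<bar>\<theta> $ i\<bar> \<le> M) \<and>
     max 7 ((2 + \<epsilon>) * M\<^sup>2 / m\<^sup>2) \<le> real (card (supp \<theta>))}"

text \<open>The law N(0, I) of a vector with independent standard normal coordinates.\<close>

definition std_gaussian :: "(real ^ 'k::finite) measure" where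
  "std_gaussian = distr (\<Pi>\<^sub>M i\<in>UNIV. std_normal_distribution) borel (\<lambda>f. \<chi> i. f i)"

text \<open>The law of one observation \<open>X = G \<theta> + \<sigma> \<xi>\<close>, where \<open>G\<close> is a uniform cyclic shift and \<open>\<xi>\<close> an
  independent standard Gaussian vector.\<close>

definition sample_law :: "real \<Rightarrow> real ^ 'l::finite mod_ring \<Rightarrow> (real ^ 'l mod_ring) measure" where
  "sample_law \<sigma> \<theta> = distr (measure_pmf (pmf_of_set UNIV) \<Otimes>\<^sub>M std_gaussian) borel
     (\<lambda>(l, \<xi>). shift l \<theta> + \<sigma> *\<^sub>R \<xi>)"

definition samples_law :: "nat \<Rightarrow> real \<Rightarrow> real ^ 'l::finite mod_ring \<Rightarrow> (nat \<Rightarrow> real ^ 'l mod_ring) measure" where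
  "samples_law n \<sigma> \<theta> = (\<Pi>\<^sub>M k\<in>{..<n}. sample_law \<sigma> \<theta>)"

definition estimators :: "nat \<Rightarrow> ((nat \<Rightarrow> real ^ 'l::finite mod_ring) \<Rightarrow> real ^ 'l mod_ring) set" where
  "estimators n = (\<Pi>\<^sub>M k\<in>{..<n}. borel) \<rightarrow>\<^sub>M borel"

text \<open>The expected loss is a nonnegative Lebesgue integral, so that an estimator whose loss is not
  integrable has risk \<open>\<infinity>\<close>.\<close>

definition risk :: "nat \<Rightarrow> real \<Rightarrow> ((nat \<Rightarrow> real ^ 'l::finite mod_ring) \<Rightarrow> real ^ 'l mod_ring) \<Rightarrow>
    real ^ 'l mod_ring \<Rightarrow> ennreal" where
  "risk n \<sigma> est \<theta> = (\<integral>\<^sup>+ X. ennreal (rho (est X) \<theta>) \<partial>samples_law n \<sigma> \<theta>)"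

definition minimax_risk :: "nat \<Rightarrow> real \<Rightarrow> (real ^ 'l::finite mod_ring) set \<Rightarrow> ennreal" where
  "minimax_risk n \<sigma> T = (INF est \<in> estimators n. SUP \<theta> \<in> T. risk n \<sigma> est \<theta>)"

lemma measurable_vec_lambda_PiM:
  "(\<lambda>f. (\<chi> i. f i) :: real ^ 'k) \<in> (\<Pi>\<^sub>M i\<in>(UNIV :: 'k::finite set). borel) \<rightarrow>\<^sub>M borel"
  unfolding borel_measurable_euclidean_space [where 'c = "real ^ 'k"]
  by (auto simp: Basis_vec_def inner_axis)

lemma prob_space_std_gaussian: "prob_space (std_gaussian :: (real ^ 'k::finite) measure)"
proof -
  have p: "prob_space std_normal_distribution"
    by (intro prob_space_normal_density) auto
  interpret product_prob_space "\<lambda>_ :: 'k. std_normal_distribution" UNIV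
    by (simp add: product_prob_space_def product_prob_space_axioms_def product_sigma_finite_def
        p prob_space_imp_sigma_finite)
  have "sets (\<Pi>\<^sub>M i\<in>(UNIV :: 'k set). std_normal_distribution) = sets (\<Pi>\<^sub>M i\<in>(UNIV :: 'k set). borel)"
    by (intro sets_PiM_cong) auto
  from measurable_cong_sets [OF this refl] show ?thesis
    unfolding std_gaussian_def
    by (intro prob_space_distr) (use measurable_vec_lambda_PiM in auto)
qed

lemma measurable_observation:
  "(\<lambda>(l, \<xi>). shift l \<theta> + \<sigma> *\<^sub>R \<xi>) \<in>
     measure_pmf (pmf_of_set UNIV) \<Otimes>\<^sub>M std_gaussian \<rightarrow>\<^sub>M (borel :: (real ^ 'l::finite mod_ring) measure)"
proof -
  have [measurable]: "(\<lambda>l. shift l \<theta>) \<in> measure_pmf (pmf_of_set UNIV) \<rightarrow>\<^sub>M borel"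
    by simp
  have [measurable]: "(\<lambda>\<xi>. \<xi>) \<in> (std_gaussian :: (real ^ 'l mod_ring) measure) \<rightarrow>\<^sub>M borel"
    by (simp add: std_gaussian_def measurable_def)
  show ?thesis
    by measurable
qed

lemma prob_space_sample_law: "prob_space (sample_law \<sigma> \<theta>)"
proof -
  interpret G: prob_space "std_gaussian :: (real ^ 'a mod_ring) measure"
    by (rule prob_space_std_gaussian)
  interpret pair_prob_space "measure_pmf (pmf_of_set (UNIV :: 'a mod_ring set))"
    "std_gaussian :: (real ^ 'a mod_ring) measure" ..
  show ?thesis
    unfolding sample_law_def
    by (intro prob_space_distr measurable_observation)
qed

end

theory Submission
  imports Defs "HOL-Real_Asymp.Real_Asymp"
begin

text \<open>
  Upper bound: for a collision-free signal the autocorrelation at \<open>i - j\<close> is the single product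
  \<open>\<theta> i * \<theta> j\<close>, and three such products determine an entry, so near the true orbit the autocorrelations
  control the orbit distance linearly; they are estimated at rate \<open>\<sigma>\<^sup>2 / sqrt n\<close>. Exponential
  moments separate all orbits, and by compactness finitely many of them separate all pairs of signals
  at distance at least \<open>m\<close>. Scaled down by a factor depending on \<open>\<sigma>\<close>, they are added as features to a
  minimum distance estimator: they do not affect the rate, and excluding a wrong orbit costs only
  \<open>O(1 / n)\<close>, with a constant depending on \<open>\<sigma>\<close>.

  Lower bound: two signals on a segment of length of order \<open>\<sigma>\<^sup>2 / sqrt n\<close> have bounded \<open>n\<close>-sample
  chi-square distance. Recentering at the coordinate mean, Jensen's inequality bounds the reference
  density below, and the chi-square distance becomes a second difference of orbit averages of
  exponentials whose first-order term is the squared difference of the coordinate sums.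
\<close>


section \<open>Cyclic shifts and the orbit distance\<close>

text \<open>The obstacle is uniformity in \<open>\<sigma>\<close>: both constants precede
  \<open>\<sigma>\<close>, and only the threshold on \<open>n\<close> may depend on it. The bound
  \<open>D = CARD('l) * M\<close> on all signal norms, free of \<open>\<sigma>\<close>, makes this
  possible. Upper side: the exponents \<open>N\<close> come from compactness of the ball of radius
  \<open>D\<close>, so the number of features is fixed. Their weights, and with them the gap
  \<open>\<gamma>\<close>, depend on \<open>\<sigma>\<close>, but \<open>\<gamma>\<close> enters
  only the coefficient of a term quadratic in the standard error \<open>s\<close>, which a large
  sample makes smaller than \<open>s\<close>. Lower side: in units of \<open>\<sigma>\<close> the
  signals have norm at most \<open>D / \<sigma>\<close>, and a displacement \<open>t\<close>
  contributes a second-order part of order \<open>D\<^sup>2 * t\<^sup>2 / \<sigma> ^ 4\<close> to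
  the chi-square distance. This is of order \<open>1 / n\<close> exactly for \<open>t\<close> of
  order \<sigma>^2 / sqrt n. The first-order part is of order
  \<open>t\<^sup>2 / \<sigma>\<^sup>2\<close>, too large once \<open>\<sigma>\<close> is far above
  \<open>D\<close>: the mean of a signal is easier to estimate than its shape. Hence directions of
  sum zero are needed there.\<close>

lemma shift_nth [simp]: "shift l \<theta> $ i = \<theta> $ (i + l)"
  by (simp add: shift_def)

lemma shift_add: "shift l (a + b) = shift l a + shift l b"
  by (simp add: vec_eq_iff)

lemma shift_diff: "shift l (a - b) = shift l a - shift l b"
  by (simp add: vec_eq_iff)

lemma shift_scaleR: "shift l (c *\<^sub>R a) = c *\<^sub>R shift l a"
  by (simp add: vec_eq_iff)

lemma shift_shift: "shift k (shift l a) = shift (k + l) a"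
  by (simp add: vec_eq_iff add.assoc)

lemma shift_0 [simp]: "shift 0 a = a"
  by (simp add: vec_eq_iff)

lemma sum_shift: "(\<Sum>i\<in>UNIV. f (i + l)) = (\<Sum>i\<in>(UNIV :: 'l::finite mod_ring set). f i)"
  by (rule sum.reindex_bij_witness[of _ "\<lambda>i. i - l" "\<lambda>i. i + l"]) auto

lemma inner_shift_shift: "shift l a \<bullet> shift l b = a \<bullet> b"
  using sum_shift[of "\<lambda>i. a $ i * b $ i" l] by (simp add: inner_vec_def)

lemma inner_shift_left: "shift l a \<bullet> b = a \<bullet> shift (- l) b"
  using inner_shift_shift[of l a "shift (- l) b"] by (simp add: shift_shift)

lemma norm_shift [simp]: "norm (shift l a) = norm a"
  by (simp add: norm_eq_sqrt_inner inner_shift_shift)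

lemma rho_le: "rho x \<theta> \<le> norm (x - shift l \<theta>)"
  unfolding rho_def by (rule Min_le) auto

lemma rho_attained: obtains l where "rho x \<theta> = norm (x - shift l \<theta>)"
proof -
  have "rho x \<theta> \<in> range (\<lambda>l. norm (x - shift l \<theta>))"
    unfolding rho_def by (rule Min_in) auto
  then show ?thesis using that by blast
qed

lemma rho_nonneg: "0 \<le> rho x \<theta>"
  by (rule rho_attained[of x \<theta>]) simp

lemma rho_le_norm_add: "rho x \<theta> \<le> norm x + norm \<theta>"
  using rho_le[of x \<theta> 0] norm_triangle_ineq4[of x \<theta>] by simp

text \<open>Shifts are isometries: the best shifts \<open>l\<close> and \<open>k\<close> towards
  \<open>x\<close> differ by \<open>k - l\<close>, which competes in the minimum
  \<open>rho \<theta> \<phi>\<close>.\<close>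

lemma rho_triangle: "rho \<theta> \<phi> \<le> rho x \<theta> + rho x \<phi>"
proof -
  obtain l where l: "rho x \<theta> = norm (x - shift l \<theta>)" by (rule rho_attained)
  obtain k where k: "rho x \<phi> = norm (x - shift k \<phi>)" by (rule rho_attained)
  have "rho \<theta> \<phi> \<le> norm (\<theta> - shift (k - l) \<phi>)" by (rule rho_le)
  also have "\<dots> = norm (shift l (\<theta> - shift (k - l) \<phi>))" by simp
  also have "shift l (\<theta> - shift (k - l) \<phi>) = (x - shift k \<phi>) - (x - shift l \<theta>)"
    by (simp add: shift_diff shift_shift)
  also have "norm \<dots> \<le> norm (x - shift k \<phi>) + norm (x - shift l \<theta>)"
    by (rule norm_triangle_ineq4)
  finally show ?thesis by (simp add: l k)
qed

lemma rho_Lipschitz: "rho x \<theta> \<le> norm (x - y) + rho y \<theta>"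
proof -
  obtain l where l: "rho y \<theta> = norm (y - shift l \<theta>)" by (rule rho_attained)
  have "rho x \<theta> \<le> norm (x - shift l \<theta>)" by (rule rho_le)
  also have "\<dots> \<le> norm (x - y) + norm (y - shift l \<theta>)"
    using norm_triangle_ineq[of "x - y" "y - shift l \<theta>"] by simp
  finally show ?thesis by (simp add: l)
qed

lemma measurable_rho [measurable]: "(\<lambda>x. rho x \<theta>) \<in> borel_measurable borel"
proof (rule borel_measurable_continuous_onI)
  have "1-lipschitz_on UNIV (\<lambda>x. rho x \<theta>)"
  proof (rule lipschitz_onI)
    fix x y :: "real ^ 'a mod_ring"
    show "dist (rho x \<theta>) (rho y \<theta>) \<le> 1 * dist x y"
      using rho_Lipschitz[of x \<theta> y] rho_Lipschitz[of y \<theta> x]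
      by (simp add: dist_norm norm_minus_commute)
  qed simp
  then show "continuous_on UNIV (\<lambda>x. rho x \<theta>)"
    by (rule lipschitz_on_continuous_on)
qed

section \<open>The Gaussian law\<close>

lemma prob_space_std_normal: "prob_space std_normal_distribution"
  by (intro prob_space_normal_density) auto

lemma product_prob_space_std_normal: "product_prob_space (\<lambda>_ :: 'k. std_normal_distribution)"
  by (simp add: product_prob_space_def product_prob_space_axioms_def product_sigma_finite_def
      prob_space_std_normal prob_space_imp_sigma_finite)

lemma sets_std_gaussian [simp, measurable_cong]: "sets std_gaussian = sets borel"
  by (simp add: std_gaussian_def)

lemma space_std_gaussian [simp]: "space std_gaussian = UNIV"
  by (simp add: std_gaussian_def)

lemma sets_sample_law [simp, measurable_cong]: "sets (sample_law \<sigma> \<theta>) = sets borel"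
  by (simp add: sample_law_def)

lemma space_sample_law [simp]: "space (sample_law \<sigma> \<theta>) = UNIV"
  by (simp add: sample_law_def)

lemma measurable_vec_lambda_std_normal:
  "(\<lambda>f. (\<chi> i. f i) :: real ^ 'k) \<in> (\<Pi>\<^sub>M i\<in>(UNIV :: 'k::finite set). std_normal_distribution) \<rightarrow>\<^sub>M borel"
proof -
  have "sets (\<Pi>\<^sub>M i\<in>(UNIV :: 'k set). std_normal_distribution) = sets (\<Pi>\<^sub>M i\<in>(UNIV :: 'k set). borel)"
    by (intro sets_PiM_cong) auto
  from measurable_cong_sets[OF this refl] show ?thesis
    using measurable_vec_lambda_PiM by auto
qed

text \<open>A finite product measure is determined on boxes, where density and indicator both factor
  over the coordinates. Serves the Gaussian translate as well as the passage from one sample to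
  \<open>n\<close>.\<close>

lemma PiM_density:
  fixes r :: "'i \<Rightarrow> 'a \<Rightarrow> ennreal"
  assumes fin: "finite I" and P: "\<And>i. prob_space (M i)" 
    and r: "\<And>i. r i \<in> borel_measurable (M i)"
    and Q: "\<And>i. prob_space (density (M i) (r i))"
  shows "(\<Pi>\<^sub>M i\<in>I. density (M i) (r i)) = density (\<Pi>\<^sub>M i\<in>I. M i) (\<lambda>x. \<Prod>i\<in>I. r i (x i))"
proof -
  interpret M: product_sigma_finite M
    by (simp add: product_sigma_finite_def P prob_space_imp_sigma_finite)
  interpret N: product_sigma_finite "\<lambda>i. density (M i) (r i)"
    by (simp add: product_sigma_finite_def Q prob_space_imp_sigma_finite)
  note [measurable] = r
  show ?thesis
  proof (rule N.PiM_eqI[OF fin, symmetric])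
    show "sets (density (\<Pi>\<^sub>M i\<in>I. M i) (\<lambda>x. \<Prod>i\<in>I. r i (x i))) = sets (\<Pi>\<^sub>M i\<in>I. density (M i) (r i))"
      by (auto intro!: sets_PiM_cong)
  next
    fix A assume A: "\<And>i. i \<in> I \<Longrightarrow> A i \<in> sets (density (M i) (r i))"
    then have A': "A i \<in> sets (M i)" if "i \<in> I" for i using that by simp
    have "emeasure (density (\<Pi>\<^sub>M i\<in>I. M i) (\<lambda>x. \<Prod>i\<in>I. r i (x i))) (Pi\<^sub>E I A) =
        (\<integral>\<^sup>+ x. (\<Prod>i\<in>I. r i (x i)) * indicator (Pi\<^sub>E I A) x \<partial>Pi\<^sub>M I M)"
      by (subst emeasure_density) (use A' fin in \<open>auto intro!: sets_PiM_I_finite borel_measurable_prod\<close>)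
    also have "\<dots> = (\<integral>\<^sup>+ x. (\<Prod>i\<in>I. r i (x i) * indicator (A i) (x i)) \<partial>Pi\<^sub>M I M)"
    proof (rule nn_integral_cong)
      fix x assume x: "x \<in> space (Pi\<^sub>M I M)"
      have "indicator (Pi\<^sub>E I A) x = (\<Prod>i\<in>I. indicator (A i) (x i) :: ennreal)"
        using x fin by (auto simp: space_PiM PiE_iff indicator_def prod_zero_iff split: if_splits)
      then show "(\<Prod>i\<in>I. r i (x i)) * indicator (Pi\<^sub>E I A) x = (\<Prod>i\<in>I. r i (x i) * indicator (A i) (x i))"
        by (simp add: prod.distrib)
    qed
    also have "\<dots> = (\<Prod>i\<in>I. \<integral>\<^sup>+ y. r i y * indicator (A i) y \<partial>M i)"
      by (rule M.product_nn_integral_prod[OF fin]) (use A' in auto)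
    also have "\<dots> = (\<Prod>i\<in>I. emeasure (density (M i) (r i)) (A i))"
      using A' by (auto simp: emeasure_density intro!: prod.cong)
    finally show "emeasure (density (\<Pi>\<^sub>M i\<in>I. M i) (\<lambda>x. \<Prod>i\<in>I. r i (x i))) (Pi\<^sub>E I A) =
      (\<Prod>i\<in>I. emeasure (density (M i) (r i)) (A i))" .
  qed
qed

text \<open>Checked on boxes, whose preimages under coordinatewise maps are again boxes.\<close>

lemma PiM_distr:
  assumes fin: "finite I" and P: "\<And>i. prob_space (M i)"
    and f [measurable]: "\<And>i. f i \<in> M i \<rightarrow>\<^sub>M N i"
  shows "(\<Pi>\<^sub>M i\<in>I. distr (M i) (N i) (f i)) = distr (\<Pi>\<^sub>M i\<in>I. M i) (\<Pi>\<^sub>M i\<in>I. N i) (\<lambda>x. \<lambda>i\<in>I. f i (x i))"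
proof -
  interpret M: product_sigma_finite M
    by (simp add: product_sigma_finite_def P prob_space_imp_sigma_finite)
  interpret N: product_sigma_finite "\<lambda>i. distr (M i) (N i) (f i)"
    by (simp add: product_sigma_finite_def P prob_space_imp_sigma_finite prob_space.prob_space_distr f)
  have meas: "(\<lambda>x. \<lambda>i\<in>I. f i (x i)) \<in> Pi\<^sub>M I M \<rightarrow>\<^sub>M Pi\<^sub>M I N"
    by measurable
  show ?thesis
  proof (rule N.PiM_eqI[OF fin, symmetric])
    show "sets (distr (\<Pi>\<^sub>M i\<in>I. M i) (\<Pi>\<^sub>M i\<in>I. N i) (\<lambda>x. \<lambda>i\<in>I. f i (x i))) =
        sets (\<Pi>\<^sub>M i\<in>I. distr (M i) (N i) (f i))"
      by (auto intro!: sets_PiM_cong)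
  next
    fix A assume A: "\<And>i. i \<in> I \<Longrightarrow> A i \<in> sets (distr (M i) (N i) (f i))"
    then have A': "A i \<in> sets (N i)" if "i \<in> I" for i using that by simp
    have eq: "(\<lambda>x. \<lambda>i\<in>I. f i (x i)) -` Pi\<^sub>E I A \<inter> space (Pi\<^sub>M I M) = (\<Pi>\<^sub>E i\<in>I. f i -` A i \<inter> space (M i))"
      by (auto simp: space_PiM PiE_iff)
    have "emeasure (distr (\<Pi>\<^sub>M i\<in>I. M i) (\<Pi>\<^sub>M i\<in>I. N i) (\<lambda>x. \<lambda>i\<in>I. f i (x i))) (Pi\<^sub>E I A) =
        emeasure (Pi\<^sub>M I M) (\<Pi>\<^sub>E i\<in>I. f i -` A i \<inter> space (M i))"
      using A' fin by (subst emeasure_distr[OF meas]) (auto simp: eq intro!: sets_PiM_I_finite)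
    also have "\<dots> = (\<Prod>i\<in>I. emeasure (M i) (f i -` A i \<inter> space (M i)))"
      by (rule M.emeasure_PiM[OF fin]) (use A' f in \<open>auto intro: measurable_sets\<close>)
    also have "\<dots> = (\<Prod>i\<in>I. emeasure (distr (M i) (N i) (f i)) (A i))"
      using A' by (auto simp: emeasure_distr intro!: prod.cong)
    finally show "emeasure (distr (\<Pi>\<^sub>M i\<in>I. M i) (\<Pi>\<^sub>M i\<in>I. N i) (\<lambda>x. \<lambda>i\<in>I. f i (x i))) (Pi\<^sub>E I A) =
      (\<Prod>i\<in>I. emeasure (distr (M i) (N i) (f i)) (A i))" .
  qed
qed

text \<open>The exponent is the logarithm of the density of N(v, 1) divided by that of N(0,
  1).\<close>

lemma std_normal_translate:
  "distr std_normal_distribution borel ((+) v) =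
    density std_normal_distribution (\<lambda>x. ennreal (exp (v * x - v\<^sup>2 / 2)))"
proof -
  have "distr std_normal_distribution borel ((+) v) =
      distr (density lborel (\<lambda>x. ennreal (std_normal_density ((v + x) - v)))) borel ((+) v)"
    by simp
  also have "\<dots> = density (distr lborel borel ((+) v)) (\<lambda>x. ennreal (std_normal_density (x - v)))"
    by (subst density_distr) auto
  also have "\<dots> = density lborel (\<lambda>x. ennreal (std_normal_density (x - v)))"
    by (simp add: lborel_distr_plus)
  also have "\<dots> = density std_normal_distribution (\<lambda>x. ennreal (exp (v * x - v\<^sup>2 / 2)))"
  proof -
    have "std_normal_density (x - v) = std_normal_density x * exp (v * x - v\<^sup>2 / 2)" for x
      by (simp add: std_normal_density_def exp_add [symmetric] power2_eq_square field_simps)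
    then show ?thesis
      by (simp add: density_density_eq ennreal_mult')
  qed
  finally show ?thesis .
qed

text \<open>The Cameron-Martin formula: the coordinates are independent, so the one-dimensional
  ratios multiply and their exponents add up to inner products.\<close>

lemma std_gaussian_translate:
  fixes v :: "real ^ 'k::finite"
  shows "distr std_gaussian borel ((+) v) = density std_gaussian (\<lambda>x. ennreal (exp (v \<bullet> x - v \<bullet> v / 2)))"
proof -
  let ?N = "std_normal_distribution" and ?vec = "\<lambda>f. (\<chi> i. f i) :: real ^ 'k"
  let ?P = "\<Pi>\<^sub>M i\<in>(UNIV :: 'k set). ?N" and ?B = "\<Pi>\<^sub>M i\<in>(UNIV :: 'k set). (borel :: real measure)"
  let ?r = "\<lambda>i x. ennreal (exp (v $ i * x - (v $ i)\<^sup>2 / 2))"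
  note [measurable] = measurable_vec_lambda_PiM[where 'k = 'k] measurable_vec_lambda_std_normal[where 'k = 'k]
  have "distr std_gaussian borel ((+) v) = distr ?P borel ((+) v \<circ> ?vec)"
    unfolding std_gaussian_def by (intro distr_distr) auto
  also have "(+) v \<circ> ?vec = ?vec \<circ> (\<lambda>f. \<lambda>i\<in>UNIV. v $ i + f i)"
    by (auto simp: fun_eq_iff vec_eq_iff)
  also have "distr ?P borel \<dots> = distr (distr ?P ?B (\<lambda>f. \<lambda>i\<in>UNIV. v $ i + f i)) borel ?vec"
    by (intro distr_distr[symmetric] measurable_vec_lambda_PiM measurable_restrict) measurable
  also have "distr ?P ?B (\<lambda>f. \<lambda>i\<in>UNIV. v $ i + f i) = (\<Pi>\<^sub>M i\<in>UNIV. distr ?N borel ((+) (v $ i)))"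
    by (intro PiM_distr[symmetric]) (auto simp: prob_space_std_normal)
  also have "\<dots> = (\<Pi>\<^sub>M i\<in>UNIV. density ?N (?r i))"
    by (simp add: std_normal_translate)
  also have "\<dots> = density ?P (\<lambda>x. \<Prod>i\<in>UNIV. ?r i (x i))"
  proof (rule PiM_density)
    show "prob_space (density ?N (?r i))" for i
      unfolding std_normal_translate[symmetric]
      by (intro prob_space.prob_space_distr prob_space_std_normal) auto
  qed (auto simp: prob_space_std_normal)
  also have "(\<lambda>x. \<Prod>i\<in>UNIV. ?r i (x i)) = (\<lambda>x. ennreal (exp (v \<bullet> ?vec x - v \<bullet> v / 2)))"
    by (simp add: prod_ennreal exp_sum [symmetric] inner_vec_def sum_subtractf sum_divide_distrib power2_eq_square)
  also have "distr (density ?P (\<lambda>x. ennreal (exp (v \<bullet> ?vec x - v \<bullet> v / 2)))) borel ?vec =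
      density std_gaussian (\<lambda>x. ennreal (exp (v \<bullet> x - v \<bullet> v / 2)))"
    unfolding std_gaussian_def by (subst density_distr) auto
  finally show ?thesis .
qed

lemma measurable_std_gaussian_borel:
  "f \<in> borel \<rightarrow>\<^sub>M N \<Longrightarrow> f \<in> std_gaussian \<rightarrow>\<^sub>M N"
  by (simp add: measurable_def)

text \<open>No integral is evaluated: the translated law has total mass 1, and by the Cameron-Martin
  formula this mass is the wanted integral up to the factor
  \<open>exp (v \<bullet> v / 2)\<close>.\<close>

lemma nn_integral_exp_std_gaussian:
  fixes v :: "real ^ 'k::finite"
  shows "(\<integral>\<^sup>+ x. ennreal (exp (v \<bullet> x)) \<partial>std_gaussian) = ennreal (exp (v \<bullet> v / 2))"
proof -
  interpret prob_space "std_gaussian :: (real ^ 'k) measure" by (rule prob_space_std_gaussian)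
  have p: "prob_space (distr std_gaussian borel ((+) v))"
    by (intro prob_space_distr measurable_std_gaussian_borel) auto
  have "(\<integral>\<^sup>+ x. ennreal (exp (v \<bullet> x - v \<bullet> v / 2)) \<partial>std_gaussian) =
      emeasure (density std_gaussian (\<lambda>x. ennreal (exp (v \<bullet> x - v \<bullet> v / 2)))) UNIV"
    by (subst emeasure_density) auto
  also have "\<dots> = 1"
    using prob_space.emeasure_space_1[OF p] by (simp add: std_gaussian_translate)
  finally have 1: "(\<integral>\<^sup>+ x. ennreal (exp (v \<bullet> x - v \<bullet> v / 2)) \<partial>std_gaussian) = 1" .
  have "(\<integral>\<^sup>+ x. ennreal (exp (v \<bullet> x)) \<partial>std_gaussian) =
      (\<integral>\<^sup>+ x. ennreal (exp (v \<bullet> v / 2)) * ennreal (exp (v \<bullet> x - v \<bullet> v / 2)) \<partial>std_gaussian)"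
    by (intro nn_integral_cong) (simp add: ennreal_mult' [symmetric] exp_add [symmetric])
  also have "\<dots> = ennreal (exp (v \<bullet> v / 2))"
    by (subst nn_integral_cmult) (auto simp: 1)
  finally show ?thesis .
qed

lemma
  fixes v :: "real ^ 'k::finite"
  shows integrable_exp_std_gaussian: "integrable std_gaussian (\<lambda>x. exp (v \<bullet> x))"
    and integral_exp_std_gaussian: "(\<integral>x. exp (v \<bullet> x) \<partial>std_gaussian) = exp (v \<bullet> v / 2)"
proof -
  show int: "integrable std_gaussian (\<lambda>x. exp (v \<bullet> x))"
    by (intro integrableI_nonneg) (auto simp: nn_integral_exp_std_gaussian)
  have "ennreal (\<integral>x. exp (v \<bullet> x) \<partial>std_gaussian) = ennreal (exp (v \<bullet> v / 2))"
    by (subst nn_integral_eq_integral[symmetric]) (auto simp: int nn_integral_exp_std_gaussian)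
  then show "(\<integral>x. exp (v \<bullet> x) \<partial>std_gaussian) = exp (v \<bullet> v / 2)"
    by (subst (asm) ennreal_inj) auto
qed

lemma std_gaussian_component:
  "distr (std_gaussian :: (real ^ 'k::finite) measure) borel (\<lambda>x. x $ i) = std_normal_distribution"
proof -
  note [measurable] = measurable_vec_lambda_std_normal[where 'k = 'k]
  have "distr (std_gaussian :: (real ^ 'k) measure) borel (\<lambda>x. x $ i) =
      distr (\<Pi>\<^sub>M i\<in>(UNIV :: 'k set). std_normal_distribution) borel ((\<lambda>x. x $ i) \<circ> (\<lambda>f. \<chi> i. f i))"
    unfolding std_gaussian_def by (intro distr_distr) auto
  also have "\<dots> = distr (\<Pi>\<^sub>M i\<in>(UNIV :: 'k set). std_normal_distribution) std_normal_distribution (\<lambda>f. f i)"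
    by (intro distr_cong) auto
  also have "\<dots> = std_normal_distribution"
    by (intro distr_PiM_component) (auto simp: prob_space_std_normal)
  finally show ?thesis .
qed

lemma integrable_power_std_gaussian: "integrable std_gaussian (\<lambda>x :: real ^ 'k::finite. (x $ i) ^ k)"
proof -
  have "integrable (distr (std_gaussian :: (real ^ 'k) measure) borel (\<lambda>x. x $ i)) (\<lambda>x. x ^ k)"
    by (simp add: std_gaussian_component integrable_std_normal_distribution_moment)
  then show ?thesis
    by (subst (asm) integrable_distr_eq) auto
qed

lemma integral_std_gaussian: "(\<integral>x. x $ i \<partial>(std_gaussian :: (real ^ 'k::finite) measure)) = 0"
proof -
  have "(\<integral>x. x \<partial>distr (std_gaussian :: (real ^ 'k) measure) borel (\<lambda>x. x $ i)) = 0"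
    by (simp add: std_gaussian_component integral_std_normal_distribution_moment_odd[of 1, simplified])
  then show ?thesis
    by (subst (asm) integral_distr) auto
qed

lemma
  fixes i j :: "'k::finite"
  assumes "i \<noteq> j"
  shows integrable_product_std_gaussian: "integrable std_gaussian (\<lambda>x :: real ^ 'k. x $ i * x $ j)"
    and integral_product_std_gaussian: "(\<integral>x. x $ i * x $ j \<partial>(std_gaussian :: (real ^ 'k) measure)) = 0"
proof -
  interpret product_prob_space "\<lambda>_ :: 'k. std_normal_distribution" UNIV
    by (rule product_prob_space_std_normal)
  interpret S: prob_space std_normal_distribution by (rule prob_space_std_normal)
  \<comment> \<open>The remaining coordinates get the factor 1, so that a product over all
    coordinates equals \<open>x i * x j\<close> and integrates factor by factor.\<close>
  let ?f = "\<lambda>k x. if k \<in> {i, j} then x else (1 :: real)"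
  have int: "integrable std_normal_distribution (?f k)" for k
    using integrable_std_normal_distribution_moment[of 1] by (cases "k \<in> {i, j}") auto
  have eq: "(\<Prod>k\<in>UNIV. ?f k (x k)) = x i * x j" for x
  proof -
    have "{k. k = i \<or> k = j} = {i, j}" by auto
    then show ?thesis using assms by (simp add: prod.If_cases)
  qed
  note [measurable] = measurable_vec_lambda_std_normal[where 'k = 'k]
  show "integrable std_gaussian (\<lambda>x :: real ^ 'k. x $ i * x $ j)"
    using product_integrable_prod[where I = UNIV and f = ?f, OF finite_class.finite_UNIV int]
    unfolding eq std_gaussian_def by (subst integrable_distr_eq) auto
  have "(\<integral>x. x $ i * x $ j \<partial>(std_gaussian :: (real ^ 'k) measure)) =
     (\<Prod>k\<in>UNIV. integral\<^sup>L std_normal_distribution (?f k))"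
    using product_integral_prod[where I = UNIV and f = ?f, OF finite_class.finite_UNIV int]
    unfolding eq std_gaussian_def by (subst integral_distr) auto
  also have "\<dots> = 0"
    using integral_std_normal_distribution_moment_odd[of 1] by (intro prod_zero bexI[of _ i]) auto
  finally show "(\<integral>x. x $ i * x $ j \<partial>(std_gaussian :: (real ^ 'k) measure)) = 0" .
qed

section \<open>Integration with respect to one observation\<close>

lemma nn_integral_sample_law:
  fixes \<theta> :: "real ^ 'l::finite mod_ring"
  assumes [measurable]: "g \<in> borel_measurable borel"
  shows "(\<integral>\<^sup>+ x. g x \<partial>sample_law \<sigma> \<theta>) =
    (\<Sum>l\<in>UNIV. \<integral>\<^sup>+ \<xi>. g (shift l \<theta> + \<sigma> *\<^sub>R \<xi>) \<partial>std_gaussian) / CARD('l)"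
proof -
  interpret prob_space "std_gaussian :: (real ^ 'l mod_ring) measure"
    by (rule prob_space_std_gaussian)
  note [measurable] = measurable_observation
  have "(\<integral>\<^sup>+ x. g x \<partial>sample_law \<sigma> \<theta>) =
      (\<integral>\<^sup>+ p. g (shift (fst p) \<theta> + \<sigma> *\<^sub>R snd p) \<partial>(measure_pmf (pmf_of_set UNIV) \<Otimes>\<^sub>M std_gaussian))"
    unfolding sample_law_def by (subst nn_integral_distr) (auto simp: case_prod_unfold)
  also have "\<dots> = (\<integral>\<^sup>+ l. (\<integral>\<^sup>+ \<xi>. g (shift l \<theta> + \<sigma> *\<^sub>R \<xi>) \<partial>std_gaussian) \<partial>measure_pmf (pmf_of_set UNIV))"
    using measurable_observation[of \<theta> \<sigma>] by (subst nn_integral_fst[symmetric]) (auto simp: case_prod_unfold)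
  also have "\<dots> = (\<Sum>l\<in>UNIV. \<integral>\<^sup>+ \<xi>. g (shift l \<theta> + \<sigma> *\<^sub>R \<xi>) \<partial>std_gaussian) / CARD('l)"
    by (subst nn_integral_pmf_of_set) auto
  finally show ?thesis .
qed

lemma
  fixes \<theta> :: "real ^ 'l::finite mod_ring" and g :: "_ \<Rightarrow> real"
  assumes [measurable]: "g \<in> borel_measurable borel"
    and int: "\<And>l. integrable std_gaussian (\<lambda>\<xi>. g (shift l \<theta> + \<sigma> *\<^sub>R \<xi>))"
  shows integrable_sample_law: "integrable (sample_law \<sigma> \<theta>) g"
    and integral_sample_law: "(\<integral>x. g x \<partial>sample_law \<sigma> \<theta>) =
    (\<Sum>l\<in>UNIV. \<integral>\<xi>. g (shift l \<theta> + \<sigma> *\<^sub>R \<xi>) \<partial>std_gaussian) / CARD('l)"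
proof -
  interpret G: prob_space "std_gaussian :: (real ^ 'l mod_ring) measure"
    by (rule prob_space_std_gaussian)
  interpret P: pair_prob_space "measure_pmf (pmf_of_set (UNIV :: 'l mod_ring set))"
    "std_gaussian :: (real ^ 'l mod_ring) measure" ..
  show I: "integrable (sample_law \<sigma> \<theta>) g"
  proof (rule integrableI_bounded)
    have "(\<integral>\<^sup>+ \<xi>. ennreal (norm (g (shift l \<theta> + \<sigma> *\<^sub>R \<xi>))) \<partial>std_gaussian) < \<infinity>" for l
      using int[of l] by (simp add: integrable_iff_bounded)
    then show "(\<integral>\<^sup>+ x. ennreal (norm (g x)) \<partial>sample_law \<sigma> \<theta>) < \<infinity>"
      by (subst nn_integral_sample_law) (auto simp: ennreal_divide_eq_top_iff less_top[symmetric])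
  qed auto
  have "integrable (measure_pmf (pmf_of_set UNIV) \<Otimes>\<^sub>M std_gaussian) (\<lambda>p. g (shift (fst p) \<theta> + \<sigma> *\<^sub>R snd p))"
    using I measurable_observation[of \<theta> \<sigma>] unfolding sample_law_def
    by (subst (asm) integrable_distr_eq) (auto simp: case_prod_unfold)
  from P.integral_fst'[OF this] 
  have "(\<integral>l. (\<integral>\<xi>. g (shift l \<theta> + \<sigma> *\<^sub>R \<xi>) \<partial>std_gaussian) \<partial>measure_pmf (pmf_of_set UNIV)) =
     (\<integral>x. g x \<partial>sample_law \<sigma> \<theta>)"
    unfolding sample_law_def using measurable_observation[of \<theta> \<sigma>] 
    by (subst integral_distr) (auto simp: case_prod_unfold)
  then show "(\<integral>x. g x \<partial>sample_law \<sigma> \<theta>) =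
    (\<Sum>l\<in>UNIV. \<integral>\<xi>. g (shift l \<theta> + \<sigma> *\<^sub>R \<xi>) \<partial>std_gaussian) / CARD('l)"
    by (simp add: integral_pmf_of_set)
qed

section \<open>Chi-square distance of two orbit mixtures\<close>

text \<open>Likelihood ratio of \<open>shift l a + \<xi>\<close>, with \<open>l\<close> uniform and
  \<open>\<xi>\<close> standard Gaussian, against \<open>\<xi>\<close>: an average of Cameron-Martin
  densities, all with the same \<open>a \<bullet> a\<close> because shifts preserve the
  norm.\<close>

definition orbit_density :: "real ^ 'l::finite mod_ring \<Rightarrow> real ^ 'l mod_ring \<Rightarrow> real" where
  "orbit_density a \<xi> = (\<Sum>l\<in>UNIV. exp (shift l a \<bullet> \<xi> - a \<bullet> a / 2)) / CARD('l)"

lemma measurable_orbit_density [measurable]: "orbit_density a \<in> borel_measurable borel"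
  unfolding orbit_density_def by measurable

lemma orbit_density_nonneg: "0 \<le> orbit_density a \<xi>"
  unfolding orbit_density_def by (auto intro!: divide_nonneg_nonneg sum_nonneg)

text \<open>Shifts fix \<open>c\<close>, so it can be moved into the affine map together with
  \<open>\<sigma>\<close>. Two signals with the same \<open>c\<close> share this map, and their
  likelihood ratio is one of orbit densities.\<close>

lemma sample_law_eq_density:
  fixes a c :: "real ^ 'l::finite mod_ring"
  assumes c: "\<And>l. shift l c = c"
  shows "sample_law \<sigma> (c + \<sigma> *\<^sub>R a) =
    distr (density std_gaussian (\<lambda>\<xi>. ennreal (orbit_density a \<xi>))) borel (\<lambda>\<xi>. c + \<sigma> *\<^sub>R \<xi>)"
proof (rule measure_eqI)
  fix A assume "A \<in> sets (sample_law \<sigma> (c + \<sigma> *\<^sub>R a))"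
  then have [measurable]: "A \<in> sets borel" by simp
  define h :: "real ^ 'l mod_ring \<Rightarrow> ennreal" where "h \<xi> = indicator A (c + \<sigma> *\<^sub>R \<xi>)" for \<xi>
  have [measurable]: "h \<in> borel_measurable borel" unfolding h_def by measurable
  have translate: "(\<integral>\<^sup>+ \<xi>. h (v + \<xi>) \<partial>std_gaussian) =
      (\<integral>\<^sup>+ \<xi>. ennreal (exp (v \<bullet> \<xi> - v \<bullet> v / 2)) * h \<xi> \<partial>std_gaussian)" for v
  proof -
    have "(\<integral>\<^sup>+ \<xi>. h (v + \<xi>) \<partial>std_gaussian) = (\<integral>\<^sup>+ \<xi>. h \<xi> \<partial>distr std_gaussian borel ((+) v))"
      by (subst nn_integral_distr) auto
    also have "\<dots> = (\<integral>\<^sup>+ \<xi>. ennreal (exp (v \<bullet> \<xi> - v \<bullet> v / 2)) * h \<xi> \<partial>std_gaussian)"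
      unfolding std_gaussian_translate by (subst nn_integral_density) auto
    finally show ?thesis .
  qed
  have "emeasure (sample_law \<sigma> (c + \<sigma> *\<^sub>R a)) A = (\<integral>\<^sup>+ x. indicator A x \<partial>sample_law \<sigma> (c + \<sigma> *\<^sub>R a))"
    by simp
  also have "\<dots> = (\<Sum>l\<in>UNIV. \<integral>\<^sup>+ \<xi>. h (shift l a + \<xi>) \<partial>std_gaussian) / CARD('l)"
    by (subst nn_integral_sample_law) (auto simp: h_def shift_add shift_scaleR c scaleR_add_right add.assoc)
  also have "\<dots> = (\<integral>\<^sup>+ \<xi>. (\<Sum>l\<in>UNIV. ennreal (exp (shift l a \<bullet> \<xi> - a \<bullet> a / 2)) * h \<xi>) \<partial>std_gaussian) / CARD('l)"
    by (subst nn_integral_sum) (auto simp: translate inner_shift_shift)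
  also have "\<dots> = (\<integral>\<^sup>+ \<xi>. (\<Sum>l\<in>UNIV. ennreal (exp (shift l a \<bullet> \<xi> - a \<bullet> a / 2)) * h \<xi>) / CARD('l) \<partial>std_gaussian)"
    by (subst nn_integral_divide) auto
  also have "\<dots> = (\<integral>\<^sup>+ \<xi>. ennreal (orbit_density a \<xi>) * h \<xi> \<partial>std_gaussian)"
  proof (rule nn_integral_cong)
    fix \<xi>
    have "ennreal (orbit_density a \<xi>) = (\<Sum>l\<in>UNIV. ennreal (exp (shift l a \<bullet> \<xi> - a \<bullet> a / 2))) / CARD('l)"
      unfolding orbit_density_def
      by (subst divide_ennreal[symmetric]) (auto intro: sum_nonneg simp: ennreal_of_nat_eq_real_of_nat)
    then show "(\<Sum>l\<in>UNIV. ennreal (exp (shift l a \<bullet> \<xi> - a \<bullet> a / 2)) * h \<xi>) / of_nat CARD('l) =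
        ennreal (orbit_density a \<xi>) * h \<xi>"
      unfolding sum_distrib_right[symmetric] by (simp only: divide_ennreal_def mult_ac)
  qed
  also have "\<dots> = (\<integral>\<^sup>+ \<xi>. h \<xi> \<partial>density std_gaussian (\<lambda>\<xi>. ennreal (orbit_density a \<xi>)))"
    by (subst nn_integral_density) (auto intro: measurable_std_gaussian_borel)
  also have "\<dots> = (\<integral>\<^sup>+ x. indicator A x \<partial>distr (density std_gaussian (\<lambda>\<xi>. ennreal (orbit_density a \<xi>))) borel (\<lambda>\<xi>. c + \<sigma> *\<^sub>R \<xi>))"
    unfolding h_def by (subst nn_integral_distr) (auto simp: measurable_density_eq1 intro: measurable_std_gaussian_borel)
  finally show "emeasure (sample_law \<sigma> (c + \<sigma> *\<^sub>R a)) A =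
      emeasure (distr (density std_gaussian (\<lambda>\<xi>. ennreal (orbit_density a \<xi>))) borel (\<lambda>\<xi>. c + \<sigma> *\<^sub>R \<xi>)) A"
    by simp
qed simp

text \<open>Jensen in the form exp x \<ge> 1 + x: for coordinate sum zero the exponents average to 0
  over the shifts, so the exponentials average to at least 1. The norm bound costs a factor exp (- 1
  / 2) \<ge> 1 / 2. This permits division by the density.\<close>

lemma orbit_density_ge:
  assumes sum: "(\<Sum>i\<in>UNIV. a $ i) = 0" and a: "norm a \<le> 1"
  shows "1 / 2 \<le> orbit_density a \<xi>"
proof -
  have "(\<Sum>l\<in>UNIV. shift l a \<bullet> \<xi>) = (\<Sum>i\<in>UNIV. \<Sum>l\<in>UNIV. a $ (i + l) * \<xi> $ i)"
    unfolding inner_vec_def by (subst sum.swap) simp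
  also have "\<dots> = 0"
    using sum_shift[of "($) a"] by (simp add: sum_distrib_right[symmetric] add.commute sum)
  finally have 0: "(\<Sum>l\<in>UNIV. shift l a \<bullet> \<xi>) = 0" .
  have "real CARD('a) = (\<Sum>l\<in>(UNIV :: 'a mod_ring set). 1 + shift l a \<bullet> \<xi>)"
    by (simp add: sum.distrib 0)
  also have "\<dots> \<le> (\<Sum>l\<in>UNIV. exp (shift l a \<bullet> \<xi>))"
    by (intro sum_mono) simp
  finally have 1: "1 \<le> (\<Sum>l\<in>UNIV. exp (shift l a \<bullet> \<xi>)) / CARD('a)"
    by simp
  have "a \<bullet> a \<le> 1"
    using a by (simp add: dot_square_norm power_le_one)
  then have "- (1 / 2) \<le> - (a \<bullet> a / 2)" by simp
  moreover have "1 / 2 \<le> exp (- (1 / 2) :: real)"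
    using exp_ge_add_one_self[of "- (1 / 2) :: real"] by simp
  ultimately have 2: "1 / 2 \<le> exp (- (a \<bullet> a / 2))"
    by (meson exp_le_cancel_iff order_trans)
  have "1 / 2 * 1 \<le> exp (- (a \<bullet> a / 2)) * ((\<Sum>l\<in>UNIV. exp (shift l a \<bullet> \<xi>)) / CARD('a))"
    by (intro mult_mono 1 2) auto
  also have "\<dots> = orbit_density a \<xi>"
  proof -
    have "exp (shift l a \<bullet> \<xi> - a \<bullet> a / 2) = exp (- (a \<bullet> a / 2)) * exp (shift l a \<bullet> \<xi>)" for l
      by (simp add: exp_add[symmetric])
    then show ?thesis unfolding orbit_density_def by (simp only: sum_distrib_left times_divide_eq_right)
  qed
  finally show ?thesis by simp
qed

lemma orbit_density_mult:
  fixes a b :: "real ^ 'l::finite mod_ring"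
  shows "orbit_density a \<xi> * orbit_density b \<xi> =
    (\<Sum>k\<in>UNIV. \<Sum>l\<in>UNIV. exp (- (a \<bullet> a + b \<bullet> b) / 2) * exp ((shift k a + shift l b) \<bullet> \<xi>)) / (real CARD('l))\<^sup>2"
proof -
  have "orbit_density a \<xi> * orbit_density b \<xi> =
    (\<Sum>k\<in>UNIV. \<Sum>l\<in>UNIV. exp (shift k a \<bullet> \<xi> - a \<bullet> a / 2) * exp (shift l b \<bullet> \<xi> - b \<bullet> b / 2)) / (real CARD('l))\<^sup>2"
    unfolding orbit_density_def by (simp add: sum_product power2_eq_square)
  also have "(\<lambda>k l. exp (shift k a \<bullet> \<xi> - a \<bullet> a / 2) * exp (shift l b \<bullet> \<xi> - b \<bullet> b / 2)) =
      (\<lambda>k l. exp (- (a \<bullet> a + b \<bullet> b) / 2) * exp ((shift k a + shift l b) \<bullet> \<xi>))"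
    by (simp add: fun_eq_iff exp_add[symmetric] inner_add_left add_divide_distrib diff_divide_distrib)
  finally show ?thesis .
qed

text \<open>The Gaussian exponential moment at \<open>shift k a + shift l b\<close> is exp of half
  its squared norm. The squares of \<open>a\<close> and \<open>b\<close> cancel against the
  normalisation; what remains is an inner product that depends on \<open>l - k\<close>
  alone.\<close>

lemma
  fixes a b :: "real ^ 'l::finite mod_ring"
  shows integrable_orbit_density_mult: "integrable std_gaussian (\<lambda>\<xi>. orbit_density a \<xi> * orbit_density b \<xi>)"
    and integral_orbit_density_mult: "(\<integral>\<xi>. orbit_density a \<xi> * orbit_density b \<xi> \<partial>std_gaussian) =
      (\<Sum>l\<in>UNIV. exp (a \<bullet> shift l b)) / CARD('l)"
proof -
  let ?L = "real CARD('l)"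
  show "integrable std_gaussian (\<lambda>\<xi>. orbit_density a \<xi> * orbit_density b \<xi>)"
    unfolding orbit_density_mult
    by (intro Bochner_Integration.integrable_divide Bochner_Integration.integrable_sum
        integrable_mult_right integrable_exp_std_gaussian)
  have "(\<integral>\<xi>. orbit_density a \<xi> * orbit_density b \<xi> \<partial>std_gaussian) =
     (\<Sum>k\<in>UNIV. \<Sum>l\<in>UNIV. exp (- (a \<bullet> a + b \<bullet> b) / 2) *
        exp ((shift k a + shift l b) \<bullet> (shift k a + shift l b) / 2)) / ?L\<^sup>2"
    unfolding orbit_density_mult
    by (simp add: integrable_exp_std_gaussian integral_exp_std_gaussian)
  also have "\<dots> = (\<Sum>k\<in>UNIV. \<Sum>l\<in>UNIV. exp (a \<bullet> shift (l - k) b)) / ?L\<^sup>2"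
  proof -
    have "exp (- (a \<bullet> a + b \<bullet> b) / 2) * exp ((shift k a + shift l b) \<bullet> (shift k a + shift l b) / 2) =
        exp (a \<bullet> shift (l - k) b)" for k l
    proof -
      have "(shift k a + shift l b) \<bullet> (shift k a + shift l b) = a \<bullet> a + b \<bullet> b + 2 * (shift k a \<bullet> shift l b)"
        by (simp add: inner_add_left inner_add_right inner_shift_shift inner_commute[of "shift l b"])
      also have "shift k a \<bullet> shift l b = a \<bullet> shift (l - k) b"
        by (simp add: inner_shift_left shift_shift)
      finally show ?thesis by (simp add: exp_add[symmetric] field_simps)
    qed
    then show ?thesis by simp
  qed
  also have "\<dots> = (\<Sum>k\<in>(UNIV :: 'l mod_ring set). \<Sum>l\<in>UNIV. exp (a \<bullet> shift l b)) / ?L\<^sup>2"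
    using sum_shift[of "\<lambda>l. exp (a \<bullet> shift l b)" "- k" for k] by simp
  also have "\<dots> = (\<Sum>l\<in>UNIV. exp (a \<bullet> shift l b)) / ?L"
    by (simp add: power2_eq_square)
  finally show "(\<integral>\<xi>. orbit_density a \<xi> * orbit_density b \<xi> \<partial>std_gaussian) =
      (\<Sum>l\<in>UNIV. exp (a \<bullet> shift l b)) / CARD('l)" .
qed

text \<open>The density of the zero vector is the constant 1, so these are the mixed moments with
  \<open>b = 0\<close>.\<close>

lemma integrable_orbit_density: "integrable std_gaussian (orbit_density a)"
  and integral_orbit_density: "(\<integral>\<xi>. orbit_density a \<xi> \<partial>std_gaussian) = 1"
  using integrable_orbit_density_mult[of a 0] integral_orbit_density_mult[of a 0]
  by (simp_all add: orbit_density_def[of 0] shift_def zero_vec_def[symmetric] inner_vec_def cong: if_cong)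

section \<open>Elementary estimates for the exponential function\<close>

lemma abs_exp_minus_one_le: "\<bar>exp x - 1\<bar> \<le> \<bar>x\<bar> * exp \<bar>x\<bar>" for x :: real
proof (cases "x \<ge> 0")
  case True
  have "1 - x \<le> exp (- x)" using exp_ge_add_one_self[of "- x"] by simp
  then have "(1 - x) * exp x \<le> exp (- x) * exp x" by (intro mult_right_mono) auto
  then show ?thesis using True by (simp add: exp_add[symmetric] algebra_simps)
next
  case False
  have "1 + x \<le> exp x" by simp
  moreover have "- x * 1 \<le> - x * exp (- x)" using False by (intro mult_left_mono) auto
  ultimately have "1 - exp x \<le> - x * exp (- x)" by linarith
  then show ?thesis using False by simp
qed

lemma exp_minus_one_minus_le: "exp x - 1 - x \<le> x\<^sup>2 * exp \<bar>x\<bar>" for x :: real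
proof -
  have "exp (- x) \<ge> 1 - x" using exp_ge_add_one_self[of "- x"] by simp
  then have "(1 - x) * exp x \<le> exp (- x) * exp x" by (intro mult_right_mono) auto
  then have "exp x - 1 \<le> x * exp x" by (simp add: exp_add[symmetric] algebra_simps)
  then have "exp x - 1 - x \<le> x * (exp x - 1)" by (simp add: algebra_simps)
  also have "\<dots> \<le> \<bar>x\<bar> * \<bar>exp x - 1\<bar>" by (simp add: abs_mult[symmetric])
  also have "\<dots> \<le> \<bar>x\<bar> * (\<bar>x\<bar> * exp \<bar>x\<bar>)" by (intro mult_left_mono abs_exp_minus_one_le) auto
  finally show ?thesis by (simp add: power2_eq_square)
qed

text \<open>In the application \<open>u\<close>, \<open>x\<close>, \<open>y\<close>,
  \<open>z\<close> are inner products of \<open>a\<close> or \<open>b\<close> with shifts of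
  \<open>a\<close> or \<open>b\<close>, and \<open>A\<close>, \<open>B\<close> are the two norms.
  The second difference keeps only what contains \<open>b\<close> in both arguments; beyond
  \<open>z\<close>, two more factors of size \<open>A + B\<close> appear.\<close>

lemma exp_second_difference_le:
  fixes A B :: real
  assumes A: "0 \<le> A" "A \<le> 1" and B: "0 \<le> B" "B \<le> 1"
    and u: "\<bar>u\<bar> \<le> A\<^sup>2" and x: "\<bar>x\<bar> \<le> A * B" and y: "\<bar>y\<bar> \<le> A * B" and z: "\<bar>z\<bar> \<le> B\<^sup>2"
  shows "exp (u + x + y + z) - exp (u + x) - exp (u + y) + exp u \<le> z + 3 * exp 4 * (B\<^sup>2 * (A + B)\<^sup>2)"
proof -
  let ?q = "B\<^sup>2 * (A + B)\<^sup>2"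
  define w where "w = u + x + y"
  have AA: "A\<^sup>2 \<le> 1" "A * B \<le> 1" "B\<^sup>2 \<le> 1"
    using A B by (auto simp: power_le_one mult_le_one)
  have w3: "\<bar>w\<bar> \<le> 3" using u x y AA unfolding w_def by linarith
  have wAB: "\<bar>w\<bar> \<le> (A + B)\<^sup>2"
  proof -
    have "\<bar>w\<bar> \<le> A\<^sup>2 + A * B + A * B" using u x y unfolding w_def by linarith
    then show ?thesis by (simp add: power2_sum) (use zero_le_power2[of B] in linarith)
  qed
  have z1: "\<bar>z\<bar> \<le> 1" using z AA by linarith
  have BAB: "B\<^sup>2 \<le> (A + B)\<^sup>2" using A B by (intro power_mono) auto
  have "exp w * (exp z - 1 - z) \<le> exp 3 * (?q * exp 1)"
  proof -
    have "z\<^sup>2 \<le> (B\<^sup>2)\<^sup>2" using power_mono[OF z, of 2] by simp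
    also have "\<dots> \<le> ?q" unfolding power2_eq_square[of "B\<^sup>2"] by (intro mult_left_mono BAB) auto
    finally have "z\<^sup>2 * exp \<bar>z\<bar> \<le> ?q * exp 1" using z1 by (intro mult_mono) auto
    then have "exp z - 1 - z \<le> ?q * exp 1" using exp_minus_one_minus_le[of z] by linarith
    moreover have "0 \<le> exp z - 1 - z" using exp_ge_add_one_self[of z] by linarith
    moreover have "exp w \<le> exp 3" using w3 by simp
    ultimately show ?thesis by (intro mult_mono) simp_all
  qed
  moreover have "(exp w - 1) * z \<le> ((A + B)\<^sup>2 * exp 3) * B\<^sup>2"
  proof -
    have "(exp w - 1) * z \<le> \<bar>exp w - 1\<bar> * \<bar>z\<bar>" by (simp add: abs_mult[symmetric])
    also have "\<dots> \<le> (\<bar>w\<bar> * exp \<bar>w\<bar>) * \<bar>z\<bar>" by (intro mult_right_mono abs_exp_minus_one_le) auto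
    also have "\<dots> \<le> ((A + B)\<^sup>2 * exp 3) * B\<^sup>2" using w3 wAB z by (intro mult_mono) auto
    finally show ?thesis .
  qed
  moreover have "exp u * ((exp x - 1) * (exp y - 1)) \<le> exp 1 * ((A * B * exp 1) * (A * B * exp 1))"
  proof -
    have e: "\<bar>exp v - 1\<bar> \<le> A * B * exp 1" if "\<bar>v\<bar> \<le> A * B" for v
    proof -
      have "\<bar>exp v - 1\<bar> \<le> \<bar>v\<bar> * exp \<bar>v\<bar>" by (rule abs_exp_minus_one_le)
      also have "\<dots> \<le> A * B * exp 1" using that AA A B by (intro mult_mono) auto
      finally show ?thesis .
    qed
    have "(exp x - 1) * (exp y - 1) \<le> \<bar>exp x - 1\<bar> * \<bar>exp y - 1\<bar>" by (simp add: abs_mult[symmetric])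
    also have "\<dots> \<le> (A * B * exp 1) * (A * B * exp 1)" using e x y A B by (intro mult_mono) auto
    finally have "exp u * ((exp x - 1) * (exp y - 1)) \<le> exp u * ((A * B * exp 1) * (A * B * exp 1))"
      by (rule mult_left_mono) simp
    also have "\<dots> \<le> exp 1 * ((A * B * exp 1) * (A * B * exp 1))"
      using u AA A B by (intro mult_right_mono) auto
    finally show ?thesis .
  qed
  moreover have "exp 1 * ((A * B * exp 1) * (A * B * exp 1)) \<le> exp 4 * ?q"
  proof -
    have "exp 1 * ((A * B * exp 1) * (A * B * exp 1)) = exp 3 * (B\<^sup>2 * A\<^sup>2)"
      by (simp add: power2_eq_square mult_ac exp_add[symmetric])
    also have "\<dots> \<le> exp 4 * ?q"
      using A B by (intro mult_mono power_mono) auto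
    finally show ?thesis .
  qed
  moreover have "exp 3 * (?q * exp 1) = exp 4 * ?q" by (simp add: exp_add[symmetric])
  moreover have "((A + B)\<^sup>2 * exp 3) * B\<^sup>2 \<le> exp 4 * ?q"
  proof -
    have "exp 3 * ?q \<le> exp 4 * ?q" by (intro mult_right_mono) auto
    then show ?thesis by (simp add: mult_ac)
  qed
  \<comment> \<open>Exact splitting with \<open>w = u + x + y\<close>: the part without
    \<open>z\<close> factors as \<open>exp u * ((exp x - 1) * (exp y - 1))\<close>, and
    \<open>exp w * (exp z - 1)\<close> is expanded around \<open>z\<close>. Each of the three
    remainders is at most \<open>exp 4 * ?q\<close>.\<close>
  moreover have "exp (u + x + y + z) - exp (u + x) - exp (u + y) + exp u =
     z + exp w * (exp z - 1 - z) + (exp w - 1) * z + exp u * ((exp x - 1) * (exp y - 1))"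
    unfolding w_def by (simp add: exp_add algebra_simps)
  ultimately show ?thesis by linarith
qed

text \<open>The linear terms of the exponentials average to the squared difference of the coordinate sums,
  so signals with equal sums are separated only at second order.\<close>

lemma orbit_density_chi_square:
  fixes a b :: "real ^ 'l::finite mod_ring"
  assumes a: "norm a \<le> 1" and b: "norm b \<le> 1"
  shows "(\<integral>\<xi>. (orbit_density (a + b) \<xi> - orbit_density a \<xi>)\<^sup>2 \<partial>std_gaussian) \<le>
    (\<Sum>i\<in>UNIV. b $ i)\<^sup>2 / CARD('l) + 3 * exp 4 * ((norm b)\<^sup>2 * (norm a + norm b)\<^sup>2)"
proof -
  let ?L = "real CARD('l)" and ?q = "(norm b)\<^sup>2 * (norm a + norm b)\<^sup>2"
  note [simp] = integrable_orbit_density_mult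
  \<comment> \<open>Summed over all shifts the two cross terms agree; for a single \<open>l\<close>
    they differ, and the second difference takes one of each.\<close>
  have sym: "(\<Sum>l\<in>UNIV. exp ((a + b) \<bullet> shift l a)) = (\<Sum>l\<in>UNIV. exp (a \<bullet> shift l (a + b)))"
    using integral_orbit_density_mult[of a "a + b"] integral_orbit_density_mult[of "a + b" a]
    by (simp add: mult.commute)
  have "(\<integral>\<xi>. (orbit_density (a + b) \<xi> - orbit_density a \<xi>)\<^sup>2 \<partial>std_gaussian) =
     (\<integral>\<xi>. orbit_density (a + b) \<xi> * orbit_density (a + b) \<xi> - orbit_density a \<xi> * orbit_density (a + b) \<xi>
        - orbit_density (a + b) \<xi> * orbit_density a \<xi> + orbit_density a \<xi> * orbit_density a \<xi> \<partial>std_gaussian)"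
    by (simp add: power2_eq_square algebra_simps)
  also have "\<dots> = (\<Sum>l\<in>UNIV. exp ((a + b) \<bullet> shift l (a + b)) - exp (a \<bullet> shift l (a + b))
      - exp ((a + b) \<bullet> shift l a) + exp (a \<bullet> shift l a)) / ?L"
    using sym by (simp add: integral_orbit_density_mult sum.distrib sum_subtractf add_divide_distrib diff_divide_distrib)
  also have "\<dots> \<le> (\<Sum>l\<in>UNIV. b \<bullet> shift l b + 3 * exp 4 * ?q) / ?L"
  proof (intro divide_right_mono sum_mono)
    fix l
    have i: "\<bar>v \<bullet> shift l w\<bar> \<le> norm v * norm w" for v w :: "real ^ 'l mod_ring"
      using Cauchy_Schwarz_ineq2[of v "shift l w"] by simp
    have "exp (a \<bullet> shift l a + a \<bullet> shift l b + b \<bullet> shift l a + b \<bullet> shift l b)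
        - exp (a \<bullet> shift l a + a \<bullet> shift l b) - exp (a \<bullet> shift l a + b \<bullet> shift l a) + exp (a \<bullet> shift l a) \<le>
      b \<bullet> shift l b + 3 * exp 4 * ?q"
      using a b i[of a a] i[of a b] i[of b a] i[of b b]
      by (intro exp_second_difference_le) (auto simp: power2_eq_square mult.commute)
    then show "exp ((a + b) \<bullet> shift l (a + b)) - exp (a \<bullet> shift l (a + b))
      - exp ((a + b) \<bullet> shift l a) + exp (a \<bullet> shift l a) \<le> b \<bullet> shift l b + 3 * exp 4 * ?q"
      by (simp add: shift_add inner_add_left inner_add_right add_ac)
  qed auto
  also have "\<dots> = (\<Sum>l\<in>UNIV. b \<bullet> shift l b) / ?L + 3 * exp 4 * ?q"
    by (simp add: sum.distrib add_divide_distrib)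
  \<comment> \<open>Over all lags the autocorrelations run through every pair of coordinates once,
    which completes the square.\<close>
  also have "(\<Sum>l\<in>UNIV. b \<bullet> shift l b) = (\<Sum>i\<in>UNIV. b $ i)\<^sup>2"
  proof -
    have "(\<Sum>l\<in>UNIV. b \<bullet> shift l b) = (\<Sum>i\<in>UNIV. \<Sum>l\<in>UNIV. b $ i * b $ (l + i))"
      unfolding inner_vec_def by (subst sum.swap) (simp add: add.commute)
    also have "\<dots> = (\<Sum>i\<in>UNIV. b $ i)\<^sup>2"
      by (simp add: sum_distrib_left[symmetric] sum_distrib_right[symmetric] sum_shift[of "($) b"] power2_eq_square)
    finally show ?thesis .
  qed
  finally show ?thesis .
qed

text \<open>The ratio is \<open>orbit_density (a + b)\<close> over \<open>orbit_density a\<close>,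
  carried along by the affine map. Sum zero is asked of the reference \<open>a\<close>, whose
  density is the denominator; \<open>c\<close> absorbs the mean. The second moment is the quantity
  to bound because it multiplies over independent samples.\<close>

lemma sample_law_likelihood_ratio:
  fixes a b c :: "real ^ 'l::finite mod_ring"
  assumes \<sigma>: "\<sigma> > 0" and c: "\<And>l. shift l c = c"
    and sum: "(\<Sum>i\<in>UNIV. a $ i) = 0" and a: "norm a \<le> 1" and b: "norm b \<le> 1"
  obtains r where "r \<in> borel_measurable borel" "\<And>x. 0 \<le> r x"
    "sample_law \<sigma> (c + \<sigma> *\<^sub>R (a + b)) = density (sample_law \<sigma> (c + \<sigma> *\<^sub>R a)) (\<lambda>x. ennreal (r x))"
    "(\<integral>\<^sup>+ x. ennreal ((r x)\<^sup>2) \<partial>sample_law \<sigma> (c + \<sigma> *\<^sub>R a)) \<le>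
      ennreal (1 + 2 * ((\<Sum>i\<in>UNIV. b $ i)\<^sup>2 / CARD('l) + 3 * exp 4 * ((norm b)\<^sup>2 * (norm a + norm b)\<^sup>2)))"
proof -
  let ?f = "orbit_density a" and ?g = "orbit_density (a + b)" and ?T = "\<lambda>\<xi>. c + \<sigma> *\<^sub>R \<xi>"
  define r where "r x = ?g ((1 / \<sigma>) *\<^sub>R (x - c)) / ?f ((1 / \<sigma>) *\<^sub>R (x - c))" for x
  have f: "1 / 2 \<le> ?f \<xi>" for \<xi> using orbit_density_ge[OF sum a] .
  have f0: "0 < ?f \<xi>" for \<xi> using f[of \<xi>] by linarith
  have g0: "0 \<le> ?g \<xi>" for \<xi> by (rule orbit_density_nonneg)
  have rT: "r (?T \<xi>) = ?g \<xi> / ?f \<xi>" for \<xi> using \<sigma> by (simp add: r_def)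
  have [measurable]: "r \<in> borel_measurable borel" unfolding r_def by measurable
  have [measurable]: "?T \<in> std_gaussian \<rightarrow>\<^sub>M borel" by (rule measurable_std_gaussian_borel) simp
  have [measurable]: "?f \<in> borel_measurable std_gaussian" "?g \<in> borel_measurable std_gaussian"
    by (auto intro: measurable_std_gaussian_borel)
  show ?thesis
  proof
    show "r \<in> borel_measurable borel" by simp
    show "0 \<le> r x" for x unfolding r_def using f0 g0 by (simp add: divide_nonneg_pos)
    have "density (sample_law \<sigma> (c + \<sigma> *\<^sub>R a)) (\<lambda>x. ennreal (r x)) =
      distr (density (density std_gaussian (\<lambda>\<xi>. ennreal (?f \<xi>))) (\<lambda>\<xi>. ennreal (?g \<xi> / ?f \<xi>))) borel ?T"
      unfolding sample_law_eq_density[OF c] by (subst density_distr) (auto simp: rT)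
    also have "density (density std_gaussian (\<lambda>\<xi>. ennreal (?f \<xi>))) (\<lambda>\<xi>. ennreal (?g \<xi> / ?f \<xi>)) =
      density std_gaussian (\<lambda>\<xi>. ennreal (?g \<xi>))"
    proof (subst density_density_eq)
      have "ennreal (?f \<xi>) * ennreal (?g \<xi> / ?f \<xi>) = ennreal (?g \<xi>)" for \<xi>
        using f0[of \<xi>] g0[of \<xi>] by (simp add: ennreal_mult[symmetric])
      then show "density std_gaussian (\<lambda>\<xi>. ennreal (?f \<xi>) * ennreal (?g \<xi> / ?f \<xi>)) =
          density std_gaussian (\<lambda>\<xi>. ennreal (?g \<xi>))" by simp
    qed auto
    finally show "sample_law \<sigma> (c + \<sigma> *\<^sub>R (a + b)) = density (sample_law \<sigma> (c + \<sigma> *\<^sub>R a)) (\<lambda>x. ennreal (r x))"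
      unfolding sample_law_eq_density[OF c] ..
  next
    \<comment> \<open>For densities f, g with f \<ge> 1 / 2: g^2 / f = 2 g - f + (g - f)^2 / f, and
      the last term is at most 2 (g - f)^2. As f and g integrate to 1, the first two terms
      contribute 1.\<close>
    let ?h = "\<lambda>\<xi>. 2 * ?g \<xi> - ?f \<xi> + 2 * (?g \<xi> - ?f \<xi>)\<^sup>2"
    have pointwise: "?f \<xi> * (?g \<xi> / ?f \<xi>)\<^sup>2 \<le> ?h \<xi>" for \<xi>
    proof -
      have "?f \<xi> * (?g \<xi> / ?f \<xi>)\<^sup>2 = 2 * ?g \<xi> - ?f \<xi> + (1 / ?f \<xi>) * (?g \<xi> - ?f \<xi>)\<^sup>2"
        using f0[of \<xi>] by (simp add: field_simps power2_eq_square)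
      also have "(1 / ?f \<xi>) * (?g \<xi> - ?f \<xi>)\<^sup>2 \<le> 2 * (?g \<xi> - ?f \<xi>)\<^sup>2"
        using f[of \<xi>] f0[of \<xi>] by (intro mult_right_mono) (auto simp: field_simps)
      finally show ?thesis by simp
    qed
    have sq: "(\<lambda>\<xi>. (?g \<xi> - ?f \<xi>)\<^sup>2) =
        (\<lambda>\<xi>. ?g \<xi> * ?g \<xi> - 2 * (?f \<xi> * ?g \<xi>) + ?f \<xi> * ?f \<xi>)"
      by (simp add: fun_eq_iff power2_eq_square algebra_simps)
    have int2: "integrable std_gaussian (\<lambda>\<xi>. (?g \<xi> - ?f \<xi>)\<^sup>2)"
      unfolding sq by (intro Bochner_Integration.integrable_add Bochner_Integration.integrable_diff
        integrable_mult_right integrable_orbit_density_mult)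
    note [simp] = int2 integrable_orbit_density integral_orbit_density
    have h0: "0 \<le> ?h \<xi>" for \<xi>
      using pointwise[of \<xi>] f0[of \<xi>] by (meson less_imp_le mult_nonneg_nonneg order_trans zero_le_power2)
    have "(\<integral>\<^sup>+ x. ennreal ((r x)\<^sup>2) \<partial>sample_law \<sigma> (c + \<sigma> *\<^sub>R a)) =
      (\<integral>\<^sup>+ \<xi>. ennreal (?f \<xi>) * ennreal ((?g \<xi> / ?f \<xi>)\<^sup>2) \<partial>std_gaussian)"
      unfolding sample_law_eq_density[OF c]
      by (subst nn_integral_distr) (auto simp: rT nn_integral_density)
    also have "\<dots> \<le> (\<integral>\<^sup>+ \<xi>. ennreal (?h \<xi>) \<partial>std_gaussian)"
    proof (rule nn_integral_mono)
      show "ennreal (?f \<xi>) * ennreal ((?g \<xi> / ?f \<xi>)\<^sup>2) \<le> ennreal (?h \<xi>)" for \<xi>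
        using pointwise[of \<xi>] f0[of \<xi>] by (simp add: ennreal_mult[symmetric] ennreal_leI)
    qed
    also have "\<dots> = ennreal (\<integral>\<xi>. ?h \<xi> \<partial>std_gaussian)"
      by (rule nn_integral_eq_integral) (auto intro: h0)
    also have "(\<integral>\<xi>. ?h \<xi> \<partial>std_gaussian) = 1 + 2 * (\<integral>\<xi>. (?g \<xi> - ?f \<xi>)\<^sup>2 \<partial>std_gaussian)"
      by simp
    also have "ennreal \<dots> \<le> ennreal (1 + 2 * ((\<Sum>i\<in>UNIV. b $ i)\<^sup>2 / CARD('l) +
        3 * exp 4 * ((norm b)\<^sup>2 * (norm a + norm b)\<^sup>2)))"
      using orbit_density_chi_square[OF a b] by (intro ennreal_leI) simp
    finally show "(\<integral>\<^sup>+ x. ennreal ((r x)\<^sup>2) \<partial>sample_law \<sigma> (c + \<sigma> *\<^sub>R a)) \<le>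
      ennreal (1 + 2 * ((\<Sum>i\<in>UNIV. b $ i)\<^sup>2 / CARD('l) + 3 * exp 4 * ((norm b)\<^sup>2 * (norm a + norm b)\<^sup>2)))" .
  qed
qed

section \<open>Two-point lower bound\<close>

text \<open>The likelihood ratio \<open>?R\<close> of \<open>n\<close> samples has second moment at
  most (1 + \<kappa>)^n \<le> exp (n \<kappa>) \<le> 5 / 4, too small for any test \<open>A\<close>
  to be reliable under both laws.\<close>

lemma product_two_point:
  fixes r :: "'a \<Rightarrow> real"
  assumes prob: "prob_space P" and prob': "prob_space (density P (\<lambda>x. ennreal (r x)))"
    and r [measurable]: "r \<in> borel_measurable P" and r0: "\<And>x. 0 \<le> r x"
    and chi: "(\<integral>\<^sup>+ x. ennreal ((r x)\<^sup>2) \<partial>P) \<le> ennreal (1 + \<kappa>)" and n: "0 \<le> \<kappa>" "real n * \<kappa> \<le> 1 / 5"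
    and A [measurable]: "A \<in> sets (\<Pi>\<^sub>M k\<in>{..<n}. P)"
  shows "ennreal (1 / 2) \<le> emeasure (\<Pi>\<^sub>M k\<in>{..<n}. P) (space (\<Pi>\<^sub>M k\<in>{..<n}. P) - A) +
      emeasure (\<Pi>\<^sub>M k\<in>{..<n}. density P (\<lambda>x. ennreal (r x))) A"
proof -
  let ?P = "\<Pi>\<^sub>M k\<in>{..<n}. P"
  let ?R = "\<lambda>x. \<Prod>k<n. r (x k)"
  interpret product_prob_space "\<lambda>_ :: nat. P" "{..<n}"
    by (simp add: product_prob_space_def product_prob_space_axioms_def product_sigma_finite_def
        prob prob_space_imp_sigma_finite)
  have PP: "prob_space ?P" by (rule prob_space_PiM) (rule prob)
  have R0: "0 \<le> ?R x" for x by (simp add: prod_nonneg r0)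
  have [measurable]: "?R \<in> borel_measurable ?P" by measurable
  have Qn: "(\<Pi>\<^sub>M k\<in>{..<n}. density P (\<lambda>x. ennreal (r x))) = density ?P (\<lambda>x. ennreal (?R x))"
    using PiM_density[of "{..<n}" "\<lambda>_. P" "\<lambda>_ x. ennreal (r x)"] prob prob' by (simp add: prod_ennreal r0)
  have R2: "(\<integral>\<^sup>+ x. ennreal ((?R x)\<^sup>2) \<partial>?P) \<le> ennreal (5 / 4)"
  proof -
    have "(\<integral>\<^sup>+ x. ennreal ((?R x)\<^sup>2) \<partial>?P) = (\<integral>\<^sup>+ x. (\<Prod>k<n. ennreal ((r (x k))\<^sup>2)) \<partial>?P)"
      by (intro nn_integral_cong) (simp add: prod_ennreal prod_power_distrib)
    also have "\<dots> = (\<integral>\<^sup>+ x. ennreal ((r x)\<^sup>2) \<partial>P) ^ n"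
      by (subst product_nn_integral_prod) auto
    also have "\<dots> \<le> ennreal (1 + \<kappa>) ^ n" by (intro power_mono chi) auto
    also have "\<dots> = ennreal ((1 + \<kappa>) ^ n)" using n by (subst ennreal_power) auto
    also have "(1 + \<kappa>) ^ n \<le> exp \<kappa> ^ n" using n by (intro power_mono) auto
    also have "exp \<kappa> ^ n = exp (real n * \<kappa>)" by (simp add: exp_of_nat_mult)
    also have "\<dots> \<le> 5 / 4"
    proof -
      have "4 / 5 \<le> exp (- (real n * \<kappa>))" using exp_ge_add_one_self[of "- (real n * \<kappa>)"] n by simp
      then show ?thesis by (simp add: exp_minus field_simps)
    qed
    finally show ?thesis by (simp add: ennreal_leI)
  qed
  have R1: "(\<integral>\<^sup>+ x. ennreal (?R x) \<partial>?P) = 1"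
  proof -
    have "prob_space (density ?P (\<lambda>x. ennreal (?R x)))"
      unfolding Qn[symmetric] by (intro prob_space_PiM prob')
    from prob_space.emeasure_space_1[OF this] show ?thesis
      by (simp add: emeasure_density cong: nn_integral_cong)
  qed
  let ?B = "space ?P - A"
  have "2 * (\<integral>\<^sup>+ x. ennreal (?R x) \<partial>?P) = (\<integral>\<^sup>+ x. ennreal (2 * ?R x) \<partial>?P)"
    by (simp add: nn_integral_cmult[symmetric] ennreal_mult')
  also have "\<dots> \<le> (\<integral>\<^sup>+ x. indicator ?B x + ennreal (?R x) * indicator A x + ennreal (1 / 4) + ennreal ((?R x)\<^sup>2) \<partial>?P)"
  proof (rule nn_integral_mono)
    fix x assume x: "x \<in> space ?P"
    \<comment> \<open>On \<open>A\<close> one copy of \<open>?R\<close> is kept and the other is at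
      most 1 / 4 + ?R^2; off \<open>A\<close>, 2 ?R \<le> 1 + ?R^2. Integrated, 2 is at most the sum
      of the two errors plus 1 / 4 + 5 / 4, which leaves 1 / 2 for the errors.\<close>
    have quadratic: "y \<le> 1 / 4 + y\<^sup>2" "2 * y \<le> 1 + y\<^sup>2" for y :: real
      using zero_le_power2[of "y - 1 / 2"] zero_le_power2[of "y - 1"]
      by (simp_all add: power2_eq_square algebra_simps)
    note le = quadratic[of "?R x"]
    show "ennreal (2 * ?R x) \<le> indicator ?B x + ennreal (?R x) * indicator A x + ennreal (1 / 4) + ennreal ((?R x)\<^sup>2)"
    proof (cases "x \<in> A")
      case True
      have "ennreal (2 * ?R x) \<le> ennreal (?R x + 1 / 4 + (?R x)\<^sup>2)"
        using le R0[of x] by (intro ennreal_leI) linarith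
      then show ?thesis using True R0[of x] by (simp add: ennreal_plus)
    next
      case False
      have "ennreal (2 * ?R x) \<le> ennreal (1 + 1 / 4 + (?R x)\<^sup>2)"
        using le R0[of x] by (intro ennreal_leI) linarith
      also have "\<dots> = ennreal (1 + 1 / 4) + ennreal ((?R x)\<^sup>2)"
        by (rule ennreal_plus) auto
      also have "ennreal (1 + 1 / 4) = ennreal 1 + ennreal (1 / 4)"
        by (rule ennreal_plus) auto
      finally show ?thesis using False x by simp
    qed
  qed
  also have "\<dots> = emeasure ?P ?B + emeasure (density ?P (\<lambda>x. ennreal (?R x))) A + ennreal (1 / 4) +
      (\<integral>\<^sup>+ x. ennreal ((?R x)\<^sup>2) \<partial>?P)"
    by (simp add: nn_integral_add emeasure_density prob_space.emeasure_space_1[OF PP])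
  also have "\<dots> \<le> emeasure ?P ?B + emeasure (density ?P (\<lambda>x. ennreal (?R x))) A + ennreal (1 / 4) + ennreal (5 / 4)"
    by (intro add_left_mono R2)
  finally have le: "ennreal 2 \<le> (emeasure ?P ?B + emeasure (density ?P (\<lambda>x. ennreal (?R x))) A) + ennreal (3 / 2)"
    by (simp add: R1 add.assoc ennreal_plus[symmetric] del: ennreal_plus)
  have "ennreal (1 / 2) \<le> emeasure ?P ?B + emeasure (density ?P (\<lambda>x. ennreal (?R x))) A"
  proof (cases "emeasure ?P ?B + emeasure (density ?P (\<lambda>x. ennreal (?R x))) A")
    case (real s)
    have "2 \<le> s + 3 / 2" using le real by (simp add: ennreal_plus[symmetric] del: ennreal_plus)
    then have "ennreal (1 / 2) \<le> ennreal s" by (intro ennreal_leI) simp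
    then show ?thesis by (simp only: real)
  qed simp
  then show ?thesis unfolding Qn .
qed

text \<open>An estimator yields a test: accept \<open>\<theta>\<close> if the loss there is below
  half of \<open>rho \<theta> \<phi>\<close>. A wrong decision costs at least half the distance
  under either law, so the two risks add up to at least a quarter of it, and the larger one is at
  least an eighth.\<close>

lemma minimax_risk_two_point:
  fixes \<theta> \<phi> :: "real ^ 'l::finite mod_ring" and r :: "real ^ 'l mod_ring \<Rightarrow> real"
  assumes T: "\<theta> \<in> T" "\<phi> \<in> T"
    and r [measurable]: "r \<in> borel_measurable borel" and r0: "\<And>x. 0 \<le> r x"
    and Q: "sample_law \<sigma> \<phi> = density (sample_law \<sigma> \<theta>) (\<lambda>x. ennreal (r x))"
    and chi: "(\<integral>\<^sup>+ x. ennreal ((r x)\<^sup>2) \<partial>sample_law \<sigma> \<theta>) \<le> ennreal (1 + \<kappa>)" 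
    and n: "0 \<le> \<kappa>" "real n * \<kappa> \<le> 1 / 5"
  shows "ennreal (rho \<theta> \<phi> / 8) \<le> minimax_risk n \<sigma> T"
  unfolding minimax_risk_def
proof (rule INF_greatest)
  fix est :: "(nat \<Rightarrow> real ^ 'l mod_ring) \<Rightarrow> real ^ 'l mod_ring"
  assume "est \<in> estimators n"
  then have e: "est \<in> (\<Pi>\<^sub>M k\<in>{..<n}. borel) \<rightarrow>\<^sub>M borel" by (simp add: estimators_def)
  let ?P = "samples_law n \<sigma> \<theta>" and ?Q = "samples_law n \<sigma> \<phi>" and ?\<Delta> = "rho \<theta> \<phi>"
  have setsS: "sets (samples_law n \<sigma> \<psi>) = sets (\<Pi>\<^sub>M k\<in>{..<n}. borel)" for \<psi> :: "real ^ 'l mod_ring"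
    unfolding samples_law_def by (intro sets_PiM_cong) auto
  have e' [measurable]: "est \<in> samples_law n \<sigma> \<psi> \<rightarrow>\<^sub>M borel" for \<psi>
    using e measurable_cong_sets[OF setsS refl] by auto
  have sp: "space ?P = space ?Q" by (rule sets_eq_imp_space_eq) (simp add: setsS)
  define A where "A = {x \<in> space ?P. rho (est x) \<theta> < ?\<Delta> / 2}"
  have A [measurable]: "A \<in> sets ?P" unfolding A_def by measurable
  have A' [measurable]: "A \<in> sets ?Q" using A by (simp add: setsS)
  have half: "ennreal (1 / 2) \<le> emeasure ?P (space ?P - A) + emeasure ?Q A"
    unfolding samples_law_def Q
  proof (rule product_two_point[OF _ _ _ r0 chi n])
    show "prob_space (density (sample_law \<sigma> \<theta>) (\<lambda>x. ennreal (r x)))"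
      unfolding Q[symmetric] by (rule prob_space_sample_law)
    show "A \<in> sets (\<Pi>\<^sub>M k\<in>{..<n}. sample_law \<sigma> \<theta>)" using A by (simp add: samples_law_def)
  qed (auto simp: prob_space_sample_law)
  have risk1: "ennreal (?\<Delta> / 2) * emeasure ?P (space ?P - A) \<le> risk n \<sigma> est \<theta>"
  proof -
    have "ennreal (?\<Delta> / 2) * emeasure ?P (space ?P - A) = (\<integral>\<^sup>+ x. ennreal (?\<Delta> / 2) * indicator (space ?P - A) x \<partial>?P)"
      by (subst nn_integral_cmult_indicator) auto
    also have "\<dots> \<le> risk n \<sigma> est \<theta>"
      unfolding risk_def by (intro nn_integral_mono) (auto simp: A_def indicator_def intro!: ennreal_leI)
    finally show ?thesis .
  qed
  have risk2: "ennreal (?\<Delta> / 2) * emeasure ?Q A \<le> risk n \<sigma> est \<phi>"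
  proof -
    have "?\<Delta> / 2 \<le> rho (est x) \<phi>" if "x \<in> A" for x
      using that rho_triangle[of \<theta> \<phi> "est x"] by (simp add: A_def)
    moreover have "ennreal (?\<Delta> / 2) * emeasure ?Q A = (\<integral>\<^sup>+ x. ennreal (?\<Delta> / 2) * indicator A x \<partial>?Q)"
      by (subst nn_integral_cmult_indicator) auto
    ultimately show ?thesis
      unfolding risk_def by (auto simp: indicator_def intro!: nn_integral_mono ennreal_leI)
  qed
  let ?S = "SUP \<psi>\<in>T. risk n \<sigma> est \<psi>"
  have "ennreal (?\<Delta> / 2) * ennreal (1 / 2) \<le> ennreal (?\<Delta> / 2) * (emeasure ?P (space ?P - A) + emeasure ?Q A)"
    by (intro mult_left_mono half) auto
  also have "\<dots> \<le> risk n \<sigma> est \<theta> + risk n \<sigma> est \<phi>"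
    unfolding distrib_left by (intro add_mono risk1 risk2)
  also have "\<dots> \<le> ?S + ?S" by (intro add_mono SUP_upper T)
  finally have le: "ennreal (?\<Delta> / 2) * ennreal (1 / 2) \<le> ?S + ?S" .
  have h: "ennreal (?\<Delta> / 2) * ennreal (1 / 2) = ennreal (?\<Delta> / 4)"
    using rho_nonneg[of \<theta> \<phi>] by (subst ennreal_mult[symmetric]) auto
  show "ennreal (?\<Delta> / 8) \<le> ?S"
  proof (cases ?S)
    case (real s)
    then show ?thesis using le unfolding h by (simp add: ennreal_plus[symmetric] del: ennreal_plus)
  qed (simp only: top_greatest)
qed

section \<open>Collision-free signals\<close>

lemma collision_free_cong: "supp \<theta> = supp \<phi> \<Longrightarrow> collision_free \<theta> \<longleftrightarrow> collision_free \<phi>"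
  by (simp add: collision_free_def diffs_def)

text \<open>Working form of \<open>collision_free\<close>: multiplicity one in the multiset means
  that the fibre of the difference map on ordered pairs is a singleton.\<close>

lemma collision_free_unique:
  assumes cf: "collision_free \<theta>" and mem: "i \<in> supp \<theta>" "j \<in> supp \<theta>" "i' \<in> supp \<theta>" "j' \<in> supp \<theta>"
    and neq: "i \<noteq> j" and eq: "i - j = i' - j'"
  shows "i = i' \<and> j = j'"
proof -
  let ?S = "{(i, j). i \<in> supp \<theta> \<and> j \<in> supp \<theta> \<and> i \<noteq> j}" and ?f = "\<lambda>(i, j). i - j"
  have fin: "finite ?S" by (rule finite_subset[of _ UNIV]) auto
  have neq': "i' \<noteq> j'" using neq eq by auto
  have S: "(i, j) \<in> ?S" "(i', j') \<in> ?S" using mem neq neq' by auto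
  have count: "count (diffs \<theta>) (i - j) = card {p \<in> ?S. ?f p = i - j}"
    unfolding diffs_def using fin by (subst count_image_mset') (auto intro!: arg_cong[where f = card])
  have "i - j \<in># diffs \<theta>"
    unfolding diffs_def using S(1) fin by force
  then have "card {p \<in> ?S. ?f p = i - j} = 1"
    using cf count by (simp add: collision_free_def)
  then obtain q where q: "{p \<in> ?S. ?f p = i - j} = {q}" by (rule card_1_singletonE)
  have "(i, j) \<in> {p \<in> ?S. ?f p = i - j}" "(i', j') \<in> {p \<in> ?S. ?f p = i - j}"
    using S eq by auto
  then show ?thesis unfolding q by auto
qed

text \<open>Otherwise the support is invariant under adding \<open>l\<close>, and for two support
  points \<open>i\<close>, \<open>j\<close> the pairs \<open>(i + l, i)\<close> and
  \<open>(j + l, j)\<close> share the difference \<open>l\<close>.\<close>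

lemma collision_free_shift_neq:
  assumes cf: "collision_free \<theta>" and s: "2 \<le> card (supp \<theta>)" and l: "l \<noteq> 0"
  shows "shift l \<theta> \<noteq> \<theta>"
proof
  assume eq: "shift l \<theta> = \<theta>"
  obtain i j where ij: "i \<in> supp \<theta>" "j \<in> supp \<theta>" "i \<noteq> j"
    using s card_le_Suc0_iff_eq[of "supp \<theta>"] by force
  have "\<theta> $ (k + l) = \<theta> $ k" for k using arg_cong[OF eq, of "\<lambda>v. v $ k"] by simp
  then have "i + l \<in> supp \<theta>" "j + l \<in> supp \<theta>" using ij by (simp_all add: supp_def)
  with collision_free_unique[OF cf, of "i + l" i "j + l" j] ij l show False by simp
qed

text \<open>Source of the radius \<open>D\<close>, on which all constants free of
  \<open>\<sigma>\<close> rest.\<close>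

lemma signals_norm_le: 
  fixes \<theta> :: "real ^ 'l::finite mod_ring" and M :: real
  assumes "\<theta> \<in> signals m M \<epsilon> \<sigma>" "M > 0"
  shows "norm \<theta> \<le> CARD('l) * M"
proof -
  have "norm \<theta> \<le> (\<Sum>i\<in>UNIV. \<bar>\<theta> $ i\<bar>)" by (rule norm_le_l1_cart)
  also have "\<dots> \<le> (\<Sum>i\<in>(UNIV :: 'l mod_ring set). M)"
    using assms by (intro sum_mono) (force simp: signals_def supp_def)
  finally show ?thesis by simp
qed

lemma signals_card_supp: "\<theta> \<in> signals m M \<epsilon> \<sigma> \<Longrightarrow> 7 \<le> card (supp \<theta>)"
  by (simp add: signals_def)

section \<open>The lower bound\<close>

text \<open>In units of \<open>\<sigma>\<close> the centered reference has norm at most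
  \<open>D / \<sigma>\<close> and the displacement at most \<open>2 * t / \<sigma>\<close>. The
  first-order part \<open>t\<^sup>2 / \<sigma>\<^sup>2\<close> is dominated by the second-order
  scale \<open>D\<^sup>2 * t\<^sup>2 / \<sigma> ^ 4\<close> only if \<open>\<sigma> \<le> D\<close>;
  hence the alternative on the sum of \<open>h\<close>.\<close>

lemma minimax_risk_segment:
  fixes \<theta> h :: "real ^ 'l::finite mod_ring"
  assumes \<sigma>: "\<sigma> > 0" and D: "norm \<theta> \<le> \<sigma>" "norm \<theta> \<le> D"
    and h: "norm h \<le> 2" "(\<Sum>i\<in>UNIV. h $ i) = 0 \<or> \<sigma> \<le> D \<and> \<bar>\<Sum>i\<in>UNIV. h $ i\<bar> \<le> 1"
    and t: "0 \<le> t" "2 * t \<le> \<sigma>" "2 * t \<le> D"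
    and T: "\<theta> \<in> T" "\<theta> + t *\<^sub>R h \<in> T"
    and n: "real n * (2 * D\<^sup>2 * (1 + 48 * exp 4) * t\<^sup>2 / \<sigma> ^ 4) \<le> 1 / 5"
  shows "ennreal (rho \<theta> (\<theta> + t *\<^sub>R h) / 8) \<le> minimax_risk n \<sigma> T"
proof -
  let ?L = "real CARD('l)"
  \<comment> \<open>\<open>c\<close> is the projection of \<open>\<theta>\<close> onto the
    shift-invariant vectors. Both signals are centered at it, so \<open>a\<close> has sum zero while
    \<open>b\<close> keeps the sum of \<open>h\<close>.\<close>
  define \<mu> where "\<mu> = (\<Sum>i\<in>UNIV. \<theta> $ i) / ?L"
  define c :: "real ^ 'l mod_ring" where "c = (\<chi> i. \<mu>)"
  define a where "a = (1 / \<sigma>) *\<^sub>R (\<theta> - c)"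
  define b where "b = (t / \<sigma>) *\<^sub>R h"
  have c: "shift l c = c" for l by (simp add: c_def vec_eq_iff)
  have \<theta>: "\<theta> = c + \<sigma> *\<^sub>R a" "\<theta> + t *\<^sub>R h = c + \<sigma> *\<^sub>R (a + b)"
    using \<sigma> by (simp_all add: a_def b_def scaleR_add_right)
  have sum0: "(\<Sum>i\<in>UNIV. (\<theta> - c) $ i) = 0"
    by (simp add: c_def sum_subtractf \<mu>_def)
  then have sum: "(\<Sum>i\<in>UNIV. a $ i) = 0"
    by (simp add: a_def sum_divide_distrib[symmetric])
  have "norm (\<theta> - c) \<le> norm \<theta>"
  proof -
    have "(\<theta> - c) \<bullet> c = 0"
      using sum0 by (simp add: inner_vec_def c_def sum_distrib_right[symmetric])
    then have "\<theta> \<bullet> \<theta> = (\<theta> - c) \<bullet> (\<theta> - c) + c \<bullet> c"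
      by (simp add: inner_diff_left inner_diff_right inner_commute)
    then show ?thesis by (simp add: norm_eq_sqrt_inner)
  qed
  moreover have "norm a = norm (\<theta> - c) / \<sigma>"
    unfolding a_def norm_scaleR using \<sigma> by simp
  ultimately have aD: "norm a \<le> D / \<sigma>" and a1: "norm a \<le> 1"
    using D \<sigma> by (auto simp: divide_right_mono)
  have bt: "norm b \<le> 2 * t / \<sigma>"
    using mult_left_mono[OF h(1), of "t / \<sigma>"] t \<sigma> by (simp add: b_def mult.commute[of 2])
  also have "\<dots> \<le> 1" using t \<sigma> by simp
  finally have b1: "norm b \<le> 1" .
  have D0: "0 \<le> D" using D norm_ge_zero order_trans by blast
  let ?q = "(\<Sum>i\<in>UNIV. b $ i)\<^sup>2 / ?L + 3 * exp 4 * ((norm b)\<^sup>2 * (norm a + norm b)\<^sup>2)"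
  have q0: "0 \<le> ?q" by (intro add_nonneg_nonneg) auto
  have first: "(\<Sum>i\<in>UNIV. b $ i)\<^sup>2 / ?L \<le> D\<^sup>2 * t\<^sup>2 / \<sigma> ^ 4"
  proof -
    have b: "(\<Sum>i\<in>UNIV. b $ i) = t / \<sigma> * (\<Sum>i\<in>UNIV. h $ i)" by (simp add: b_def sum_distrib_left)
    have "(\<Sum>i\<in>UNIV. b $ i)\<^sup>2 / ?L \<le> (t / \<sigma> * (\<Sum>i\<in>UNIV. h $ i))\<^sup>2 / 1"
      unfolding b by (intro divide_left_mono) (auto simp: Suc_le_eq)
    also have "(t / \<sigma> * (\<Sum>i\<in>UNIV. h $ i))\<^sup>2 / 1 \<le> D\<^sup>2 * t\<^sup>2 / \<sigma> ^ 4"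
    proof (cases "(\<Sum>i\<in>UNIV. h $ i) = 0")
      case False
      then have h: "\<sigma> \<le> D" "\<bar>\<Sum>i\<in>UNIV. h $ i\<bar> \<le> 1" using h by auto
      have "(t / \<sigma> * (\<Sum>i\<in>UNIV. h $ i))\<^sup>2 = (t / \<sigma>)\<^sup>2 * (\<Sum>i\<in>UNIV. h $ i)\<^sup>2" by (simp only: power_mult_distrib)
      also have "\<dots> \<le> (t / \<sigma>)\<^sup>2 * 1"
        using power_mono[OF h(2), of 2] by (intro mult_left_mono) auto
      \<comment> \<open>\<open>D / \<sigma>\<close> is at least 1 here and supplies the missing
        factor.\<close>
      also have "\<dots> \<le> (t / \<sigma>)\<^sup>2 * (D / \<sigma>)\<^sup>2"
        using h \<sigma> by (intro mult_left_mono one_le_power) auto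
      also have "\<dots> = D\<^sup>2 * t\<^sup>2 / \<sigma> ^ 4" by (simp add: power_divide power2_eq_square power4_eq_xxxx mult_ac)
      finally show ?thesis by simp
    qed simp
    finally show ?thesis .
  qed
  have "(norm b)\<^sup>2 * (norm a + norm b)\<^sup>2 \<le> (2 * t / \<sigma>)\<^sup>2 * (2 * D / \<sigma>)\<^sup>2"
  proof (intro mult_mono power_mono bt)
    have "norm a + norm b \<le> D / \<sigma> + 2 * t / \<sigma>" using aD bt by simp
    also have "\<dots> \<le> 2 * D / \<sigma>" using t \<sigma> by (simp add: field_simps)
    finally show "norm a + norm b \<le> 2 * D / \<sigma>" .
  qed auto
  then have "3 * exp 4 * ((norm b)\<^sup>2 * (norm a + norm b)\<^sup>2) \<le> 3 * exp 4 * ((2 * t / \<sigma>)\<^sup>2 * (2 * D / \<sigma>)\<^sup>2)"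
    by (intro mult_left_mono) auto
  \<comment> \<open>48 is 3 * 4 * 4. In \<open>2 * D\<^sup>2 * (1 + 48 * exp 4)\<close> the 1 is the
    first-order part, and the leading 2 stems from the lower bound 1 / 2 on the reference
    density.\<close>
  also have "3 * exp 4 * ((2 * t / \<sigma>)\<^sup>2 * (2 * D / \<sigma>)\<^sup>2) = 48 * exp 4 * (D\<^sup>2 * t\<^sup>2 / \<sigma> ^ 4)"
    by (simp add: power_divide power2_eq_square power4_eq_xxxx mult_ac)
  finally have "2 * ?q \<le> 2 * (D\<^sup>2 * t\<^sup>2 / \<sigma> ^ 4 + 48 * exp 4 * (D\<^sup>2 * t\<^sup>2 / \<sigma> ^ 4))"
    using first by (intro mult_left_mono add_mono) auto
  also have "\<dots> = 2 * D\<^sup>2 * (1 + 48 * exp 4) * t\<^sup>2 / \<sigma> ^ 4"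
    by (simp add: algebra_simps add_divide_distrib)
  finally have q: "2 * ?q \<le> 2 * D\<^sup>2 * (1 + 48 * exp 4) * t\<^sup>2 / \<sigma> ^ 4" .
  obtain r where r: "r \<in> borel_measurable borel" "\<And>x. 0 \<le> r x"
    "sample_law \<sigma> (c + \<sigma> *\<^sub>R (a + b)) = density (sample_law \<sigma> (c + \<sigma> *\<^sub>R a)) (\<lambda>x. ennreal (r x))"
    "(\<integral>\<^sup>+ x. ennreal ((r x)\<^sup>2) \<partial>sample_law \<sigma> (c + \<sigma> *\<^sub>R a)) \<le> ennreal (1 + 2 * ?q)"
    using sample_law_likelihood_ratio[OF \<sigma> c sum a1 b1] by blast
  show ?thesis
  proof (rule minimax_risk_two_point[OF T r(1,2)])
    show "sample_law \<sigma> (\<theta> + t *\<^sub>R h) = density (sample_law \<sigma> \<theta>) (\<lambda>x. ennreal (r x))"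
      using r(3) unfolding \<theta>(2) \<theta>(1)[symmetric] .
    show "(\<integral>\<^sup>+ x. ennreal ((r x)\<^sup>2) \<partial>sample_law \<sigma> \<theta>) \<le> ennreal (1 + 2 * ?q)"
      using r(4) unfolding \<theta>(1)[symmetric] .
    show "0 \<le> 2 * ?q" using q0 by simp
    have "real n * (2 * ?q) \<le> real n * (2 * D\<^sup>2 * (1 + 48 * exp 4) * t\<^sup>2 / \<sigma> ^ 4)"
      using q by (intro mult_left_mono) auto
    then show "real n * (2 * ?q) \<le> 1 / 5" using n by linarith
  qed
qed

text \<open>Nonzero shifts move \<open>\<theta>\<close> by at least a fixed gap. After a
  perturbation of at most half the gap, they still leave a distance no smaller than that of the
  unshifted vector.\<close>

lemma rho_segment:
  fixes \<theta> :: "real ^ 'l::finite mod_ring"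
  assumes "\<And>l. l \<noteq> 0 \<Longrightarrow> shift l \<theta> \<noteq> \<theta>"
  obtains g where "g > 0" "\<And>v :: real ^ 'l::finite mod_ring. norm v \<le> g \<Longrightarrow> norm v \<le> rho \<theta> (\<theta> + v)"
proof -
  \<comment> \<open>The 1 keeps the set nonempty when \<open>CARD('l) = 1\<close> and there is no
    nonzero shift.\<close>
  let ?S = "insert 1 ((\<lambda>l. norm (\<theta> - shift l \<theta>)) ` {l. l \<noteq> 0})"
  have fin: "finite ?S" by simp
  have pos: "0 < Min ?S"
    using assms by (subst Min_gr_iff) (auto simp: eq_commute[of \<theta>])
  show ?thesis
  proof
    show "0 < Min ?S / 2" using pos by simp
    fix v :: "real ^ 'l mod_ring" assume v: "norm v \<le> Min ?S / 2"
    obtain l where l: "rho \<theta> (\<theta> + v) = norm (\<theta> - shift l (\<theta> + v))" by (rule rho_attained)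
    show "norm v \<le> rho \<theta> (\<theta> + v)"
    proof (cases "l = 0")
      case True
      then show ?thesis using l by simp
    next
      case False
      then have "Min ?S \<le> norm (\<theta> - shift l \<theta>)" by (intro Min_le[OF fin]) auto
      moreover have "norm (\<theta> - shift l \<theta>) \<le> norm (\<theta> - shift l (\<theta> + v)) + norm v"
        using norm_triangle_ineq[of "\<theta> - shift l (\<theta> + v)" "shift l v"] by (simp add: shift_add)
      ultimately show ?thesis using v l by linarith
    qed
  qed
qed

lemma finite_vec_range:
  assumes "finite A"
  shows "finite {\<theta> :: 'a ^ 'k::finite. \<forall>i. \<theta> $ i \<in> A}"
proof (rule finite_surj)
  show "finite (\<Pi>\<^sub>E i\<in>(UNIV :: 'k set). A)" by (intro finite_PiE assms) auto
  show "{\<theta> :: 'a ^ 'k. \<forall>i. \<theta> $ i \<in> A} \<subseteq> (\<lambda>f. \<chi> i. f i) ` (\<Pi>\<^sub>E i\<in>UNIV. A)"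
  proof
    fix \<theta> :: "'a ^ 'k" assume "\<theta> \<in> {\<theta>. \<forall>i. \<theta> $ i \<in> A}"
    then show "\<theta> \<in> (\<lambda>f. \<chi> i. f i) ` (\<Pi>\<^sub>E i\<in>UNIV. A)"
      by (intro image_eqI[of _ _ "($) \<theta>"]) (auto simp: vec_eq_iff)
  qed
qed

text \<open>For small noise one entry is decreased in absolute value, which keeps the norm bounded by the
  noise level; for large noise the norm constraint is void and the direction can be taken with sum
  zero, which is invisible in the first moment.\<close>

lemma signals_segment:
  fixes m M \<epsilon> \<sigma> :: real
  assumes inf: "infinite (signals m M \<epsilon> \<sigma> :: (real ^ 'l::finite mod_ring) set)" and m: "m > 0" "M > 0"
  obtains \<theta> h :: "real ^ 'l::finite mod_ring" and \<tau> where "\<tau> > 0"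
    "\<And>t. 0 \<le> t \<Longrightarrow> t \<le> \<tau> \<Longrightarrow> \<theta> + t *\<^sub>R h \<in> signals m M \<epsilon> \<sigma>"
    "1 \<le> norm h" "norm h \<le> 2"
    "(\<Sum>i\<in>UNIV. h $ i) = 0 \<or> \<sigma> \<le> CARD('l::finite) * M \<and> \<bar>\<Sum>i\<in>UNIV. h $ i\<bar> \<le> 1"
proof -
  let ?T = "signals m M \<epsilon> \<sigma> :: (real ^ 'l mod_ring) set"
  \<comment> \<open>Only finitely many vectors have all entries in \<open>{0, m, - m}\<close>, so
    some signal has an entry of absolute value strictly above \<open>m\<close>, which leaves room to
    move.\<close>
  have "\<not> ?T \<subseteq> {\<theta>. \<forall>i. \<theta> $ i \<in> {0, m, - m}}"
    using inf finite_subset finite_vec_range[of "{0, m, - m}"] by blast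
  then obtain \<theta> i where \<theta>: "\<theta> \<in> ?T" "\<theta> $ i \<notin> {0, m, - m}" by blast
  then have i: "i \<in> supp \<theta>" "m < \<bar>\<theta> $ i\<bar>" "\<bar>\<theta> $ i\<bar> \<le> M"
    by (force simp: signals_def supp_def)+
  show ?thesis
  proof (cases "\<sigma> \<le> CARD('l) * M")
    case True
    define h :: "real ^ 'l mod_ring" where "h = axis i (- sgn (\<theta> $ i))"
    have s: "\<bar>sgn (\<theta> $ i)\<bar> = 1" using i by (auto simp: supp_def abs_sgn_eq)
    have h1: "norm h = 1" using s by (simp add: h_def norm_eq_sqrt_inner inner_axis)
    show ?thesis
    proof (rule that[of "\<bar>\<theta> $ i\<bar> - m" \<theta> h])
      fix t :: real assume t: "0 \<le> t" "t \<le> \<bar>\<theta> $ i\<bar> - m"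
      let ?\<phi> = "\<theta> + t *\<^sub>R h"
      have \<phi>i: "\<bar>?\<phi> $ i\<bar> = \<bar>\<theta> $ i\<bar> - t"
        using t m i by (auto simp: h_def sgn_real_def abs_if split: if_splits)
      have \<phi>k: "?\<phi> $ k = \<theta> $ k" if "k \<noteq> i" for k using that by (simp add: h_def axis_def)
      have le: "\<bar>?\<phi> $ k\<bar> \<le> \<bar>\<theta> $ k\<bar>" for k
      proof (cases "k = i")
        case True
        then show ?thesis using \<phi>i t by simp
      next
        case False
        show ?thesis unfolding \<phi>k[OF False] ..
      qed
      have "?\<phi> $ i \<noteq> 0" using \<phi>i t m by auto
      then have "k \<in> supp ?\<phi> \<longleftrightarrow> k \<in> supp \<theta>" for k
        using i \<phi>k[of k] by (cases "k = i") (auto simp: supp_def)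
      then have supp: "supp ?\<phi> = supp \<theta>" by blast
      have "norm ?\<phi> \<le> norm \<theta>" using le by (intro norm_le_componentwise_cart) auto
      moreover have "m \<le> \<bar>?\<phi> $ k\<bar> \<and> \<bar>?\<phi> $ k\<bar> \<le> M" if "k \<in> supp \<theta>" for k
        using that \<theta> \<phi>i \<phi>k[of k] t i by (cases "k = i") (auto simp: signals_def)
      ultimately show "?\<phi> \<in> ?T"
        using \<theta> collision_free_cong[OF supp] unfolding signals_def supp[symmetric] by (auto simp: supp)
    qed (use i h1 True s in \<open>auto simp: h_def axis_def\<close>)
  next
    case False
    have "\<not> supp \<theta> \<subseteq> {i}"
      using card_mono[of "{i}" "supp \<theta>"] signals_card_supp[OF \<theta>(1)] by auto
    then obtain j where j: "j \<in> supp \<theta>" "j \<noteq> i" by auto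
    define h :: "real ^ 'l mod_ring" where "h = axis i 1 - axis j 1"
    \<comment> \<open>Collision-freeness depends on the support only, so the entries may be reset to
      the midpoint of \<open>m\<close> and \<open>M\<close>. This leaves room
      \<open>(M - m) / 2\<close> on both sides, as two entries move in opposite directions.\<close>
    define \<psi> :: "real ^ 'l mod_ring" where "\<psi> = (\<chi> k. if k \<in> supp \<theta> then (m + M) / 2 else 0)"
    have mM: "m < M" using i by linarith
    show ?thesis
    proof (rule that[of "(M - m) / 2" \<psi> h])
      show "0 < (M - m) / 2" using mM by simp
      have "\<bar>h $ i\<bar> = 1" using j by (simp add: h_def axis_def)
      then show "1 \<le> norm h" using component_le_norm_cart[of h i] by simp
      show "norm h \<le> 2" unfolding h_def using norm_triangle_ineq4[of "axis i 1" "axis j (1 :: real)"] by simp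
      show "(\<Sum>k\<in>UNIV. h $ k) = 0 \<or> \<sigma> \<le> CARD('l) * M \<and> \<bar>\<Sum>k\<in>UNIV. h $ k\<bar> \<le> 1"
        by (simp add: h_def axis_def sum_subtractf)
      fix t :: real assume t: "0 \<le> t" "t \<le> (M - m) / 2"
      let ?\<phi> = "\<psi> + t *\<^sub>R h"
      have in_supp: "m \<le> ?\<phi> $ k \<and> ?\<phi> $ k \<le> M" if "k \<in> supp \<theta>" for k
        using that t j by (auto simp: \<psi>_def h_def axis_def field_simps)
      have out: "?\<phi> $ k = 0" if "k \<notin> supp \<theta>" for k
        using that i j by (auto simp: \<psi>_def h_def axis_def)
      have "k \<in> supp ?\<phi> \<longleftrightarrow> k \<in> supp \<theta>" for k
        using in_supp[of k] out[of k] m by (cases "k \<in> supp \<theta>") (auto simp: supp_def[of ?\<phi>])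
      then have supp: "supp ?\<phi> = supp \<theta>" by blast
      have abs: "m \<le> \<bar>?\<phi> $ k\<bar> \<and> \<bar>?\<phi> $ k\<bar> \<le> M" if "k \<in> supp \<theta>" for k
        using in_supp[OF that] m by auto
      have "norm ?\<phi> \<le> (\<Sum>k\<in>UNIV. \<bar>?\<phi> $ k\<bar>)" by (rule norm_le_l1_cart)
      also have "\<dots> \<le> (\<Sum>k\<in>(UNIV :: 'l mod_ring set). M)"
      proof (rule sum_mono)
        show "\<bar>?\<phi> $ k\<bar> \<le> M" for k using abs[of k] out[of k] m by (cases "k \<in> supp \<theta>") auto
      qed
      also have "\<dots> \<le> \<sigma>" using False by simp
      finally have "norm ?\<phi> \<le> \<sigma>" .
      then show "?\<phi> \<in> ?T"
        using \<theta>(1) collision_free_cong[OF supp] abs unfolding signals_def by (auto simp: supp)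
    qed
  qed
qed

text \<open>The step \<open>t n\<close> makes n t^2 / \<sigma>^4 equal to the constant
  \<open>c\<^sup>2\<close>, so the condition of the segment bound becomes one on \<open>c\<close>,
  free of \<open>\<sigma>\<close>. The length of the segment and the gap \<open>g\<close> of the
  base point only decide how large \<open>n\<close> must be.\<close>

lemma minimax_risk_lower_bound:
  fixes m M \<epsilon> \<sigma> :: real
  assumes m: "m > 0" "M > 0" and \<sigma>: "\<sigma> > 0"
    and inf: "infinite (signals m M \<epsilon> \<sigma> :: (real ^ 'l::finite mod_ring) set)"
    and D: "D = CARD('l) * M"
    and c: "c > 0" "2 * D\<^sup>2 * (1 + 48 * exp 4) * c\<^sup>2 \<le> 1 / 5"
  shows "\<forall>\<^sub>F n in sequentially. ennreal (c / 8 * (\<sigma>\<^sup>2 / sqrt (real n)))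
        \<le> minimax_risk n \<sigma> (signals m M \<epsilon> \<sigma> :: (real ^ 'l mod_ring) set)"
proof -
  let ?T = "signals m M \<epsilon> \<sigma> :: (real ^ 'l mod_ring) set"
  obtain \<theta> h :: "real ^ 'l mod_ring" and \<tau> where \<tau>: "\<tau> > 0"
    and seg: "\<And>t. 0 \<le> t \<Longrightarrow> t \<le> \<tau> \<Longrightarrow> \<theta> + t *\<^sub>R h \<in> ?T"
    and h: "1 \<le> norm h" "norm h \<le> 2"
      "(\<Sum>i\<in>UNIV. h $ i) = 0 \<or> \<sigma> \<le> CARD('l) * M \<and> \<bar>\<Sum>i\<in>UNIV. h $ i\<bar> \<le> 1"
    by (rule signals_segment[OF inf m]) blast
  have \<theta>: "\<theta> \<in> ?T" using seg[of 0] \<tau> by simp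
  have neq: "shift l \<theta> \<noteq> \<theta>" if "l \<noteq> 0" for l
    using \<theta> signals_card_supp[OF \<theta>] that by (intro collision_free_shift_neq) (auto simp: signals_def)
  obtain g where g: "g > 0" "\<And>v. norm v \<le> g \<Longrightarrow> norm v \<le> rho \<theta> (\<theta> + v)"
    using rho_segment[OF neq] by metis
  have D0: "D > 0" using m D by (simp add: card_gt_0_iff)
  define t where "t n = c * (\<sigma>\<^sup>2 / sqrt (real n))" for n
  have t0: "0 \<le> t n" for n using c by (simp add: t_def)
  have "t \<longlonglongrightarrow> 0" unfolding t_def by real_asymp
  then have ev: "\<forall>\<^sub>F n in sequentially. t n < e" if "e > 0" for e
    using that by (rule order_tendstoD(2))
  have "\<forall>\<^sub>F n in sequentially. t n < min (min \<tau> (g / 2)) (min (\<sigma> / 2) (D / 2))"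
    by (rule ev) (use \<tau> g \<sigma> D0 in auto)
  moreover have "\<forall>\<^sub>F n in sequentially. n > 0" by (rule eventually_gt_at_top)
  ultimately show ?thesis
  proof eventually_elim
    case (elim n)
    have "norm (t n *\<^sub>R h) \<le> t n * 2" using h(2) t0[of n] by (simp add: mult_left_mono)
    then have "norm (t n *\<^sub>R h) \<le> g" using elim by simp
    then have "norm (t n *\<^sub>R h) \<le> rho \<theta> (\<theta> + t n *\<^sub>R h)" by (rule g)
    moreover have "t n * 1 \<le> norm (t n *\<^sub>R h)" using mult_left_mono[OF h(1) t0[of n]] t0[of n] by simp
    ultimately have "ennreal (c / 8 * (\<sigma>\<^sup>2 / sqrt (real n))) \<le> ennreal (rho \<theta> (\<theta> + t n *\<^sub>R h) / 8)"
      by (intro ennreal_leI) (simp add: t_def)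
    also have "\<dots> \<le> minimax_risk n \<sigma> ?T"
    proof (rule minimax_risk_segment[OF \<sigma> _ _ h(2)])
      show "norm \<theta> \<le> \<sigma>" using \<theta> by (simp add: signals_def)
      show "norm \<theta> \<le> D" using signals_norm_le[OF \<theta> m(2)] D by simp
      show "\<theta> + t n *\<^sub>R h \<in> ?T" using elim t0 by (intro seg) auto
      have "real n * (2 * D\<^sup>2 * (1 + 48 * exp 4) * (t n)\<^sup>2 / \<sigma> ^ 4) = 2 * D\<^sup>2 * (1 + 48 * exp 4) * c\<^sup>2"
        using elim \<sigma> by (simp add: t_def power_mult_distrib power_divide field_simps power2_eq_square power4_eq_xxxx)
      then show "real n * (2 * D\<^sup>2 * (1 + 48 * exp 4) * (t n)\<^sup>2 / \<sigma> ^ 4) \<le> 1 / 5" using c by simp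
    qed (use h(3) elim t0 \<theta> D in auto)
    finally show ?case .
  qed
qed

section \<open>A minimum distance estimator\<close>

lemma
  fixes h :: "'a \<Rightarrow> real"
  assumes prob: "prob_space P" and h: "integrable P h" "integrable P (\<lambda>x. (h x)\<^sup>2)" "(\<integral>x. h x \<partial>P) = 0"
  shows integrable_square_sum_PiM: "integrable (\<Pi>\<^sub>M k\<in>{..<n}. P) (\<lambda>x. (\<Sum>k<n. h (x k))\<^sup>2)"
    and integral_square_sum_PiM: "(\<integral>x. (\<Sum>k<n. h (x k))\<^sup>2 \<partial>(\<Pi>\<^sub>M k\<in>{..<n}. P)) = real n * (\<integral>x. (h x)\<^sup>2 \<partial>P)"
proof -
  interpret M: prob_space P by (rule prob)
  interpret product_prob_space "\<lambda>_ :: nat. P" "{..<n}"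
    by (simp add: product_prob_space_def product_prob_space_axioms_def product_sigma_finite_def
        prob prob_space_imp_sigma_finite)
  let ?P = "\<Pi>\<^sub>M k\<in>{..<n}. P"
  \<comment> \<open>\<open>?f j k i\<close> is the factor of \<open>h (x j) * h (x k)\<close> at
    coordinate \<open>i\<close>: it is squared if \<open>i = j = k\<close>, and 1 away from
    \<open>j\<close> and \<open>k\<close>. For \<open>j \<noteq> k\<close> the factor at
    \<open>j\<close> is a single \<open>h\<close>, with integral 0.\<close>
  let ?f = "\<lambda>j k i x. (if i = j then h x else 1) * (if i = k then h x else 1)"
  have int: "integrable P (?f j k i)" for j k i
    using h by (cases "i = j"; cases "i = k") (auto simp: power2_eq_square)
  have eq: "(\<Prod>i<n. ?f j k i (x i)) = h (x j) * h (x k)" if "j < n" "k < n" for j k x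
    using that by (simp add: prod.distrib prod.delta)
  have int2: "integrable ?P (\<lambda>x. h (x j) * h (x k))" if "j < n" "k < n" for j k
    using product_integrable_prod[where I = "{..<n}" and f = "?f j k", OF _ int] eq[OF that] by simp
  have "(\<integral>x. h (x j) * h (x k) \<partial>?P) = (\<Prod>i<n. \<integral>x. ?f j k i x \<partial>P)" if "j < n" "k < n" for j k
    using product_integral_prod[where I = "{..<n}" and f = "?f j k", OF _ int] eq[OF that] by simp
  moreover have "(\<Prod>i<n. \<integral>x. ?f j k i x \<partial>P) = (if j = k then \<integral>x. (h x)\<^sup>2 \<partial>P else 0)"
    if "j < n" "k < n" for j k
  proof (cases "j = k")
    case True
    have "(\<integral>x. ?f k k i x \<partial>P) = (if i = k then \<integral>x. (h x)\<^sup>2 \<partial>P else 1)" for i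
      by (simp add: power2_eq_square M.prob_space)
    then show ?thesis using True that by (simp add: prod.delta)
  next
    case False
    then have "(\<integral>x. ?f j k j x \<partial>P) = 0" using h by simp
    then show ?thesis using False that by (intro prod_zero bexI[of _ j] trans[OF _ if_not_P[symmetric]]) auto
  qed
  ultimately have val: "(\<integral>x. h (x j) * h (x k) \<partial>?P) = (if j = k then \<integral>x. (h x)\<^sup>2 \<partial>P else 0)"
    if "j < n" "k < n" for j k using that by simp
  have sq: "(\<Sum>k<n. h (x k))\<^sup>2 = (\<Sum>j<n. \<Sum>k<n. h (x j) * h (x k))" for x
    by (simp add: power2_eq_square sum_product)
  show "integrable ?P (\<lambda>x. (\<Sum>k<n. h (x k))\<^sup>2)"
    unfolding sq by (intro Bochner_Integration.integrable_sum int2) auto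
  have "(\<integral>x. (\<Sum>k<n. h (x k))\<^sup>2 \<partial>?P) = (\<Sum>j<n. \<Sum>k<n. if j = k then \<integral>x. (h x)\<^sup>2 \<partial>P else 0)"
  proof -
    have "(\<integral>x. (\<Sum>k<n. h (x k))\<^sup>2 \<partial>?P) = (\<Sum>j<n. \<integral>x. (\<Sum>k<n. h (x j) * h (x k)) \<partial>?P)"
      unfolding sq by (intro Bochner_Integration.integral_sum Bochner_Integration.integrable_sum int2) auto
    also have "\<dots> = (\<Sum>j<n. \<Sum>k<n. \<integral>x. h (x j) * h (x k) \<partial>?P)"
      by (intro sum.cong refl Bochner_Integration.integral_sum int2) auto
    also have "\<dots> = (\<Sum>j<n. \<Sum>k<n. if j = k then \<integral>x. (h x)\<^sup>2 \<partial>P else 0)"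
      by (intro sum.cong refl val) auto
    finally show ?thesis .
  qed
  also have "\<dots> = real n * (\<integral>x. (h x)\<^sup>2 \<partial>P)" by simp
  finally show "(\<integral>x. (\<Sum>k<n. h (x k))\<^sup>2 \<partial>?P) = real n * (\<integral>x. (h x)\<^sup>2 \<partial>P)" .
qed

text \<open>The variance is at most the raw second moment, so \<open>V\<close> may bound the
  latter.\<close>

lemma
  fixes g :: "'a \<Rightarrow> real" and n :: nat
  assumes prob: "prob_space P" and g: "integrable P g" "integrable P (\<lambda>x. (g x)\<^sup>2)"
    and V: "(\<integral>x. (g x)\<^sup>2 \<partial>P) \<le> V" and n: "n > 0"
  shows integrable_empirical_mean: "integrable (\<Pi>\<^sub>M k\<in>{..<n}. P) (\<lambda>x. ((\<Sum>k<n. g (x k)) / n - (\<integral>x. g x \<partial>P))\<^sup>2)"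
    and variance_empirical_mean: "(\<integral>x. ((\<Sum>k<n. g (x k)) / n - (\<integral>x. g x \<partial>P))\<^sup>2 \<partial>(\<Pi>\<^sub>M k\<in>{..<n}. P)) \<le> V / n"
proof -
  interpret M: prob_space P by (rule prob)
  let ?\<psi> = "\<integral>x. g x \<partial>P"
  define h where "h x = g x - ?\<psi>" for x
  have h1: "integrable P h" "(\<integral>x. h x \<partial>P) = 0"
    unfolding h_def using g by (simp_all add: M.prob_space)
  have h2: "(\<lambda>x. (h x)\<^sup>2) = (\<lambda>x. (g x)\<^sup>2 - 2 * ?\<psi> * g x + ?\<psi>\<^sup>2)"
    by (simp add: h_def fun_eq_iff power2_diff)
  have h3: "integrable P (\<lambda>x. (h x)\<^sup>2)" unfolding h2 using g by simp
  have "(\<integral>x. (h x)\<^sup>2 \<partial>P) = (\<integral>x. (g x)\<^sup>2 \<partial>P) - ?\<psi>\<^sup>2"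
    unfolding h2 using g by (simp add: M.prob_space power2_eq_square)
  then have h4: "(\<integral>x. (h x)\<^sup>2 \<partial>P) \<le> V" using V zero_le_power2[of ?\<psi>] by linarith
  have eq: "((\<Sum>k<n. g (x k)) / n - ?\<psi>)\<^sup>2 = (\<Sum>k<n. h (x k))\<^sup>2 / (real n)\<^sup>2" for x
  proof -
    have "(\<Sum>k<n. g (x k)) / n - ?\<psi> = (\<Sum>k<n. h (x k)) / n"
      using n by (simp add: h_def sum_subtractf field_simps)
    then show ?thesis by (simp add: power_divide)
  qed
  show "integrable (\<Pi>\<^sub>M k\<in>{..<n}. P) (\<lambda>x. ((\<Sum>k<n. g (x k)) / n - ?\<psi>)\<^sup>2)"
    unfolding eq by (intro Bochner_Integration.integrable_divide integrable_square_sum_PiM[OF prob h1(1) h3 h1(2)])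
  have "(\<integral>x. ((\<Sum>k<n. g (x k)) / n - ?\<psi>)\<^sup>2 \<partial>(\<Pi>\<^sub>M k\<in>{..<n}. P)) = real n * (\<integral>x. (h x)\<^sup>2 \<partial>P) / (real n)\<^sup>2"
    unfolding eq using integral_square_sum_PiM[OF prob h1(1) h3 h1(2)] by simp
  also have "\<dots> = (\<integral>x. (h x)\<^sup>2 \<partial>P) / n" by (simp add: power2_eq_square)
  also have "\<dots> \<le> V / n" using h4 by (intro divide_right_mono) auto
  finally show "(\<integral>x. ((\<Sum>k<n. g (x k)) / n - ?\<psi>)\<^sup>2 \<partial>(\<Pi>\<^sub>M k\<in>{..<n}. P)) \<le> V / n" .
qed

text \<open>The minimiser is built by adding one candidate at a time. Measurability of the attained
  cost is carried through the induction, because the next comparison uses it.\<close>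

lemma measurable_argmin:
  fixes c :: "'b::topological_space \<Rightarrow> 'a \<Rightarrow> real"
  assumes "finite F" "F \<noteq> {}" "\<And>\<phi>. \<phi> \<in> F \<Longrightarrow> c \<phi> \<in> borel_measurable M"
  obtains e where "e \<in> M \<rightarrow>\<^sub>M borel" "\<And>x. e x \<in> F" "\<And>x \<phi>. \<phi> \<in> F \<Longrightarrow> c (e x) x \<le> c \<phi> x"
proof -
  have "\<exists>e. e \<in> M \<rightarrow>\<^sub>M borel \<and> (\<lambda>x. c (e x) x) \<in> borel_measurable M \<and>
      (\<forall>x. e x \<in> F \<and> (\<forall>\<phi>\<in>F. c (e x) x \<le> c \<phi> x))"
    using assms
  proof (induction F rule: finite_ne_induct)
    case (singleton \<phi>)
    then show ?case by (intro exI[of _ "\<lambda>_. \<phi>"]) auto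
  next
    case (insert \<phi> F)
    then obtain e where e [measurable]: "e \<in> M \<rightarrow>\<^sub>M borel" "(\<lambda>x. c (e x) x) \<in> borel_measurable M"
      and min: "\<And>x. e x \<in> F" "\<And>x \<psi>. \<psi> \<in> F \<Longrightarrow> c (e x) x \<le> c \<psi> x" by auto
    have [measurable]: "c \<phi> \<in> borel_measurable M" using insert by simp
    define e' where "e' x = (if c \<phi> x \<le> c (e x) x then \<phi> else e x)" for x
    have "(\<lambda>x. c (e' x) x) = (\<lambda>x. min (c \<phi> x) (c (e x) x))"
      by (auto simp: e'_def fun_eq_iff min_def)
    then have "(\<lambda>x. c (e' x) x) \<in> borel_measurable M" by simp
    moreover have "e' \<in> M \<rightarrow>\<^sub>M borel" unfolding e'_def by measurable
    moreover have "e' x \<in> insert \<phi> F" "c (e' x) x \<le> c \<psi> x" if "\<psi> \<in> insert \<phi> F" for x \<psi>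
      using min(1)[of x] min(2)[of \<psi> x] that by (auto simp: e'_def)
    ultimately show ?case by (intro exI[of _ e']) auto
  qed
  then show ?thesis using that by blast
qed

text \<open>The net lives in feature space: rounded feature vectors take finitely many values, and
  one signal is kept for each. Signals with the same rounded vector differ by at most
  \<open>\<delta>\<close> in every feature.\<close>

lemma finite_net:
  fixes \<Psi> :: "'j \<Rightarrow> 'a \<Rightarrow> real"
  assumes J: "finite J" and B: "\<And>j \<theta>. j \<in> J \<Longrightarrow> \<theta> \<in> T \<Longrightarrow> \<bar>\<Psi> j \<theta>\<bar> \<le> B" and \<tau>: "\<tau> > 0"
  obtains F where "finite F" "F \<subseteq> T" "\<And>\<theta>. \<theta> \<in> T \<Longrightarrow> \<exists>\<phi>\<in>F. (\<Sum>j\<in>J. \<bar>\<Psi> j \<phi> - \<Psi> j \<theta>\<bar>) \<le> \<tau>"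
proof -
  \<comment> \<open>The \<open>+ 1\<close> covers an empty \<open>J\<close>, where division by zero
    would give 0.\<close>
  define \<delta> where "\<delta> = \<tau> / (card J + 1)"
  have \<delta>: "\<delta> > 0" using \<tau> by (simp add: \<delta>_def)
  define q where "q \<theta> = (\<lambda>j\<in>J. \<lfloor>\<Psi> j \<theta> / \<delta>\<rfloor>)" for \<theta>
  have "q ` T \<subseteq> (\<Pi>\<^sub>E j\<in>J. {\<lfloor>- B / \<delta>\<rfloor>..\<lfloor>B / \<delta>\<rfloor>})"
  proof (clarsimp simp: q_def)
    fix \<theta> j assume "\<theta> \<in> T" "j \<in> J"
    from B[OF this(2,1)] show "\<lfloor>- (B / \<delta>)\<rfloor> \<le> \<lfloor>\<Psi> j \<theta> / \<delta>\<rfloor> \<and> \<lfloor>\<Psi> j \<theta> / \<delta>\<rfloor> \<le> \<lfloor>B / \<delta>\<rfloor>"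
      using \<delta> by (intro conjI floor_mono) (auto simp: field_simps)
  qed
  then have "finite (q ` T)" by (rule finite_subset) (intro finite_PiE J finite_atLeastAtMost_int)
  then obtain F where F: "F \<subseteq> T" "finite F" "q ` T = q ` F"
    using finite_subset_image[of "q ` T" q T] by blast
  show ?thesis
  proof
    fix \<theta> assume "\<theta> \<in> T"
    then obtain \<phi> where \<phi>: "\<phi> \<in> F" "q \<theta> = q \<phi>" using F by (metis imageE imageI)
    have "\<bar>\<Psi> j \<phi> - \<Psi> j \<theta>\<bar> \<le> \<delta>" if "j \<in> J" for j
    proof -
      have "\<lfloor>\<Psi> j \<theta> / \<delta>\<rfloor> = \<lfloor>\<Psi> j \<phi> / \<delta>\<rfloor>" using fun_cong[OF \<phi>(2), of j] that by (simp add: q_def)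
      then have "\<bar>\<Psi> j \<phi> / \<delta> - \<Psi> j \<theta> / \<delta>\<bar> \<le> 1" by linarith
      then show ?thesis using \<delta> by (simp add: diff_divide_distrib[symmetric] abs_divide)
    qed
    then have "(\<Sum>j\<in>J. \<bar>\<Psi> j \<phi> - \<Psi> j \<theta>\<bar>) \<le> (\<Sum>j\<in>J. \<delta>)" by (rule sum_mono)
    also have "\<dots> \<le> \<tau>" using \<tau> by (simp add: \<delta>_def field_simps)
    finally show "\<exists>\<phi>\<in>F. (\<Sum>j\<in>J. \<bar>\<Psi> j \<phi> - \<Psi> j \<theta>\<bar>) \<le> \<tau>" using \<phi> by blast
  qed (use F in auto)
qed

text \<open>\<open>s\<close> bounds the standard error of each empirical feature mean. Minimising
  over a finite \<open>s\<close>-net gives existence and measurability at the price of one extra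
  \<open>s\<close>. In the separation the linear part serves nearby orbits and the quadratic part
  distant ones, so a large \<open>C\<^sub>2\<close> does not harm the rate.\<close>

lemma minimax_risk_minimum_distance:
  fixes T :: "(real ^ 'l::finite mod_ring) set" and g :: "'j \<Rightarrow> real ^ 'l mod_ring \<Rightarrow> real" and n :: nat
  assumes J: "finite J" and n: "n > 0" and V: "V > 0" and C: "C\<^sub>1 \<ge> 0" "C\<^sub>2 \<ge> 0"
    and g [measurable]: "\<And>j. g j \<in> borel_measurable borel"
    and int: "\<And>j \<theta>. j \<in> J \<Longrightarrow> \<theta> \<in> T \<Longrightarrow> integrable (sample_law \<sigma> \<theta>) (g j)"
      "\<And>j \<theta>. j \<in> J \<Longrightarrow> \<theta> \<in> T \<Longrightarrow> (\<integral>x. g j x \<partial>sample_law \<sigma> \<theta>) = \<Psi> j \<theta>"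
      "\<And>j \<theta>. j \<in> J \<Longrightarrow> \<theta> \<in> T \<Longrightarrow> integrable (sample_law \<sigma> \<theta>) (\<lambda>x. (g j x)\<^sup>2)"
      "\<And>j \<theta>. j \<in> J \<Longrightarrow> \<theta> \<in> T \<Longrightarrow> (\<integral>x. (g j x)\<^sup>2 \<partial>sample_law \<sigma> \<theta>) \<le> V"
    and B: "\<And>j \<theta>. j \<in> J \<Longrightarrow> \<theta> \<in> T \<Longrightarrow> \<bar>\<Psi> j \<theta>\<bar> \<le> B"
    and sep: "\<And>\<theta> \<phi>. \<theta> \<in> T \<Longrightarrow> \<phi> \<in> T \<Longrightarrow>
      rho \<phi> \<theta> \<le> C\<^sub>1 * (\<Sum>j\<in>J. \<bar>\<Psi> j \<phi> - \<Psi> j \<theta>\<bar>) + C\<^sub>2 * (\<Sum>j\<in>J. \<bar>\<Psi> j \<phi> - \<Psi> j \<theta>\<bar>)\<^sup>2"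
    and s: "s = sqrt (V / n)"
  shows "minimax_risk n \<sigma> T \<le>
    ennreal (C\<^sub>1 * (2 * card J + 1) * s + C\<^sub>2 * (8 * (card J)\<^sup>2 + 2) * s\<^sup>2)"
proof (cases "T = {}")
  \<comment> \<open>The net needs a signal; over the empty class the supremum of the risks is
    0.\<close>
  case True
  have "(\<lambda>_. 0) \<in> (estimators n :: ((nat \<Rightarrow> real ^ 'l mod_ring) \<Rightarrow> _) set)" by (simp add: estimators_def)
  then show ?thesis unfolding minimax_risk_def by (rule INF_lower2) (simp add: True)
next
  case False
  have s0: "s > 0" and s2: "s\<^sup>2 = V / n" using V n unfolding s by (auto intro: divide_pos_pos)
  obtain F where F: "finite F" "F \<subseteq> T" "\<And>\<theta>. \<theta> \<in> T \<Longrightarrow> \<exists>\<phi>\<in>F. (\<Sum>j\<in>J. \<bar>\<Psi> j \<phi> - \<Psi> j \<theta>\<bar>) \<le> s"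
    using finite_net[where T = T and J = J and \<Psi> = \<Psi> and B = B and \<tau> = s, OF J B s0] by blast
  have F0: "F \<noteq> {}" using F(3) False by blast
  define mean where "mean j X = (\<Sum>k<n. g j (X k)) / n" for j and X :: "nat \<Rightarrow> real ^ 'l mod_ring"
  define c where "c \<phi> X = (\<Sum>j\<in>J. \<bar>mean j X - \<Psi> j \<phi>\<bar>)" for \<phi> X
  have "c \<phi> \<in> borel_measurable (\<Pi>\<^sub>M k\<in>{..<n}. borel)" for \<phi>
    unfolding c_def mean_def by measurable
  then obtain est where est: "est \<in> (\<Pi>\<^sub>M k\<in>{..<n}. borel) \<rightarrow>\<^sub>M borel" "\<And>X. est X \<in> F"
      "\<And>X \<phi>. \<phi> \<in> F \<Longrightarrow> c (est X) X \<le> c \<phi> X"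
    using measurable_argmin[OF F(1) F0, of c "\<Pi>\<^sub>M k\<in>{..<n}. borel"] by blast
  have "minimax_risk n \<sigma> T \<le> (SUP \<theta>\<in>T. risk n \<sigma> est \<theta>)"
    unfolding minimax_risk_def by (rule INF_lower) (simp add: estimators_def est)
  also have "\<dots> \<le> ennreal (C\<^sub>1 * (2 * card J + 1) * s + C\<^sub>2 * (8 * (card J)\<^sup>2 + 2) * s\<^sup>2)"
  proof (rule SUP_least)
    fix \<theta> assume \<theta>: "\<theta> \<in> T"
    define y where "y j X = (mean j X - \<Psi> j \<theta>)\<^sup>2" for j X
    let ?p = "real (card J)"
    let ?P = "samples_law n \<sigma> \<theta>"
    interpret prob_space ?P unfolding samples_law_def by (intro prob_space_PiM prob_space_sample_law)
    have int_y: "integrable ?P (y j)" "(\<integral>X. y j X \<partial>?P) \<le> s\<^sup>2" if "j \<in> J" for j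
      using integrable_empirical_mean[OF prob_space_sample_law int(1,3,4) n, of j \<theta>]
        variance_empirical_mean[OF prob_space_sample_law int(1,3,4) n, of j \<theta>] that \<theta>
      by (simp_all add: y_def[abs_def] mean_def samples_law_def int(2) s2)
    let ?W = "\<lambda>X. \<Sum>j\<in>J. y j X"
    let ?bound = "\<lambda>X. C\<^sub>1 * (?W X / s + ?p * s + s) + C\<^sub>2 * (8 * ?p * ?W X + 2 * s\<^sup>2)"
    have rho: "rho (est X) \<theta> \<le> ?bound X" for X
    proof -
      let ?u = "\<Sum>j\<in>J. \<bar>\<Psi> j (est X) - \<Psi> j \<theta>\<bar>"
      obtain \<phi> where \<phi>: "\<phi> \<in> F" "(\<Sum>j\<in>J. \<bar>\<Psi> j \<phi> - \<Psi> j \<theta>\<bar>) \<le> s" using F(3)[OF \<theta>] by blast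
      have u0: "0 \<le> ?u" "0 \<le> c \<theta> X" by (auto simp: c_def sum_nonneg)
      \<comment> \<open>The features of the estimate and of \<open>\<theta>\<close> are compared
        through the empirical means, and the cost of the estimate through that of a net point
        \<open>\<phi>\<close> close to \<open>\<theta>\<close>.\<close>
      have "?u \<le> (\<Sum>j\<in>J. \<bar>mean j X - \<Psi> j (est X)\<bar> + \<bar>mean j X - \<Psi> j \<theta>\<bar>)"
        by (intro sum_mono) linarith
      also have "\<dots> = c (est X) X + c \<theta> X" by (simp add: c_def sum.distrib)
      also have "c (est X) X \<le> c \<phi> X" by (rule est \<phi>)+
      also have "c \<phi> X \<le> (\<Sum>j\<in>J. \<bar>mean j X - \<Psi> j \<theta>\<bar> + \<bar>\<Psi> j \<phi> - \<Psi> j \<theta>\<bar>)"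
        unfolding c_def by (intro sum_mono) linarith
      also have "\<dots> \<le> c \<theta> X + s" using \<phi> by (simp add: c_def sum.distrib)
      finally have u: "?u \<le> 2 * c \<theta> X + s" by simp
      \<comment> \<open>Only squared deviations have known expectations, hence 2 |z| \<le> z^2 / s +
        s, which loses nothing when |z| = s.\<close>
      have "2 * c \<theta> X = (\<Sum>j\<in>J. 2 * \<bar>mean j X - \<Psi> j \<theta>\<bar>)" by (simp add: c_def sum_distrib_left)
      also have "\<dots> \<le> (\<Sum>j\<in>J. y j X / s + s)"
      proof (rule sum_mono)
        fix j
        have "2 * \<bar>z\<bar> * s \<le> z\<^sup>2 + s * s" for z
          using zero_le_power2[of "\<bar>z\<bar> - s"] by (simp add: power2_eq_square algebra_simps)
        then have "2 * \<bar>mean j X - \<Psi> j \<theta>\<bar> * s \<le> y j X + s * s" by (simp add: y_def)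
        then show "2 * \<bar>mean j X - \<Psi> j \<theta>\<bar> \<le> y j X / s + s" using s0 by (simp add: field_simps)
      qed
      also have "\<dots> = ?W X / s + ?p * s" by (simp add: sum.distrib sum_divide_distrib)
      finally have u1: "?u \<le> ?W X / s + ?p * s + s" using u by simp
      have "(c \<theta> X)\<^sup>2 \<le> (\<Sum>j\<in>J. \<bar>mean j X - \<Psi> j \<theta>\<bar>\<^sup>2) * ?p"
        unfolding c_def by (rule sum_squared_le_sum_of_squares)
      then have c2: "(c \<theta> X)\<^sup>2 \<le> ?p * ?W X" by (simp add: y_def mult.commute)
      have "?u\<^sup>2 \<le> (2 * c \<theta> X + s)\<^sup>2" using u u0 by (intro power_mono) auto
      also have "\<dots> \<le> 8 * (c \<theta> X)\<^sup>2 + 2 * s\<^sup>2"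
        using zero_le_power2[of "2 * c \<theta> X - s"] by (simp add: power2_sum power2_diff power_mult_distrib)
      finally have u2: "?u\<^sup>2 \<le> 8 * ?p * ?W X + 2 * s\<^sup>2" using c2 by simp
      have "rho (est X) \<theta> \<le> C\<^sub>1 * ?u + C\<^sub>2 * ?u\<^sup>2" using sep[OF \<theta>, of "est X"] est(2)[of X] F(2) by blast
      also have "\<dots> \<le> ?bound X" by (intro add_mono mult_left_mono u1 u2 C)
      finally show ?thesis .
    qed
    have intW: "integrable ?P ?W" using int_y by (intro Bochner_Integration.integrable_sum) auto
    have W: "(\<integral>X. ?W X \<partial>?P) \<le> ?p * s\<^sup>2"
      using int_y sum_mono[of J "\<lambda>j. \<integral>X. y j X \<partial>?P" "\<lambda>_. s\<^sup>2"] by (simp add: Bochner_Integration.integral_sum)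
    have "risk n \<sigma> est \<theta> \<le> (\<integral>\<^sup>+ X. ennreal (?bound X) \<partial>?P)"
      unfolding risk_def by (intro nn_integral_mono ennreal_leI rho)
    also have "\<dots> = ennreal (\<integral>X. ?bound X \<partial>?P)"
    proof (rule nn_integral_eq_integral)
      show "integrable ?P ?bound" using intW by simp
      show "AE X in ?P. 0 \<le> ?bound X" using rho rho_nonneg order_trans by blast
    qed
    also have "(\<integral>X. ?bound X \<partial>?P) = C\<^sub>1 * ((\<integral>X. ?W X \<partial>?P) / s + ?p * s + s) + C\<^sub>2 * (8 * ?p * (\<integral>X. ?W X \<partial>?P) + 2 * s\<^sup>2)"
      using intW by (simp add: prob_space del: Bochner_Integration.integral_sum)
    also have "ennreal \<dots> \<le> ennreal (C\<^sub>1 * (?p * s\<^sup>2 / s + ?p * s + s) + C\<^sub>2 * (8 * ?p * (?p * s\<^sup>2) + 2 * s\<^sup>2))"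
      using W s0 C by (intro ennreal_leI add_mono mult_left_mono divide_right_mono) auto
    also have "C\<^sub>1 * (?p * s\<^sup>2 / s + ?p * s + s) + C\<^sub>2 * (8 * ?p * (?p * s\<^sup>2) + 2 * s\<^sup>2) =
        C\<^sub>1 * (2 * card J + 1) * s + C\<^sub>2 * (8 * (card J)\<^sup>2 + 2) * s\<^sup>2"
      using s0 by (simp add: power2_eq_square algebra_simps)
    finally show "risk n \<sigma> est \<theta> \<le> ennreal (C\<^sub>1 * (2 * card J + 1) * s + C\<^sub>2 * (8 * (card J)\<^sup>2 + 2) * s\<^sup>2)" .
  qed
  finally show ?thesis .
qed

section \<open>Autocorrelations\<close>

abbreviation autocorr :: "'l::finite mod_ring \<Rightarrow> real ^ 'l mod_ring \<Rightarrow> real" where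
  "autocorr d \<theta> \<equiv> shift d \<theta> \<bullet> \<theta>"

lemma autocorr_shift: "autocorr d (shift l \<theta>) = autocorr d \<theta>"
proof -
  have "shift d (shift l \<theta>) = shift l (shift d \<theta>)" by (simp add: shift_shift add.commute)
  then show ?thesis by (simp only: inner_shift_shift)
qed

lemma continuous_on_shift: "continuous_on A (shift l)"
  unfolding shift_def by (intro continuous_intros)

lemma measurable_shift [measurable]: "shift l \<in> borel \<rightarrow>\<^sub>M borel"
  by (intro borel_measurable_continuous_onI continuous_on_shift)

section \<open>Moments of the autocorrelations of one observation\<close>

lemma
  fixes w :: "real ^ 'k::finite"
  shows integrable_inner_std_gaussian: "integrable std_gaussian (\<lambda>\<xi>. w \<bullet> \<xi>)"
    and integral_inner_std_gaussian: "(\<integral>\<xi>. w \<bullet> \<xi> \<partial>std_gaussian) = 0"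
proof -
  have int: "integrable std_gaussian (\<lambda>\<xi> :: real ^ 'k. \<xi> $ i)" for i
    using integrable_power_std_gaussian[of i 1] by simp
  then show "integrable std_gaussian (\<lambda>\<xi>. w \<bullet> \<xi>)" by (simp add: inner_vec_def)
  show "(\<integral>\<xi>. w \<bullet> \<xi> \<partial>std_gaussian) = 0"
    using int by (simp add: inner_vec_def integral_std_gaussian)
qed

text \<open>At a nonzero lag each summand pairs two different, hence independent and centered
  coordinates. At lag zero the mean would be the dimension, which is why the features leave that lag
  out.\<close>

lemma
  fixes d :: "'l::finite mod_ring"
  assumes d: "d \<noteq> 0"
  shows integrable_autocorr_std_gaussian: "integrable std_gaussian (autocorr d)"
    and integral_autocorr_std_gaussian: "(\<integral>\<xi>. autocorr d \<xi> \<partial>std_gaussian) = 0"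
proof -
  have neq: "i + d \<noteq> i" for i using d by simp
  note int = integrable_product_std_gaussian[OF neq] integral_product_std_gaussian[OF neq]
  show "integrable std_gaussian (autocorr d)" 
    using int by (simp add: inner_vec_def)
  show "(\<integral>\<xi>. autocorr d \<xi> \<partial>std_gaussian) = 0"
    using int by (simp add: inner_vec_def)
qed

lemma autocorr_add:
  "autocorr d (v + \<sigma> *\<^sub>R \<xi>) = autocorr d v + \<sigma> * ((shift d v + shift (- d) v) \<bullet> \<xi>) + \<sigma>\<^sup>2 * autocorr d \<xi>"
proof -
  have "shift d \<xi> \<bullet> v = shift (- d) v \<bullet> \<xi>" by (simp add: inner_shift_left[of d \<xi> v] inner_commute[of "shift (- d) v"])
  then show ?thesis
    by (simp add: shift_add shift_scaleR inner_add_left inner_add_right power2_eq_square algebra_simps)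
qed

text \<open>The autocorrelation forgets the random shift, and both noise terms of its expansion have
  mean zero.\<close>

lemma
  assumes d: "d \<noteq> 0"
  shows integrable_autocorr: "integrable (sample_law \<sigma> \<theta>) (autocorr d)"
    and integral_autocorr: "(\<integral>x. autocorr d x \<partial>sample_law \<sigma> \<theta>) = autocorr d \<theta>"
proof -
  interpret G: prob_space "std_gaussian :: (real ^ 'a mod_ring) measure"
    by (rule prob_space_std_gaussian)
  have [simp]: "G.prob UNIV = 1" using G.prob_space by simp
  note [simp] = integrable_inner_std_gaussian integral_inner_std_gaussian
    integrable_autocorr_std_gaussian[OF d] integral_autocorr_std_gaussian[OF d]
  have int: "integrable std_gaussian (\<lambda>\<xi>. autocorr d (shift l \<theta> + \<sigma> *\<^sub>R \<xi>))" for l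
    unfolding autocorr_add by (intro Bochner_Integration.integrable_add integrable_mult_right) simp_all
  have val: "(\<integral>\<xi>. autocorr d (shift l \<theta> + \<sigma> *\<^sub>R \<xi>) \<partial>std_gaussian) = autocorr d \<theta>" for l
  proof -
    let ?w = "shift d (shift l \<theta>) + shift (- d) (shift l \<theta>)"
    have "(\<integral>\<xi>. autocorr d (shift l \<theta> + \<sigma> *\<^sub>R \<xi>) \<partial>std_gaussian) =
      (\<integral>\<xi>. autocorr d (shift l \<theta>) + \<sigma> * (?w \<bullet> \<xi>) \<partial>std_gaussian) + (\<integral>\<xi>. \<sigma>\<^sup>2 * autocorr d \<xi> \<partial>std_gaussian)"
      unfolding autocorr_add
      by (intro Bochner_Integration.integral_add Bochner_Integration.integrable_add integrable_mult_right
          G.integrable_const) simp_all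
    also have "(\<integral>\<xi>. autocorr d (shift l \<theta>) + \<sigma> * (?w \<bullet> \<xi>) \<partial>std_gaussian) =
      (\<integral>\<xi>. autocorr d (shift l \<theta>) \<partial>(std_gaussian :: (real ^ 'a mod_ring) measure)) + (\<integral>\<xi>. \<sigma> * (?w \<bullet> \<xi>) \<partial>std_gaussian)"
      by (intro Bochner_Integration.integral_add integrable_mult_right G.integrable_const) simp_all
    finally have "(\<integral>\<xi>. autocorr d (shift l \<theta> + \<sigma> *\<^sub>R \<xi>) \<partial>std_gaussian) = autocorr d (shift l \<theta>)"
      unfolding integral_mult_right_zero by simp
    then show ?thesis by (simp add: autocorr_shift)
  qed
  show "integrable (sample_law \<sigma> \<theta>) (autocorr d)"
    using int by (intro integrable_sample_law) simp_all
  show "(\<integral>x. autocorr d x \<partial>sample_law \<sigma> \<theta>) = autocorr d \<theta>"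
    using int by (subst integral_sample_law) (simp_all add: val)
qed

lemma autocorr_square_le: "(autocorr d x)\<^sup>2 \<le> norm x ^ 4"
proof -
  have "\<bar>autocorr d x\<bar> \<le> (norm x)\<^sup>2"
    using Cauchy_Schwarz_ineq2[of "shift d x" x] by (simp add: power2_eq_square)
  then have "\<bar>autocorr d x\<bar>\<^sup>2 \<le> ((norm x)\<^sup>2)\<^sup>2" by (rule power_mono) simp
  then show ?thesis by simp
qed

lemma norm_add_power4_le: "norm (v + w) ^ 4 \<le> 8 * norm v ^ 4 + 8 * norm w ^ 4"
proof -
  have sq: "(x + y)\<^sup>2 \<le> 2 * x\<^sup>2 + 2 * y\<^sup>2" for x y :: real
    using zero_le_power2[of "x - y"] by (simp add: power2_eq_square algebra_simps)
  have p4: "x ^ 4 = (x\<^sup>2)\<^sup>2" for x :: real by simp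
  have "norm (v + w) ^ 4 \<le> (norm v + norm w) ^ 4" by (intro power_mono norm_triangle_ineq) auto
  also have "\<dots> \<le> (2 * (norm v)\<^sup>2 + 2 * (norm w)\<^sup>2)\<^sup>2" unfolding p4 by (intro power_mono sq) auto
  also have "\<dots> \<le> 2 * (2 * (norm v)\<^sup>2)\<^sup>2 + 2 * (2 * (norm w)\<^sup>2)\<^sup>2" by (rule sq)
  also have "\<dots> = 8 * norm v ^ 4 + 8 * norm w ^ 4" by (simp add: power_mult_distrib)
  finally show ?thesis .
qed

lemma integrable_norm_power4_std_gaussian:
  "integrable std_gaussian (\<lambda>\<xi> :: real ^ 'k::finite. norm \<xi> ^ 4)"
proof (rule Bochner_Integration.integrable_bound)
  show "integrable std_gaussian (\<lambda>\<xi> :: real ^ 'k. (\<Sum>i\<in>UNIV. (\<xi> $ i) ^ 4) * CARD('k))"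
    by (intro integrable_mult_left Bochner_Integration.integrable_sum integrable_power_std_gaussian)
  have "norm (norm \<xi> ^ 4) \<le> norm ((\<Sum>i\<in>UNIV. (\<xi> $ i) ^ 4) * CARD('k))" for \<xi> :: "real ^ 'k"
  proof -
    have "norm (norm \<xi> ^ 4) = ((norm \<xi>)\<^sup>2)\<^sup>2" by simp
    also have "(norm \<xi>)\<^sup>2 = (\<Sum>i\<in>UNIV. (\<xi> $ i)\<^sup>2)"
      unfolding power2_norm_eq_inner inner_vec_def by (simp add: power2_eq_square)
    also have "\<dots>\<^sup>2 \<le> (\<Sum>i\<in>UNIV. ((\<xi> $ i)\<^sup>2)\<^sup>2) * CARD('k)"
      by (rule sum_squared_le_sum_of_squares)
    also have "\<dots> = (\<Sum>i\<in>UNIV. (\<xi> $ i) ^ 4) * CARD('k)" by simp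
    also have "\<dots> \<le> norm \<dots>" by (simp only: real_norm_def abs_ge_self)
    finally show ?thesis .
  qed
  then show "AE \<xi> :: real ^ 'k in std_gaussian. norm (norm \<xi> ^ 4) \<le> norm ((\<Sum>i\<in>UNIV. (\<xi> $ i) ^ 4) * CARD('k))"
    by (intro AE_I2)
next
  show "(\<lambda>\<xi> :: real ^ 'k. norm \<xi> ^ 4) \<in> borel_measurable std_gaussian"
    by (rule measurable_std_gaussian_borel) measurable
qed

text \<open>A constant of the dimension alone, which the type argument conveys; it makes the
  variance bound a multiple of \<open>\<sigma> ^ 4\<close> by a factor free of
  \<open>\<sigma>\<close>.\<close>

definition gaussian_moment4 :: "'k::finite itself \<Rightarrow> real" where
  "gaussian_moment4 _ = (\<integral>\<xi>. norm \<xi> ^ 4 \<partial>(std_gaussian :: (real ^ 'k) measure))"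

text \<open>The constraint \<open>norm \<theta> \<le> \<sigma>\<close> absorbs the signal part
  \<open>norm \<theta> ^ 4\<close> into the noise part. This is the origin of \<sigma>^2 in the
  rate.\<close>

lemma
  fixes \<theta> :: "real ^ 'l::finite mod_ring"
  assumes \<sigma>: "norm \<theta> \<le> \<sigma>"
  shows integrable_autocorr_square: "integrable (sample_law \<sigma> \<theta>) (\<lambda>x. (autocorr d x)\<^sup>2)"
    and integral_autocorr_square:
      "(\<integral>x. (autocorr d x)\<^sup>2 \<partial>sample_law \<sigma> \<theta>) \<le> 8 * (1 + gaussian_moment4 TYPE('l mod_ring)) * \<sigma> ^ 4"
proof -
  interpret G: prob_space "std_gaussian :: (real ^ 'l mod_ring) measure"
    by (rule prob_space_std_gaussian)
  let ?G = "gaussian_moment4 TYPE('l mod_ring)"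
  let ?b = "\<lambda>\<xi> :: real ^ 'l mod_ring. 8 * norm \<theta> ^ 4 + 8 * \<sigma> ^ 4 * norm \<xi> ^ 4"
  have le: "(autocorr d (shift l \<theta> + \<sigma> *\<^sub>R \<xi>))\<^sup>2 \<le> ?b \<xi>" for l \<xi>
    using autocorr_square_le[of d "shift l \<theta> + \<sigma> *\<^sub>R \<xi>"] norm_add_power4_le[of "shift l \<theta>" "\<sigma> *\<^sub>R \<xi>"]
    by (simp add: power_mult_distrib)
  have [simp]: "G.prob UNIV = 1" using G.prob_space by simp
  have intb: "integrable std_gaussian ?b"
    by (intro Bochner_Integration.integrable_add integrable_mult_right integrable_norm_power4_std_gaussian
        G.integrable_const)
  have int: "integrable std_gaussian (\<lambda>\<xi>. (autocorr d (shift l \<theta> + \<sigma> *\<^sub>R \<xi>))\<^sup>2)" for l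
  proof (rule Bochner_Integration.integrable_bound[OF intb])
    have "norm ((autocorr d (shift l \<theta> + \<sigma> *\<^sub>R \<xi>))\<^sup>2) \<le> norm (?b \<xi>)" for \<xi>
      using order_trans[OF le abs_ge_self] by (simp only: real_norm_def abs_of_nonneg[OF zero_le_power2])
    then show "AE \<xi> in std_gaussian. norm ((autocorr d (shift l \<theta> + \<sigma> *\<^sub>R \<xi>))\<^sup>2) \<le> norm (?b \<xi>)" by (intro AE_I2)
    show "(\<lambda>\<xi>. (autocorr d (shift l \<theta> + \<sigma> *\<^sub>R \<xi>))\<^sup>2) \<in> borel_measurable std_gaussian"
      by (rule measurable_std_gaussian_borel) measurable
  qed
  show "integrable (sample_law \<sigma> \<theta>) (\<lambda>x. (autocorr d x)\<^sup>2)"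
    using int by (intro integrable_sample_law) simp_all
  have "(\<integral>\<xi>. (autocorr d (shift l \<theta> + \<sigma> *\<^sub>R \<xi>))\<^sup>2 \<partial>std_gaussian) \<le> 8 * (1 + ?G) * \<sigma> ^ 4" for l
  proof -
    have "(\<integral>\<xi>. (autocorr d (shift l \<theta> + \<sigma> *\<^sub>R \<xi>))\<^sup>2 \<partial>std_gaussian) \<le> (\<integral>\<xi>. ?b \<xi> \<partial>std_gaussian)"
      by (intro integral_mono int intb le)
    also have "\<dots> = 8 * norm \<theta> ^ 4 + 8 * \<sigma> ^ 4 * ?G"
    proof -
      have "(\<integral>\<xi>. ?b \<xi> \<partial>std_gaussian) = (\<integral>\<xi>. 8 * norm \<theta> ^ 4 \<partial>(std_gaussian :: (real ^ 'l mod_ring) measure)) +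
          (\<integral>\<xi>. 8 * \<sigma> ^ 4 * norm \<xi> ^ 4 \<partial>(std_gaussian :: (real ^ 'l mod_ring) measure))"
        by (intro Bochner_Integration.integral_add integrable_mult_right integrable_norm_power4_std_gaussian
            G.integrable_const)
      then show ?thesis by (simp add: gaussian_moment4_def)
    qed
    also have "norm \<theta> ^ 4 \<le> \<sigma> ^ 4" by (intro power_mono \<sigma>) auto
    finally show ?thesis by (simp add: algebra_simps)
  qed
  then have "(\<Sum>l\<in>(UNIV :: 'l mod_ring set). \<integral>\<xi>. (autocorr d (shift l \<theta> + \<sigma> *\<^sub>R \<xi>))\<^sup>2 \<partial>std_gaussian) \<le>
      (\<Sum>l\<in>(UNIV :: 'l mod_ring set). 8 * (1 + ?G) * \<sigma> ^ 4)"
    by (intro sum_mono)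
  then show "(\<integral>x. (autocorr d x)\<^sup>2 \<partial>sample_law \<sigma> \<theta>) \<le> 8 * (1 + ?G) * \<sigma> ^ 4"
    using int by (subst integral_sample_law) (simp_all add: field_simps)
qed

text \<open>A nonzero summand at another \<open>k\<close> would be a second pair of support points
  with the same difference.\<close>

lemma autocorr_collision_free:
  assumes cf: "collision_free \<theta>" and ij: "i \<in> supp \<theta>" "j \<in> supp \<theta>" "i \<noteq> j"
  shows "autocorr (i - j) \<theta> = \<theta> $ i * \<theta> $ j"
proof -
  have "autocorr (i - j) \<theta> = (\<Sum>k\<in>UNIV. \<theta> $ (k + (i - j)) * \<theta> $ k)"
    by (simp add: inner_vec_def)
  also have "\<dots> = (\<Sum>k\<in>{j}. \<theta> $ (k + (i - j)) * \<theta> $ k)"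
  proof (rule sum.mono_neutral_right)
    show "\<forall>k\<in>UNIV - {j}. \<theta> $ (k + (i - j)) * \<theta> $ k = 0"
    proof (rule ballI, rule ccontr)
      fix k assume k: "k \<in> UNIV - {j}" "\<theta> $ (k + (i - j)) * \<theta> $ k \<noteq> 0"
      then have mem: "k + (i - j) \<in> supp \<theta>" "k \<in> supp \<theta>" by (auto simp: supp_def)
      have "i - j = (k + (i - j)) - k" by simp
      from collision_free_unique[OF cf ij(1,2) mem ij(3) this] k(1) show False by blast
    qed
  qed auto
  finally show ?thesis by simp
qed

text \<open>Three products of pairs of entries determine the entries: \<open>x\<^sup>2 = (x y) (x z) / (y z)\<close>.\<close>

lemma entry_le_products:
  fixes x y z x' y' z' m M e :: real
  assumes m: "0 < m" and bounds: "m \<le> \<bar>x\<bar>" "\<bar>x\<bar> \<le> M" "m \<le> \<bar>y\<bar>" "\<bar>y\<bar> \<le> M" "m \<le> \<bar>z\<bar>" "\<bar>z\<bar> \<le> M"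
      "m \<le> \<bar>x'\<bar>" "\<bar>x'\<bar> \<le> M" "\<bar>y'\<bar> \<le> M" "\<bar>z'\<bar> \<le> M"
    and sign: "0 < x * x'"
    and e: "\<bar>x' * y' - x * y\<bar> \<le> e" "\<bar>x' * z' - x * z\<bar> \<le> e" "\<bar>y' * z' - y * z\<bar> \<le> e"
  shows "\<bar>x' - x\<bar> \<le> 3 * M\<^sup>2 / (2 * m ^ 3) * e"
proof -
  have M: "0 < M" using m bounds(1,2) by linarith
  have MM: "\<bar>a * b\<bar> \<le> M\<^sup>2" if "\<bar>a\<bar> \<le> M" "\<bar>b\<bar> \<le> M" for a b
    using that M unfolding abs_mult power2_eq_square by (intro mult_mono) auto
  have e0: "0 \<le> e" using e(1) by linarith
  have term_le: "\<bar>p * q\<bar> \<le> M\<^sup>2 * e" if "\<bar>p\<bar> \<le> M\<^sup>2" "\<bar>q\<bar> \<le> e" for p q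
    using that e0 unfolding abs_mult by (intro mult_mono) auto
  \<comment> \<open>Telescoping of \<open>(x' * y') * (x' * z') - (x * y) * (x * z)\<close>,
    corrected by replacing \<open>y' * z'\<close> with \<open>y * z\<close>: each term has one
    difference of products as a factor.\<close>
  have "(x'\<^sup>2 - x\<^sup>2) * (y * z) =
      (x' * y') * (x' * z' - x * z) + (x * z) * (x' * y' - x * y) - (x' * x') * (y' * z' - y * z)"
    by (simp add: power2_eq_square algebra_simps)
  also have "\<bar>\<dots>\<bar> \<le> 3 * (M\<^sup>2 * e)"
  proof -
    have tri: "\<bar>p + q - r\<bar> \<le> 3 * c" if "\<bar>p\<bar> \<le> c" "\<bar>q\<bar> \<le> c" "\<bar>r\<bar> \<le> c" for p q r c :: real
      using that by linarith
    show ?thesis by (intro tri term_le MM bounds e)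
  qed
  finally have 1: "\<bar>x'\<^sup>2 - x\<^sup>2\<bar> * (\<bar>y\<bar> * \<bar>z\<bar>) \<le> 3 * M\<^sup>2 * e" by (simp add: abs_mult mult.assoc)
  have "\<bar>x'\<^sup>2 - x\<^sup>2\<bar> * (m * m) \<le> \<bar>x'\<^sup>2 - x\<^sup>2\<bar> * (\<bar>y\<bar> * \<bar>z\<bar>)"
    using m bounds by (intro mult_left_mono mult_mono) auto
  with 1 have 2: "\<bar>x'\<^sup>2 - x\<^sup>2\<bar> * (m * m) \<le> 3 * M\<^sup>2 * e" by linarith
  \<comment> \<open>Equal signs keep the sum away from zero, so the error of the squares controls
    that of the entries. The \<open>2 * m ^ 3\<close> collects this factor and \<open>m * m\<close>
    from \<open>y * z\<close>.\<close>
  have "2 * m \<le> \<bar>x' + x\<bar>"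
  proof (cases "0 < x")
    case True
    then have "0 < x'" using sign by (simp add: zero_less_mult_iff)
    with True show ?thesis using bounds(1,7) by linarith
  next
    case False
    then have "x < 0" "x' < 0" using sign by (auto simp: zero_less_mult_iff)
    then show ?thesis using bounds(1,7) by linarith
  qed
  then have "\<bar>x' - x\<bar> * (2 * m) \<le> \<bar>x' - x\<bar> * \<bar>x' + x\<bar>" by (intro mult_left_mono) auto
  also have "\<dots> = \<bar>x'\<^sup>2 - x\<^sup>2\<bar>" by (simp add: abs_mult[symmetric] power2_eq_square algebra_simps)
  finally have "\<bar>x' - x\<bar> * (2 * m) * (m * m) \<le> \<bar>x'\<^sup>2 - x\<^sup>2\<bar> * (m * m)"
    using m by (intro mult_right_mono) auto
  with 2 have "\<bar>x' - x\<bar> * (2 * m ^ 3) \<le> 3 * M\<^sup>2 * e" by (simp add: power3_eq_cube mult_ac)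
  then show ?thesis using m by (simp add: field_simps)
qed

text \<open>Nonzero entries have size at least \<open>m\<close>, so below distance \<open>m\<close>
  the aligned signals share support and signs. Products of two distinct entries are then
  autocorrelations of both at the same lag, and they determine every entry in a Lipschitz
  way.\<close>

lemma signals_local_separation:
  fixes \<theta> \<phi> :: "real ^ 'l::finite mod_ring"
  assumes m: "m > 0" and mem: "\<theta> \<in> signals m M \<epsilon> \<sigma>" "\<phi> \<in> signals m M \<epsilon> \<sigma>" and close: "rho \<phi> \<theta> < m"
  shows "rho \<phi> \<theta> \<le> CARD('l) * (3 * M\<^sup>2 / (2 * m ^ 3)) * (\<Sum>d\<in>UNIV - {0}. \<bar>autocorr d \<phi> - autocorr d \<theta>\<bar>)"
proof -
  obtain l where l: "rho \<phi> \<theta> = norm (\<phi> - shift l \<theta>)" by (rule rho_attained)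
  define \<psi> where "\<psi> = shift l \<theta>"
  let ?e = "\<Sum>d\<in>UNIV - {0}. \<bar>autocorr d \<phi> - autocorr d \<theta>\<bar>"
  have \<psi>: "m \<le> \<bar>\<psi> $ i\<bar> \<and> \<bar>\<psi> $ i\<bar> \<le> M" if "\<psi> $ i \<noteq> 0" for i
    using mem(1) that by (auto simp: signals_def supp_def \<psi>_def)
  have \<phi>: "m \<le> \<bar>\<phi> $ i\<bar> \<and> \<bar>\<phi> $ i\<bar> \<le> M" if "\<phi> $ i \<noteq> 0" for i
    using mem(2) that by (auto simp: signals_def supp_def)
  have near: "\<bar>\<phi> $ i - \<psi> $ i\<bar> < m" for i
    using component_le_norm_cart[of "\<phi> - \<psi>" i] close l by (simp add: \<psi>_def)
  have zero: "\<phi> $ i = 0 \<longleftrightarrow> \<psi> $ i = 0" for i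
  proof
    show "\<psi> $ i = 0" if "\<phi> $ i = 0" by (rule ccontr) (use near[of i] \<psi>[of i] that in simp)
    show "\<phi> $ i = 0" if "\<psi> $ i = 0" by (rule ccontr) (use near[of i] \<phi>[of i] that in simp)
  qed
  then have supp: "supp \<psi> = supp \<phi>" by (simp add: supp_def)
  have sign: "0 < \<psi> $ i * \<phi> $ i" if "\<psi> $ i \<noteq> 0" for i
  proof (cases "0 < \<psi> $ i")
    case True
    then have "0 < \<phi> $ i" using near[of i] \<psi>[OF that] by linarith
    with True show ?thesis by simp
  next
    case False
    then have "\<psi> $ i < 0" "\<phi> $ i < 0" using near[of i] \<psi>[OF that] that by linarith+
    then show ?thesis by (simp add: mult_neg_neg)
  qed
  have cf: "collision_free \<phi>" "collision_free \<psi>"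
    using mem(2) collision_free_cong[OF supp] by (auto simp: signals_def)
  have e: "\<bar>\<phi> $ i * \<phi> $ j - \<psi> $ i * \<psi> $ j\<bar> \<le> ?e" if "i \<in> supp \<phi>" "j \<in> supp \<phi>" "i \<noteq> j" for i j
  proof -
    have "\<phi> $ i * \<phi> $ j - \<psi> $ i * \<psi> $ j = autocorr (i - j) \<phi> - autocorr (i - j) \<psi>"
      using that cf by (simp add: autocorr_collision_free supp)
    also have "autocorr (i - j) \<psi> = autocorr (i - j) \<theta>" by (simp add: \<psi>_def autocorr_shift)
    also have "\<bar>autocorr (i - j) \<phi> - autocorr (i - j) \<theta>\<bar> \<le> ?e"
      by (rule member_le_sum[of "i - j" "UNIV - {0}" "\<lambda>d. \<bar>autocorr d \<phi> - autocorr d \<theta>\<bar>"])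
        (use that in auto)
    finally show ?thesis .
  qed
  have e0: "0 \<le> ?e" by (intro sum_nonneg) auto
  have entry: "\<bar>\<phi> $ i - \<psi> $ i\<bar> \<le> 3 * M\<^sup>2 / (2 * m ^ 3) * ?e" for i
  proof (cases "i \<in> supp \<phi>")
    case False
    then have "\<phi> $ i = 0" "\<psi> $ i = 0" using zero by (auto simp: supp_def)
    then show ?thesis using e0 m by simp
  next
    case True
    \<comment> \<open>Two further support points play the part of \<open>y\<close> and
      \<open>z\<close> in the product formula.\<close>
    have "\<not> supp \<phi> \<subseteq> {i}"
      using card_mono[of "{i}" "supp \<phi>"] signals_card_supp[OF mem(2)] by auto
    then obtain j where j: "j \<in> supp \<phi>" "j \<noteq> i" by auto
    have "\<not> supp \<phi> \<subseteq> {i, j}"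
      using card_mono[of "{i, j}" "supp \<phi>"] signals_card_supp[OF mem(2)] j by auto
    then obtain k where k: "k \<in> supp \<phi>" "k \<noteq> i" "k \<noteq> j" by auto
    have "\<phi> $ i \<noteq> 0" "\<phi> $ j \<noteq> 0" "\<phi> $ k \<noteq> 0" using True j k by (auto simp: supp_def)
    note nz = this
    have bounds: "m \<le> \<bar>\<phi> $ x\<bar>" "\<bar>\<phi> $ x\<bar> \<le> M" "m \<le> \<bar>\<psi> $ x\<bar>" "\<bar>\<psi> $ x\<bar> \<le> M" if "\<phi> $ x \<noteq> 0" for x
      using \<phi> \<psi> zero that by blast+
    have "\<psi> $ i \<noteq> 0" using nz zero by blast
    note * = bounds[OF nz(1)] bounds[OF nz(2)] bounds[OF nz(3)]
    show ?thesis
      by (rule entry_le_products[OF m *(3,4,7,8,11,12,1,2,6,10) sign[OF \<open>\<psi> $ i \<noteq> 0\<close>]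
            e[OF True j(1) not_sym[OF j(2)]] e[OF True k(1) not_sym[OF k(2)]] e[OF j(1) k(1) not_sym[OF k(3)]]])
  qed
  have "norm (\<phi> - \<psi>) \<le> (\<Sum>i\<in>UNIV. \<bar>(\<phi> - \<psi>) $ i\<bar>)" by (rule norm_le_l1_cart)
  also have "\<dots> \<le> (\<Sum>i\<in>(UNIV :: 'l mod_ring set). 3 * M\<^sup>2 / (2 * m ^ 3) * ?e)"
    using entry by (intro sum_mono) simp
  finally show ?thesis using l by (simp add: \<psi>_def)
qed

section \<open>Orbit averages of exponentials\<close>

text \<open>The moment generating function, at \<open>t\<close>, of a uniformly random shift of
  \<open>\<theta>\<close>; it depends on the orbit only.\<close>

definition orbit_mgf :: "real ^ 'l::finite mod_ring \<Rightarrow> real ^ 'l mod_ring \<Rightarrow> real" where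
  "orbit_mgf t \<theta> = (\<Sum>l\<in>UNIV. exp (t \<bullet> shift l \<theta>)) / CARD('l)"

lemma continuous_on_orbit_mgf: "continuous_on A (orbit_mgf t)"
  unfolding orbit_mgf_def by (intro continuous_intros continuous_on_shift) simp

text \<open>Along the longer of the two vectors, the orbit average is exponentially dominated by the
  largest inner product, which is smaller for every vector outside the orbit.\<close>

lemma orbit_mgf_neq:
  fixes \<theta> \<phi> :: "real ^ 'l::finite mod_ring"
  assumes neq: "\<And>l. \<theta> \<noteq> shift l \<phi>" and le: "norm \<phi> \<le> norm \<theta>"
  shows "\<exists>t. orbit_mgf t \<theta> \<noteq> orbit_mgf t \<phi>"
proof -
  let ?L = "real CARD('l)"
  \<comment> \<open>The smallest excess of \<open>\<theta> \<bullet> \<theta>\<close> over the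
    products with the other orbit. It is positive: expand the squared norm of
    \<open>\<theta> - shift l \<phi>\<close> and use that \<open>\<phi>\<close> is no longer than
    \<open>\<theta>\<close>.\<close>
  define \<delta> where "\<delta> = Min (range (\<lambda>l. \<theta> \<bullet> \<theta> - \<theta> \<bullet> shift l \<phi>))"
  have "0 < \<theta> \<bullet> \<theta> - \<theta> \<bullet> shift l \<phi>" for l
  proof -
    have "0 < (\<theta> - shift l \<phi>) \<bullet> (\<theta> - shift l \<phi>)" using neq[of l] by simp
    also have "\<dots> = \<theta> \<bullet> \<theta> - 2 * (\<theta> \<bullet> shift l \<phi>) + \<phi> \<bullet> \<phi>"
      by (simp add: inner_diff_left inner_diff_right inner_commute inner_shift_shift)
    also have "\<phi> \<bullet> \<phi> \<le> \<theta> \<bullet> \<theta>" using le by (simp add: norm_eq_sqrt_inner)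
    finally show ?thesis by simp
  qed
  then have \<delta>: "0 < \<delta>" unfolding \<delta>_def by (subst Min_gr_iff) auto
  have gap: "\<theta> \<bullet> shift l \<phi> \<le> \<theta> \<bullet> \<theta> - \<delta>" for l
  proof -
    have "\<delta> \<le> \<theta> \<bullet> \<theta> - \<theta> \<bullet> shift l \<phi>" unfolding \<delta>_def by (rule Min_le) auto
    then show ?thesis by simp
  qed
  \<comment> \<open>With \<open>s * \<delta> = ?L\<close> the dominant term wins by a factor
    \<open>exp ?L\<close>, more than the factor \<open>?L\<close> lost by keeping a single term of
    the average.\<close>
  define s where "s = ?L / \<delta>"
  have L0: "0 < ?L" by (simp add: card_gt_0_iff)
  have s: "0 < s" "s * \<delta> = ?L" using \<delta> L0 by (simp_all add: s_def)
  let ?t = "s *\<^sub>R \<theta>"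
  have "exp (s * (\<theta> \<bullet> \<theta>)) \<le> (\<Sum>l\<in>UNIV. exp (?t \<bullet> shift l \<theta>))"
    using member_le_sum[of 0 UNIV "\<lambda>l. exp (?t \<bullet> shift l \<theta>)"] by simp
  then have 1: "exp (s * (\<theta> \<bullet> \<theta>)) / ?L \<le> orbit_mgf ?t \<theta>"
    unfolding orbit_mgf_def by (rule divide_right_mono) simp
  have "(\<Sum>l\<in>UNIV. exp (?t \<bullet> shift l \<phi>)) \<le> (\<Sum>l\<in>(UNIV :: 'l mod_ring set). exp (s * (\<theta> \<bullet> \<theta> - \<delta>)))"
    using gap s by (intro sum_mono) (simp add: mult_left_mono)
  then have "orbit_mgf ?t \<phi> \<le> exp (s * (\<theta> \<bullet> \<theta> - \<delta>))"
    using L0 by (simp add: orbit_mgf_def divide_le_eq mult.commute)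
  also have "\<dots> = exp (s * (\<theta> \<bullet> \<theta>)) / exp ?L"
    using s by (simp add: right_diff_distrib exp_diff)
  also have "\<dots> < exp (s * (\<theta> \<bullet> \<theta>)) / ?L"
  proof (rule divide_strict_left_mono)
    show "?L < exp ?L" using exp_ge_add_one_self[of ?L] by linarith
  qed (use L0 in auto)
  also note 1
  finally show ?thesis by (intro exI[of _ ?t]) simp
qed

lemma orbit_mgf_separates:
  assumes "\<And>l. \<theta> \<noteq> shift l \<phi>"
  shows "\<exists>t. orbit_mgf t \<theta> \<noteq> orbit_mgf t \<phi>"
proof (cases "norm \<phi> \<le> norm \<theta>")
  case True
  then show ?thesis using assms orbit_mgf_neq by blast
next
  case False
  have "\<phi> \<noteq> shift l \<theta>" for l
    using assms[of "- l"] by (auto simp: shift_shift)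
  with False orbit_mgf_neq[of \<phi> \<theta>] show ?thesis by (metis linear)
qed

text \<open>Formulated with single shifts instead of \<open>rho\<close>, since each of them gives a
  closed condition by continuity.\<close>

lemma compact_separated_pairs:
  "compact {p \<in> cball 0 D \<times> cball 0 D. \<forall>l. m \<le> norm (fst p - shift l (snd p :: real ^ 'l::finite mod_ring))}"
proof -
  have "closed {p. m \<le> norm (fst p - shift l (snd p :: real ^ 'l mod_ring))}" for l
  proof (intro closed_Collect_le continuous_intros)
    have "continuous_on UNIV (shift l \<circ> (snd :: (real ^ 'l mod_ring) \<times> (real ^ 'l mod_ring) \<Rightarrow> _))"
      by (intro continuous_on_compose continuous_on_snd continuous_on_id continuous_on_shift)
    then show "continuous_on UNIV (\<lambda>p :: (real ^ 'l mod_ring) \<times> (real ^ 'l mod_ring). shift l (snd p))"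
      by (simp add: o_def)
  qed
  then have "closed (\<Inter>l. {p. m \<le> norm (fst p - shift l (snd p :: real ^ 'l mod_ring))})"
    by (intro closed_INT) auto
  then have "compact ((cball 0 D \<times> cball 0 D) \<inter> (\<Inter>l. {p. m \<le> norm (fst p - shift l (snd p :: real ^ 'l mod_ring))}))"
    by (intro compact_Int_closed compact_Times compact_cball)
  also have "\<dots> = {p \<in> cball 0 D \<times> cball 0 D. \<forall>l. m \<le> norm (fst p - shift l (snd p))}" by auto
  finally show ?thesis .
qed

lemma continuous_on_orbit_mgf_pair:
  "continuous_on A (\<lambda>p. orbit_mgf t (fst p))" "continuous_on A (\<lambda>p. orbit_mgf t (snd p))"
  by (rule continuous_on_compose2[OF continuous_on_orbit_mgf[of UNIV]], auto intro!: continuous_intros)+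

text \<open>Each \<open>t\<close> separates an open set of pairs; these sets cover the compact set
  of pairs at distance at least \<open>m\<close>, and a finite subcover suffices. Only
  \<open>D\<close> and \<open>m\<close> enter, so \<open>N\<close> can be fixed before
  \<open>\<sigma>\<close>.\<close>

lemma orbit_mgf_finite_separating:
  fixes D m :: real
  assumes m: "m > 0"
  obtains N :: "(real ^ 'l::finite mod_ring) set" where "finite N"
    "\<And>\<theta> \<phi> :: real ^ 'l::finite mod_ring. norm \<theta> \<le> D \<Longrightarrow> norm \<phi> \<le> D \<Longrightarrow> m \<le> rho \<theta> \<phi> \<Longrightarrow>
      \<exists>t\<in>N. orbit_mgf t \<theta> \<noteq> orbit_mgf t \<phi>"
proof -
  let ?P = "{p \<in> cball 0 D \<times> cball 0 D. \<forall>l. m \<le> norm (fst p - shift l (snd p :: real ^ 'l mod_ring))}"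
  let ?U = "\<lambda>t. {p. orbit_mgf t (fst p) \<noteq> orbit_mgf t (snd p :: real ^ 'l mod_ring)}"
  have op: "open (?U t)" for t
    by (intro open_Collect_neq continuous_on_orbit_mgf_pair)
  have "?P \<subseteq> (\<Union>t\<in>UNIV. ?U t)"
  proof
    fix p assume p: "p \<in> ?P"
    have "fst p \<noteq> shift l (snd p)" for l
    proof
      assume eq: "fst p = shift l (snd p)"
      have "m \<le> norm (fst p - shift l (snd p))" using p by blast
      then show False using m unfolding eq by simp
    qed
    then show "p \<in> (\<Union>t\<in>UNIV. ?U t)" using orbit_mgf_separates[of "fst p" "snd p"] by auto
  qed
  then obtain N where N: "N \<subseteq> UNIV" "finite N" "?P \<subseteq> (\<Union>t\<in>N. ?U t)"
    by (rule compactE_image[OF compact_separated_pairs op])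
  show ?thesis
  proof
    fix \<theta> \<phi> :: "real ^ 'l mod_ring" assume *: "norm \<theta> \<le> D" "norm \<phi> \<le> D" "m \<le> rho \<theta> \<phi>"
    have "\<forall>l. m \<le> norm (\<theta> - shift l \<phi>)" using order_trans[OF *(3) rho_le] by blast
    then have "(\<theta>, \<phi>) \<in> ?P" using * by simp
    with N(3) have "(\<theta>, \<phi>) \<in> (\<Union>t\<in>N. ?U t)" by (rule subsetD)
    then show "\<exists>t\<in>N. orbit_mgf t \<theta> \<noteq> orbit_mgf t \<phi>" by simp
  qed (rule N(2))
qed

text \<open>A positive continuous function on a compact set has a positive minimum. The weights
  \<open>\<kappa>\<close> are kept general because they will depend on \<open>\<sigma>\<close>, and
  \<open>\<gamma>\<close> with them.\<close>

lemma orbit_mgf_gap: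
  fixes D m :: real and N :: "(real ^ 'l::finite mod_ring) set"
  assumes N: "finite N" and \<kappa>: "\<And>t. \<kappa> t > 0"
    and sep: "\<And>\<theta> \<phi>. norm \<theta> \<le> D \<Longrightarrow> norm \<phi> \<le> D \<Longrightarrow> m \<le> rho \<theta> \<phi> \<Longrightarrow>
      \<exists>t\<in>N. orbit_mgf t \<theta> \<noteq> orbit_mgf t \<phi>"
  obtains \<gamma> where "\<gamma> > 0" "\<And>\<theta> \<phi>. norm \<theta> \<le> D \<Longrightarrow> norm \<phi> \<le> D \<Longrightarrow> m \<le> rho \<theta> \<phi> \<Longrightarrow>
      \<gamma> \<le> (\<Sum>t\<in>N. \<bar>\<kappa> t * orbit_mgf t \<theta> - \<kappa> t * orbit_mgf t \<phi>\<bar>)"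
proof -
  let ?P = "{p \<in> cball 0 D \<times> cball 0 D. \<forall>l. m \<le> norm (fst p - shift l (snd p :: real ^ 'l mod_ring))}"
  let ?f = "\<lambda>p. \<Sum>t\<in>N. \<bar>\<kappa> t * orbit_mgf t (fst p) - \<kappa> t * orbit_mgf t (snd p)\<bar>"
  have memP: "(\<theta>, \<phi>) \<in> ?P" if "norm \<theta> \<le> D" "norm \<phi> \<le> D" "m \<le> rho \<theta> \<phi>" for \<theta> \<phi>
  proof -
    have "\<forall>l. m \<le> norm (\<theta> - shift l \<phi>)" using order_trans[OF that(3) rho_le] by blast
    then show ?thesis using that by simp
  qed
  show ?thesis
  proof (cases "?P = {}")
    case True
    show ?thesis
    proof (rule that[of 1])
      fix \<theta> \<phi> :: "real ^ 'l mod_ring" assume "norm \<theta> \<le> D" "norm \<phi> \<le> D" "m \<le> rho \<theta> \<phi>"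
      then have "(\<theta>, \<phi>) \<in> ?P" by (rule memP)
      then show "1 \<le> (\<Sum>t\<in>N. \<bar>\<kappa> t * orbit_mgf t \<theta> - \<kappa> t * orbit_mgf t \<phi>\<bar>)" using True by blast
    qed simp
  next
    case False
    have "continuous_on ?P ?f" by (intro continuous_intros continuous_on_orbit_mgf_pair)
    then obtain p where p: "p \<in> ?P" "\<And>q. q \<in> ?P \<Longrightarrow> ?f p \<le> ?f q"
      using continuous_attains_inf[OF compact_separated_pairs False] by blast
    obtain l where "rho (fst p) (snd p) = norm (fst p - shift l (snd p))" by (rule rho_attained)
    then have "m \<le> rho (fst p) (snd p)" using p(1) by auto
    then obtain t where t: "t \<in> N" "orbit_mgf t (fst p) \<noteq> orbit_mgf t (snd p)"
      using sep[of "fst p" "snd p"] p(1) by (auto simp: mem_Times_iff)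
    have "0 < \<bar>\<kappa> t * orbit_mgf t (fst p) - \<kappa> t * orbit_mgf t (snd p)\<bar>"
      using t(2) \<kappa>[of t] by simp
    also have "\<dots> \<le> ?f p" by (rule member_le_sum[OF t(1), of "\<lambda>t. \<bar>\<kappa> t * orbit_mgf t (fst p) - \<kappa> t * orbit_mgf t (snd p)\<bar>"])
        (use N in auto)
    finally have pos: "0 < ?f p" .
    show ?thesis
    proof (rule that[OF pos])
      fix \<theta> \<phi> :: "real ^ 'l mod_ring" assume "norm \<theta> \<le> D" "norm \<phi> \<le> D" "m \<le> rho \<theta> \<phi>"
      then have "(\<theta>, \<phi>) \<in> ?P" by (rule memP)
      from p(2)[OF this] show "?f p \<le> (\<Sum>t\<in>N. \<bar>\<kappa> t * orbit_mgf t \<theta> - \<kappa> t * orbit_mgf t \<phi>\<bar>)" by simp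
    qed
  qed
qed

text \<open>The noise multiplies the exponential moment of the orbit by a factor known from
  \<open>\<sigma>\<close> and \<open>t\<close>, so a rescaled \<open>exp (t \<bullet> x)\<close> is
  unbiased for \<open>orbit_mgf t \<theta>\<close>.\<close>

lemma
  fixes t \<theta> :: "real ^ 'l::finite mod_ring"
  shows integrable_exp_sample_law: "integrable (sample_law \<sigma> \<theta>) (\<lambda>x. exp (t \<bullet> x))"
    and integral_exp_sample_law: "(\<integral>x. exp (t \<bullet> x) \<partial>sample_law \<sigma> \<theta>) = exp (\<sigma>\<^sup>2 * (t \<bullet> t) / 2) * orbit_mgf t \<theta>"
proof -
  have eq: "exp (t \<bullet> (v + \<sigma> *\<^sub>R \<xi>)) = exp (t \<bullet> v) * exp ((\<sigma> *\<^sub>R t) \<bullet> \<xi>)" for v \<xi>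
    by (simp add: inner_add_right exp_add)
  have int: "integrable std_gaussian (\<lambda>\<xi>. exp (t \<bullet> (shift l \<theta> + \<sigma> *\<^sub>R \<xi>)))" for l
    unfolding eq by (intro integrable_mult_right integrable_exp_std_gaussian)
  have val: "(\<integral>\<xi>. exp (t \<bullet> (shift l \<theta> + \<sigma> *\<^sub>R \<xi>)) \<partial>std_gaussian) = exp (\<sigma>\<^sup>2 * (t \<bullet> t) / 2) * exp (t \<bullet> shift l \<theta>)" for l
    unfolding eq integral_mult_right_zero integral_exp_std_gaussian
    by (simp add: power2_eq_square mult_ac)
  show "integrable (sample_law \<sigma> \<theta>) (\<lambda>x. exp (t \<bullet> x))"
    using int by (intro integrable_sample_law) simp_all
  show "(\<integral>x. exp (t \<bullet> x) \<partial>sample_law \<sigma> \<theta>) = exp (\<sigma>\<^sup>2 * (t \<bullet> t) / 2) * orbit_mgf t \<theta>"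
    using int by (subst integral_sample_law) (simp_all add: val orbit_mgf_def sum_distrib_left)
qed

lemma orbit_mgf_le:
  fixes t \<theta> :: "real ^ 'l::finite mod_ring"
  assumes "norm \<theta> \<le> D"
  shows "orbit_mgf t \<theta> \<le> exp (norm t * D)"
proof -
  have "(\<Sum>l\<in>UNIV. exp (t \<bullet> shift l \<theta>)) \<le> (\<Sum>l\<in>(UNIV :: 'l mod_ring set). exp (norm t * D))"
  proof (rule sum_mono)
    fix l
    have "t \<bullet> shift l \<theta> \<le> norm t * norm \<theta>" using norm_cauchy_schwarz[of t "shift l \<theta>"] by simp
    also have "\<dots> \<le> norm t * D" using assms by (intro mult_left_mono) auto
    finally show "exp (t \<bullet> shift l \<theta>) \<le> exp (norm t * D)" by simp
  qed
  then show ?thesis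
    by (simp add: orbit_mgf_def divide_le_eq card_gt_0_iff mult.commute)
qed

section \<open>The upper bound\<close>

text \<open>The features are the autocorrelations at nonzero lags, which give the linear local
  separation, and damped exponentials, which only have to tell distant orbits apart. All have second
  moment at most \<open>B * \<sigma> ^ 4\<close>.\<close>

lemma minimax_risk_upper_bound:
  fixes m M \<epsilon> \<sigma> D B C\<^sub>1 :: real and N :: "(real ^ 'l::finite mod_ring) set"
  defines "T \<equiv> signals m M \<epsilon> \<sigma> :: (real ^ 'l::finite mod_ring) set"
    and "J \<equiv> (UNIV - {0 :: 'l mod_ring}) <+> N"
    and "B \<equiv> 8 * (1 + gaussian_moment4 TYPE('l mod_ring))"
    and "C\<^sub>1 \<equiv> CARD('l) * (3 * M\<^sup>2 / (2 * m ^ 3))"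
  assumes m: "m > 0" "M > 0" and \<sigma>: "\<sigma> > 0" and D: "D = CARD('l) * M"
    and N: "finite N" and sep: "\<And>\<theta> \<phi>. norm \<theta> \<le> D \<Longrightarrow> norm \<phi> \<le> D \<Longrightarrow> m \<le> rho \<theta> \<phi> \<Longrightarrow>
      \<exists>t\<in>N. orbit_mgf t \<theta> \<noteq> orbit_mgf t \<phi>"
  shows "\<forall>\<^sub>F n in sequentially. minimax_risk n \<sigma> T \<le>
    ennreal ((C\<^sub>1 * (2 * card J + 1) + 1) * sqrt B * (\<sigma>\<^sup>2 / sqrt (real n)))"
proof -
  \<comment> \<open>The factor \<open>c\<close> also removes the noise factor, so the feature has
    mean \<open>\<kappa> t * orbit_mgf t \<theta>\<close>. The damping in \<open>\<kappa>\<close>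
    keeps this mean within \<open>\<sigma>\<^sup>2\<close> and the second moment within
    \<open>\<sigma> ^ 4\<close>, the scales of the autocorrelations.\<close>
  define \<kappa> where "\<kappa> t = \<sigma>\<^sup>2 * exp (- (norm t * D + \<sigma>\<^sup>2 * (t \<bullet> t) / 2))" for t :: "real ^ 'l mod_ring"
  define c where "c t = \<kappa> t * exp (- (\<sigma>\<^sup>2 * (t \<bullet> t) / 2))" for t :: "real ^ 'l mod_ring"
  define g :: "'l mod_ring + real ^ 'l mod_ring \<Rightarrow> real ^ 'l mod_ring \<Rightarrow> real"
    where "g = case_sum autocorr (\<lambda>t x. c t * exp (t \<bullet> x))"
  define \<Psi> :: "'l mod_ring + real ^ 'l mod_ring \<Rightarrow> real ^ 'l mod_ring \<Rightarrow> real"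
    where "\<Psi> = case_sum autocorr (\<lambda>t \<theta>. \<kappa> t * orbit_mgf t \<theta>)"
  define V where "V = B * \<sigma> ^ 4"
  have \<kappa>: "\<kappa> t > 0" for t using \<sigma> by (simp add: \<kappa>_def)
  obtain \<gamma> where \<gamma>: "\<gamma> > 0" "\<And>\<theta> \<phi>. norm \<theta> \<le> D \<Longrightarrow> norm \<phi> \<le> D \<Longrightarrow> m \<le> rho \<theta> \<phi> \<Longrightarrow>
      \<gamma> \<le> (\<Sum>t\<in>N. \<bar>\<kappa> t * orbit_mgf t \<theta> - \<kappa> t * orbit_mgf t \<phi>\<bar>)"
    by (rule orbit_mgf_gap[where \<kappa> = \<kappa>, OF N \<kappa> sep]) blast+
  \<comment> \<open>Orbit distances are at most \<open>2 * D\<close>, and distant orbits have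
    feature distance at least \<open>\<gamma>\<close>, so its square over
    \<open>\<gamma>\<^sup>2\<close> is at least 1.\<close>
  define C\<^sub>2 where "C\<^sub>2 = 2 * D / \<gamma>\<^sup>2"
  have D0: "D \<ge> 0" using m D by simp
  have B1: "B \<ge> 8" unfolding B_def gaussian_moment4_def by simp
  have V0: "V > 0" using B1 \<sigma> by (simp add: V_def)
  have C: "C\<^sub>1 \<ge> 0" "C\<^sub>2 \<ge> 0" using m D0 \<gamma> by (simp_all add: C\<^sub>1_def C\<^sub>2_def)
  have J: "finite J" using N by (simp add: J_def)
  have T: "norm \<theta> \<le> D" "norm \<theta> \<le> \<sigma>" if "\<theta> \<in> T" for \<theta>
    using that signals_norm_le[of \<theta> m M \<epsilon> \<sigma>] m D by (auto simp: T_def signals_def)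
  have \<kappa>_le: "\<kappa> t * exp (norm t * D) \<le> \<sigma>\<^sup>2" for t
  proof -
    have "\<kappa> t * exp (norm t * D) = \<sigma>\<^sup>2 * exp (- (\<sigma>\<^sup>2 * (t \<bullet> t) / 2))"
      by (simp add: \<kappa>_def exp_add[symmetric])
    also have "\<dots> \<le> \<sigma>\<^sup>2 * 1" by (intro mult_left_mono) auto
    finally show ?thesis by simp
  qed
  have g [measurable]: "g j \<in> borel_measurable borel" for j
    by (cases j) (simp_all add: g_def)
  have g_int: "integrable (sample_law \<sigma> \<theta>) (g j)"
      "(\<integral>x. g j x \<partial>sample_law \<sigma> \<theta>) = \<Psi> j \<theta>"
      "integrable (sample_law \<sigma> \<theta>) (\<lambda>x. (g j x)\<^sup>2)"
      "(\<integral>x. (g j x)\<^sup>2 \<partial>sample_law \<sigma> \<theta>) \<le> V" "\<bar>\<Psi> j \<theta>\<bar> \<le> \<sigma>\<^sup>2" if j: "j \<in> J" and \<theta>: "\<theta> \<in> T" for j \<theta>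
  proof -
    have "integrable (sample_law \<sigma> \<theta>) (g j) \<and> (\<integral>x. g j x \<partial>sample_law \<sigma> \<theta>) = \<Psi> j \<theta> \<and>
      integrable (sample_law \<sigma> \<theta>) (\<lambda>x. (g j x)\<^sup>2) \<and> (\<integral>x. (g j x)\<^sup>2 \<partial>sample_law \<sigma> \<theta>) \<le> V \<and> \<bar>\<Psi> j \<theta>\<bar> \<le> \<sigma>\<^sup>2"
    proof (cases j)
      case (Inl d)
      have d: "d \<noteq> 0" using j Inl by (auto simp: J_def)
      have "\<bar>autocorr d \<theta>\<bar> \<le> norm \<theta> * norm \<theta>" using Cauchy_Schwarz_ineq2[of "shift d \<theta>" \<theta>] by simp
      also have "\<dots> \<le> \<sigma> * \<sigma>" using T[OF \<theta>] \<sigma> by (intro mult_mono) auto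
      finally have "\<bar>autocorr d \<theta>\<bar> \<le> \<sigma>\<^sup>2" by (simp add: power2_eq_square)
      then show ?thesis
        using integrable_autocorr[OF d, of \<sigma> \<theta>] integral_autocorr[OF d, of \<sigma> \<theta>]
          integrable_autocorr_square[OF T(2)[OF \<theta>], of d] integral_autocorr_square[OF T(2)[OF \<theta>], of d]
        by (simp add: Inl g_def \<Psi>_def V_def B_def)
    next
      case (Inr t)
      \<comment> \<open>The square of an exponential feature is an exponential at
        \<open>2 *\<^sub>R t\<close>, so its mean is known as well.\<close>
      have sq: "(c t * exp (t \<bullet> x))\<^sup>2 = (c t)\<^sup>2 * exp ((2 *\<^sub>R t) \<bullet> x)" for x
        by (simp add: power_mult_distrib exp_double)
      have "(\<integral>x. c t * exp (t \<bullet> x) \<partial>sample_law \<sigma> \<theta>) = \<kappa> t * orbit_mgf t \<theta>"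
        unfolding integral_mult_right_zero integral_exp_sample_law by (simp add: c_def exp_minus field_simps)
      moreover have "(\<integral>x. (c t * exp (t \<bullet> x))\<^sup>2 \<partial>sample_law \<sigma> \<theta>) \<le> V"
      proof -
        have "(\<integral>x. (c t * exp (t \<bullet> x))\<^sup>2 \<partial>sample_law \<sigma> \<theta>) =
            (c t)\<^sup>2 * exp (2 * (\<sigma>\<^sup>2 * (t \<bullet> t))) * orbit_mgf (2 *\<^sub>R t) \<theta>"
          unfolding sq integral_mult_right_zero integral_exp_sample_law by simp
        also have "\<dots> \<le> (c t)\<^sup>2 * exp (2 * (\<sigma>\<^sup>2 * (t \<bullet> t))) * exp (2 * (norm t * D))"
          using orbit_mgf_le[OF T(1)[OF \<theta>], of "2 *\<^sub>R t"] by (intro mult_left_mono) (auto simp: mult.assoc)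
        also have "\<dots> = \<sigma> ^ 4"
        proof -
          have "c t = \<sigma>\<^sup>2 * exp (- (norm t * D + \<sigma>\<^sup>2 * (t \<bullet> t)))"
            unfolding c_def \<kappa>_def by (simp add: exp_add[symmetric])
          then have "(c t)\<^sup>2 = \<sigma> ^ 4 * exp (- (2 * (norm t * D) + 2 * (\<sigma>\<^sup>2 * (t \<bullet> t))))"
            by (simp add: power_mult_distrib exp_double[symmetric] distrib_left)
          then show ?thesis by (simp add: exp_add[symmetric] mult.assoc)
        qed
        also have "\<dots> \<le> V" using B1 \<sigma> by (simp add: V_def)
        finally show ?thesis .
      qed
      moreover have "\<bar>\<kappa> t * orbit_mgf t \<theta>\<bar> \<le> \<sigma>\<^sup>2"
      proof -
        have "0 \<le> orbit_mgf t \<theta>" by (simp add: orbit_mgf_def sum_nonneg)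
        then have "\<bar>\<kappa> t * orbit_mgf t \<theta>\<bar> = \<kappa> t * orbit_mgf t \<theta>" using \<kappa>[of t] by simp
        also have "\<kappa> t * orbit_mgf t \<theta> \<le> \<kappa> t * exp (norm t * D)"
          using orbit_mgf_le[OF T(1)[OF \<theta>], of t] \<kappa>[of t] by (intro mult_left_mono) auto
        also have "\<dots> \<le> \<sigma>\<^sup>2" by (rule \<kappa>_le)
        finally show ?thesis .
      qed
      moreover have "integrable (sample_law \<sigma> \<theta>) (\<lambda>x. c t * exp (t \<bullet> x))"
        "integrable (sample_law \<sigma> \<theta>) (\<lambda>x. (c t * exp (t \<bullet> x))\<^sup>2)"
        unfolding sq by (intro integrable_mult_right integrable_exp_sample_law)+
      ultimately show ?thesis by (simp add: Inr g_def \<Psi>_def)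
    qed
    then show "integrable (sample_law \<sigma> \<theta>) (g j)"
      "(\<integral>x. g j x \<partial>sample_law \<sigma> \<theta>) = \<Psi> j \<theta>"
      "integrable (sample_law \<sigma> \<theta>) (\<lambda>x. (g j x)\<^sup>2)"
      "(\<integral>x. (g j x)\<^sup>2 \<partial>sample_law \<sigma> \<theta>) \<le> V" "\<bar>\<Psi> j \<theta>\<bar> \<le> \<sigma>\<^sup>2" by blast+
  qed
  have separation: "rho \<phi> \<theta> \<le> C\<^sub>1 * (\<Sum>j\<in>J. \<bar>\<Psi> j \<phi> - \<Psi> j \<theta>\<bar>) + C\<^sub>2 * (\<Sum>j\<in>J. \<bar>\<Psi> j \<phi> - \<Psi> j \<theta>\<bar>)\<^sup>2"
    if mem: "\<theta> \<in> T" "\<phi> \<in> T" for \<theta> \<phi>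
  proof -
    let ?u = "\<Sum>j\<in>J. \<bar>\<Psi> j \<phi> - \<Psi> j \<theta>\<bar>"
    let ?a = "\<Sum>d\<in>UNIV - {0}. \<bar>autocorr d \<phi> - autocorr d \<theta>\<bar>"
    let ?b = "\<Sum>t\<in>N. \<bar>\<kappa> t * orbit_mgf t \<phi> - \<kappa> t * orbit_mgf t \<theta>\<bar>"
    have u: "?u = ?a + ?b"
      unfolding J_def using N by (subst sum.Plus) (auto simp: \<Psi>_def)
    have ab: "0 \<le> ?a" "0 \<le> ?b" by (intro sum_nonneg; simp)+
    show ?thesis
    proof (cases "rho \<phi> \<theta> < m")
      case True
      have "rho \<phi> \<theta> \<le> C\<^sub>1 * ?a"
        unfolding C\<^sub>1_def using mem True by (intro signals_local_separation m) (auto simp: T_def)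
      also have "?a \<le> ?u" using u ab by linarith
      then have "C\<^sub>1 * ?a \<le> C\<^sub>1 * ?u" using C(1) by (rule mult_left_mono)
      also have "\<dots> \<le> C\<^sub>1 * ?u + C\<^sub>2 * ?u\<^sup>2" using C by simp
      finally show ?thesis .
    next
      case False
      then have "\<gamma> \<le> ?b" using T mem by (intro \<gamma>) auto
      then have "\<gamma> \<le> ?u" using u ab by linarith
      then have "\<gamma>\<^sup>2 \<le> ?u\<^sup>2" using \<gamma>(1) by (intro power_mono) auto
      then have "1 \<le> ?u\<^sup>2 / \<gamma>\<^sup>2" using \<gamma>(1) by simp
      then have "2 * D * 1 \<le> 2 * D * (?u\<^sup>2 / \<gamma>\<^sup>2)" using D0 by (intro mult_left_mono) auto
      then have "2 * D \<le> C\<^sub>2 * ?u\<^sup>2" by (simp add: C\<^sub>2_def)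
      moreover have "rho \<phi> \<theta> \<le> 2 * D" using rho_le_norm_add[of \<phi> \<theta>] T(1)[OF mem(1)] T(1)[OF mem(2)] by linarith
      moreover have "0 \<le> C\<^sub>1 * ?u" by (intro mult_nonneg_nonneg C sum_nonneg) simp
      ultimately show ?thesis by linarith
    qed
  qed
  let ?p = "real (card J)"
  let ?s = "\<lambda>n. sqrt (V / real n)"
  have s_eq: "?s n = sqrt B * (\<sigma>\<^sup>2 / sqrt (real n))" for n
  proof -
    have "sqrt (\<sigma> ^ 4) = \<sigma>\<^sup>2" using real_sqrt_abs[of "\<sigma>\<^sup>2"] by simp
    then show ?thesis by (simp add: V_def real_sqrt_divide real_sqrt_mult)
  qed
  \<comment> \<open>\<open>C\<^sub>2\<close> depends on \<open>\<sigma>\<close> but comes with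
    \<open>?s n\<close> squared. One factor tends to 0 and absorbs the coefficient; the other
    accounts for the \<open>+ 1\<close> in the final constant.\<close>
  have "(\<lambda>n. C\<^sub>2 * (8 * ?p\<^sup>2 + 2) * ?s n) \<longlonglongrightarrow> C\<^sub>2 * (8 * ?p\<^sup>2 + 2) * sqrt 0"
    by (intro tendsto_intros lim_const_over_n)
  then have "\<forall>\<^sub>F n in sequentially. C\<^sub>2 * (8 * ?p\<^sup>2 + 2) * ?s n < 1"
    by (rule order_tendstoD) simp
  moreover have "\<forall>\<^sub>F n in sequentially. n > 0" by (rule eventually_gt_at_top)
  ultimately show ?thesis
  proof eventually_elim
    case (elim n)
    have s0: "0 \<le> ?s n" using V0 by simp
    have "minimax_risk n \<sigma> T \<le> ennreal (C\<^sub>1 * (2 * card J + 1) * ?s n + C\<^sub>2 * (8 * (card J)\<^sup>2 + 2) * (?s n)\<^sup>2)"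
      by (rule minimax_risk_minimum_distance[where g = g and \<Psi> = \<Psi> and V = V,
            OF J elim(2) V0 C g g_int separation refl])
    also have "C\<^sub>2 * (8 * (card J)\<^sup>2 + 2) * (?s n)\<^sup>2 \<le> 1 * ?s n"
    proof -
      have p: "C\<^sub>2 * (8 * (card J)\<^sup>2 + 2) = C\<^sub>2 * (8 * ?p\<^sup>2 + 2)" by simp
      show ?thesis
        unfolding p power2_eq_square[of "?s n"] mult.assoc[symmetric]
        by (rule mult_right_mono[OF less_imp_le[OF elim(1)] s0])
    qed
    then have "ennreal (C\<^sub>1 * (2 * card J + 1) * ?s n + C\<^sub>2 * (8 * (card J)\<^sup>2 + 2) * (?s n)\<^sup>2) \<le>
        ennreal ((C\<^sub>1 * (2 * card J + 1) + 1) * ?s n)"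
      by (intro ennreal_leI) (simp add: distrib_right)
    finally show ?case unfolding s_eq by (simp add: mult.assoc)
  qed
qed

text \<open>The lower bound needs a guard: for small \<open>\<sigma>\<close> no signal meets the
  norm constraint, and an empty class has risk 0. In an infinite class some signal has an entry that
  can be moved.\<close>

theorem theorem1p4p1:
  fixes m M \<epsilon> :: real
  assumes "m > 0" and "M > 0" and "\<epsilon> > 0"
  shows "\<exists>c>0. \<exists>C>0. \<forall>\<sigma>>0. \<forall>\<^sub>F n in sequentially.
    (infinite (signals m M \<epsilon> \<sigma> :: (real ^ 'l::finite mod_ring) set) \<longrightarrow>
      ennreal (c * (\<sigma>\<^sup>2 / sqrt (real n)))
        \<le> minimax_risk n \<sigma> (signals m M \<epsilon> \<sigma> :: (real ^ 'l mod_ring) set)) \<and>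
    minimax_risk n \<sigma> (signals m M \<epsilon> \<sigma> :: (real ^ 'l mod_ring) set)
      \<le> ennreal (C * (\<sigma>\<^sup>2 / sqrt (real n)))"
proof -
  define D where "D = CARD('l) * M"
  define K where "K = 2 * D\<^sup>2 * (1 + 48 * exp 4)"
  \<comment> \<open>The largest \<open>c\<close> with
    \<open>K * c\<^sup>2 \<le> 1 / 5\<close>.\<close>
  define c where "c = sqrt (1 / (5 * K))"
  have D: "D > 0" using assms by (simp add: D_def card_gt_0_iff)
  then have K: "K > 0" unfolding K_def by (intro mult_pos_pos add_pos_pos) auto
  then have c: "c > 0" "K * c\<^sup>2 \<le> 1 / 5" by (simp_all add: c_def)
  \<comment> \<open>Chosen before \<open>\<sigma>\<close>, so that the number of features, which
    enters \<open>C\<close>, does not depend on it.\<close>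
  obtain N :: "(real ^ 'l mod_ring) set" where N: "finite N"
    "\<And>\<theta> \<phi> :: real ^ 'l mod_ring. norm \<theta> \<le> D \<Longrightarrow> norm \<phi> \<le> D \<Longrightarrow> m \<le> rho \<theta> \<phi> \<Longrightarrow>
      \<exists>t\<in>N. orbit_mgf t \<theta> \<noteq> orbit_mgf t \<phi>"
    by (rule orbit_mgf_finite_separating[OF assms(1), of D]) blast
  define B where "B = 8 * (1 + gaussian_moment4 TYPE('l mod_ring))"
  define C where "C = (CARD('l) * (3 * M\<^sup>2 / (2 * m ^ 3)) * (2 * card ((UNIV - {0 :: 'l mod_ring}) <+> N) + 1) + 1) * sqrt B"
  have B: "B > 0" unfolding B_def gaussian_moment4_def by (simp add: add_pos_nonneg)
  have C: "C > 0"
    unfolding C_def using B assms by (intro mult_pos_pos add_nonneg_pos mult_nonneg_nonneg divide_nonneg_nonneg) auto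
  show ?thesis
  proof (intro exI conjI allI impI)
    show "c / 8 > 0" using c by simp
    show "C > 0" by (rule C)
    fix \<sigma> :: real assume \<sigma>: "\<sigma> > 0"
    let ?T = "signals m M \<epsilon> \<sigma> :: (real ^ 'l mod_ring) set"
    have "\<forall>\<^sub>F n in sequentially. infinite ?T \<longrightarrow> ennreal (c / 8 * (\<sigma>\<^sup>2 / sqrt (real n))) \<le> minimax_risk n \<sigma> ?T"
    proof (cases "finite ?T")
      case False
      from minimax_risk_lower_bound[OF assms(1,2) \<sigma> False D_def c(1)] c(2)
      have "\<forall>\<^sub>F n in sequentially. ennreal (c / 8 * (\<sigma>\<^sup>2 / sqrt (real n))) \<le> minimax_risk n \<sigma> ?T"
        by (simp add: K_def)
      then show ?thesis by (rule eventually_mono) blast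
    qed simp
    moreover have "\<forall>\<^sub>F n in sequentially. minimax_risk n \<sigma> ?T \<le> ennreal (C * (\<sigma>\<^sup>2 / sqrt (real n)))"
      unfolding C_def B_def
      by (rule minimax_risk_upper_bound[OF assms(1,2) \<sigma> D_def N])
    ultimately show "\<forall>\<^sub>F n in sequentially. (infinite ?T \<longrightarrow>
        ennreal (c / 8 * (\<sigma>\<^sup>2 / sqrt (real n))) \<le> minimax_risk n \<sigma> ?T) \<and>
      minimax_risk n \<sigma> ?T \<le> ennreal (C * (\<sigma>\<^sup>2 / sqrt (real n)))"
      by (rule eventually_conj)
  qed
qed

end
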